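(* Let $Q$ be one of the quadratic spline quasi-interpolants $S_2$, $W_2^*$ on $\Omega$, and let $|\alpha|=1$. There exists a constant $\overline C_1>0$, with $\overline C_1\le 120$ for $Q=S_2$ and $\overline C_1\le 70$ for $Q=W_2^*$, such that, for every $f\in C^1(\Omega)$, $$\|D^\alpha f-D^\alpha Qf\|_\Omega\le\left[1+\overline C_1\left(\frac h\delta\right)\right]\omega(Df,h/2).$$
   Context: Partition. Let $m,n\ge 1$ be integers, $\Omega=[a,b]\times[c,d]$, $a=x_0<x_1<\dots<x_m=b$ and $c=y_0<y_1<\dots<y_n=d$, with the conventions $x_{-1}=x_0$, $x_{m+1}=x_m$, $y_{-1}=y_0$, $y_{n+1}=y_n$. Put $h_i=x_i-x_{i-1}$, $k_j=y_j-y_{j-1}$ (so $h_0=h_{m+1}=k_0=k_{n+1}=0$), $s_i=\frac12(x_{i-1}+x_i)$, $t_j=\frac12(y_{j-1}+y_j)$ for $0\le i\le m+1$, $0\le j\le n+1$. Put $M_{i,j}=(s_i,t_j)$ for these indices and $A_{i,j}=(x_i,y_j)$ for $-1\le i\le m+1$, $-1\le j\le n+1$. The criss-cross triangulation $\mathcal T_{mn}$ of $\Omega$ is obtained by drawing both diagonals in each subrectangle $\Omega_{ij}=[x_{i-1},x_i]\times[y_{j-1},y_j]$, $1\le i\le m$, $1\le j\le n$. B-splines. Choose extended knots $u_{-2}<u_{-1}<u_0<\dots<u_m<u_{m+1}<u_{m+2}$ with $u_i=x_i$ for $0\le i\le m$, and $v_{-2}<v_{-1}<v_0<\dots<v_n<v_{n+1}<v_{n+2}$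 with $v_j=y_j$ for $0\le j\le n$. For $0\le i\le m+1$, $0\le j\le n+1$, the classical B-spline $\overline B_{ij}$ is the unique $C^1$ function on $\mathbb R^2$ that is a polynomial of total degree at most 2 on each triangle of the criss-cross triangulation (both diagonals in each subrectangle) of the grid $\{u_p\}\times\{v_q\}$, vanishes outside the octagon with vertices $(u_{i-2},v_{j-1}),(u_{i-2},v_j),(u_{i-1},v_{j+1}),(u_i,v_{j+1}),(u_{i+1},v_j),(u_{i+1},v_{j-1}),(u_i,v_{j-2}),(u_{i-1},v_{j-2})$, and is normalized by $\overline B_{ij}(u_i,v_j)=\frac{u_{i+1}-u_i}{u_{i+1}-u_{i-1}}\cdot\frac{v_{j+1}-v_j}{v_{j+1}-v_{j-1}}$. Let $\bar h_0=u_0-u_{-1}$, $\bar h_{m+1}=u_{m+1}-u_m$, $\bar k_0=v_0-v_{-1}$, $\bar k_{n+1}=v_{n+1}-v_n$. Define $\alpha_{00}=\frac{\bar h_0+h_1}{h_1}$, $\alpha_{m+1,m+1}=\frac{h_m+\bar h_{m+1}}{h_m}$, $\alpha_{ii}=1$ for $1\le i\le m$, $\alpha_{1,0}=-\frac{\bar h_0}{h_1}$, $\alpha_{m,m+1}=-\frac{\bar h_{m+1}}{h_m}$, all other $\alpha_{ip}=0$; and define $\beta_{jq}$ in the same way with $n,k,\bar k$ in place of $m,h,\bar h$. The B-spline $B_{ij}$ is the restriction to $\Omega$ of $\sum_{p=0}^{m+1}\sum_{q=0}^{n+1}\alpha_{ip}\beta_{jq}\overline B_{pq}$. The functions $B_{ij}$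 are nonnegative, have supports in $\Omega$, and sum to 1. Quasi-interpolants. For $2\le i\le m$ put $\sigma_i=\frac{h_i}{h_{i-1}+h_i}$, $\sigma_i'=1-\sigma_i$; for $2\le j\le n$ put $\tau_j=\frac{k_j}{k_{j-1}+k_j}$, $\tau_j'=1-\tau_j$; and $\sigma_1=\sigma'_{m+1}=\tau_1=\tau'_{n+1}=1$, $\sigma_1'=\sigma_{m+1}=\tau_1'=\tau_{n+1}=0$. For $1\le i\le m$, $1\le j\le n$, $$a_i=-\frac{\sigma_i^2\sigma_{i+1}'}{\sigma_i+\sigma_{i+1}'},\quad c_i=-\frac{\sigma_i(\sigma_{i+1}')^2}{\sigma_i+\sigma_{i+1}'},\quad \bar a_j=-\frac{\tau_j^2\tau_{j+1}'}{\tau_j+\tau_{j+1}'},\quad \bar c_j=-\frac{\tau_j(\tau_{j+1}')^2}{\tau_j+\tau_{j+1}'},$$ and $a_0=c_0=a_{m+1}=c_{m+1}=\bar a_0=\bar c_0=\bar a_{n+1}=\bar c_{n+1}=0$; $b_{ij}=1-(a_i+c_i+\bar a_j+\bar c_j)$. Then $S_2f=\sum_{i=0}^{m+1}\sum_{j=0}^{n+1}\mu_{ij}(f)B_{ij}$ with $\mu_{ij}(f)=b_{ij}f(M_{i,j})+a_if(M_{i-1,j})+c_if(M_{i+1,j})+\bar a_jf(M_{i,j-1})+\bar c_jf(M_{i,j+1})$ (terms with zero coefficient are omitted), and $W_2^*f=\sum_{i=0}^{m+1}\sum_{j=0}^{n+1}\mu^*_{ij}(f)B_{ij}$ with $\mu^*_{ij}(f)=2f(M_{i,j})-\frac14[f(A_{i-1,j-1})+f(A_{i-1,j})+f(A_{i,j-1})+f(A_{i,j})]$.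 Notation. $h=\max\{h_i,k_j: 1\le i\le m,\,1\le j\le n\}$, $\delta=\min\{h_i,k_j: 1\le i\le m,\,1\le j\le n\}$; $\|\cdot\|_\Omega$ is the supremum norm over $\Omega$; for $\psi\in C(\Omega)$, $\omega(\psi,t)=\max\{|\psi(M)-\psi(P)|: M,P\in\Omega,\ \|MP\|\le t\}$, where $\|MP\|$ is the Euclidean distance; for a multi-index $\alpha=(\alpha_1,\alpha_2)$ of nonnegative integers, $D^\alpha=\frac{\partial^{|\alpha|}}{\partial x^{\alpha_1}\partial y^{\alpha_2}}$ with $|\alpha|=\alpha_1+\alpha_2$; $\omega(D^sf,t)=\max\{\omega(D^\alpha f,t):|\alpha|=s\}$ and $Df=D^1f$. *)

theory Defs
  imports "HOL-Analysis.Analysis"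
begin

section \<open>Calculus on subsets of the plane\<close>

text \<open>
  On a closed nondegenerate rectangle, derivatives are taken within the rectangle
  (so they are one-sided on the boundary).
\<close>

definition C1_on :: "(real \<times> real) set \<Rightarrow> (real \<times> real \<Rightarrow> real) \<Rightarrow> bool" where
  "C1_on S f \<longleftrightarrow>
     (\<exists>f' :: real \<times> real \<Rightarrow> (real \<times> real) \<Rightarrow>\<^sub>L real.
        (\<forall>p\<in>S. (f has_derivative blinfun_apply (f' p)) (at p within S)) \<and> continuous_on S f')"

definition partial_x :: "(real \<times> real) set \<Rightarrow> (real \<times> real \<Rightarrow> real) \<Rightarrow> real \<times> real \<Rightarrow> real" where
  "partial_x S f p =
     vector_derivative (\<lambda>t. f (t, snd p)) (at (fst p) within {t. (t, snd p) \<in> S})"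

definition partial_y :: "(real \<times> real) set \<Rightarrow> (real \<times> real \<Rightarrow> real) \<Rightarrow> real \<times> real \<Rightarrow> real" where
  "partial_y S f p =
     vector_derivative (\<lambda>t. f (fst p, t)) (at (snd p) within {t. (fst p, t) \<in> S})"

definition partial_deriv ::
  "(real \<times> real) set \<Rightarrow> nat \<times> nat \<Rightarrow> (real \<times> real \<Rightarrow> real) \<Rightarrow> real \<times> real \<Rightarrow> real" where
  "partial_deriv S \<alpha> f = (partial_x S ^^ fst \<alpha>) ((partial_y S ^^ snd \<alpha>) f)"

definition sup_norm :: "(real \<times> real) set \<Rightarrow> (real \<times> real \<Rightarrow> real) \<Rightarrow> real" where
  "sup_norm S \<psi> = (SUP p\<in>S. \<bar>\<psi> p\<bar>)"

text \<open>
  For continuous \<open>\<psi>\<close> on a compact set and nonnegative \<open>t\<close> the supremum is attained;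
  \<^const>\<open>dist\<close> on pairs of reals is the Euclidean distance.
\<close>

definition modulus :: "(real \<times> real) set \<Rightarrow> (real \<times> real \<Rightarrow> real) \<Rightarrow> real \<Rightarrow> real" where
  "modulus S \<psi> t = (SUP (M, P) \<in> {(M, P). M \<in> S \<and> P \<in> S \<and> dist M P \<le> t}. \<bar>\<psi> M - \<psi> P\<bar>)"

definition deriv_modulus ::
  "(real \<times> real) set \<Rightarrow> nat \<Rightarrow> (real \<times> real \<Rightarrow> real) \<Rightarrow> real \<Rightarrow> real" where
  "deriv_modulus S s f t =
     Max ((\<lambda>\<alpha>. modulus S (partial_deriv S \<alpha> f) t) ` {\<alpha>. fst \<alpha> + snd \<alpha> = s})"


section \<open>Partitions and extended knots\<close>

text \<open>
  Index sequences are functions on the integers; only the values at the indices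
  \<open>-1, \<dots>, m + 1\<close> (partitions) and \<open>-2, \<dots>, m + 2\<close> (extended knots) are constrained.
\<close>

definition is_partition :: "int \<Rightarrow> real \<Rightarrow> real \<Rightarrow> (int \<Rightarrow> real) \<Rightarrow> bool" where
  "is_partition m a b x \<longleftrightarrow>
     x 0 = a \<and> x m = b \<and> (\<forall>i\<in>{1..m}. x (i - 1) < x i) \<and> x (-1) = x 0 \<and> x (m + 1) = x m"

definition extended_knots :: "int \<Rightarrow> (int \<Rightarrow> real) \<Rightarrow> (int \<Rightarrow> real) \<Rightarrow> bool" where
  "extended_knots m x u \<longleftrightarrow>
     (\<forall>i\<in>{0..m}. u i = x i) \<and> (\<forall>i\<in>{-1..m + 2}. u (i - 1) < u i)"

definition step :: "(int \<Rightarrow> real) \<Rightarrow> int \<Rightarrow> real" where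
  "step x i = x i - x (i - 1)"

definition midpt :: "(int \<Rightarrow> real) \<Rightarrow> int \<Rightarrow> real" where
  "midpt x i = (x (i - 1) + x i) / 2"

definition steps :: "int \<Rightarrow> int \<Rightarrow> (int \<Rightarrow> real) \<Rightarrow> (int \<Rightarrow> real) \<Rightarrow> real set" where
  "steps m n x y = step x ` {1..m} \<union> step y ` {1..n}"

definition mesh_max :: "int \<Rightarrow> int \<Rightarrow> (int \<Rightarrow> real) \<Rightarrow> (int \<Rightarrow> real) \<Rightarrow> real" where
  "mesh_max m n x y = Max (steps m n x y)"

definition mesh_min :: "int \<Rightarrow> int \<Rightarrow> (int \<Rightarrow> real) \<Rightarrow> (int \<Rightarrow> real) \<Rightarrow> real" where
  "mesh_min m n x y = Min (steps m n x y)"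


section \<open>B-splines\<close>

definition quadratic_on :: "(real \<times> real) set \<Rightarrow> (real \<times> real \<Rightarrow> real) \<Rightarrow> bool" where
  "quadratic_on T g \<longleftrightarrow>
     (\<exists>c0 c1 c2 c3 c4 c5. \<forall>(s, t)\<in>T.
        g (s, t) = c0 + c1 * s + c2 * t + c3 * s\<^sup>2 + c4 * s * t + c5 * t\<^sup>2)"

text \<open>The four triangles cut from a rectangle by its two diagonals.\<close>

definition rect_triangles :: "real \<Rightarrow> real \<Rightarrow> real \<Rightarrow> real \<Rightarrow> (real \<times> real) set set" where
  "rect_triangles x0 x1 y0 y1 =
     (let M = ((x0 + x1) / 2, (y0 + y1) / 2) in
      {convex hull {(x0, y0), (x1, y0), M},
       convex hull {(x1, y0), (x1, y1), M},
       convex hull {(x1, y1), (x0, y1), M},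
       convex hull {(x0, y1), (x0, y0), M}})"

definition extended_triangulation ::
  "int \<Rightarrow> int \<Rightarrow> (int \<Rightarrow> real) \<Rightarrow> (int \<Rightarrow> real) \<Rightarrow> (real \<times> real) set set" where
  "extended_triangulation m n u v =
     (\<Union>p\<in>{-1..m + 2}. \<Union>q\<in>{-1..n + 2}. rect_triangles (u (p - 1)) (u p) (v (q - 1)) (v q))"

definition octagon ::
  "(int \<Rightarrow> real) \<Rightarrow> (int \<Rightarrow> real) \<Rightarrow> int \<Rightarrow> int \<Rightarrow> (real \<times> real) set" where
  "octagon u v i j = convex hull
     {(u (i - 2), v (j - 1)), (u (i - 2), v j), (u (i - 1), v (j + 1)), (u i, v (j + 1)),
      (u (i + 1), v j), (u (i + 1), v (j - 1)), (u i, v (j - 2)), (u (i - 1), v (j - 2))}"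

definition is_classical_bspline ::
  "int \<Rightarrow> int \<Rightarrow> (int \<Rightarrow> real) \<Rightarrow> (int \<Rightarrow> real) \<Rightarrow> int \<Rightarrow> int \<Rightarrow> (real \<times> real \<Rightarrow> real) \<Rightarrow> bool" where
  "is_classical_bspline m n u v i j g \<longleftrightarrow>
     C1_on UNIV g \<and>
     (\<forall>T\<in>extended_triangulation m n u v. quadratic_on T g) \<and>
     (\<forall>p. p \<notin> octagon u v i j \<longrightarrow> g p = 0) \<and>
     g (u i, v j) = (u (i + 1) - u i) / (u (i + 1) - u (i - 1)) *
                    ((v (j + 1) - v j) / (v (j + 1) - v (j - 1)))"

definition classical_bspline ::
  "int \<Rightarrow> int \<Rightarrow> (int \<Rightarrow> real) \<Rightarrow> (int \<Rightarrow> real) \<Rightarrow> int \<Rightarrow> int \<Rightarrow> real \<times> real \<Rightarrow> real" where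
  "classical_bspline m n u v i j = (THE g. is_classical_bspline m n u v i j g)"

text \<open>
  The same definition serves both directions: it gives \<open>\<alpha>\<close> from \<open>(m, x, u)\<close>
  and \<open>\<beta>\<close> from \<open>(n, y, v)\<close>. The outer steps of the extended knots
  are \<open>step u 0\<close> and \<open>step u (m + 1)\<close>.
\<close>

definition boundary_coeff ::
  "int \<Rightarrow> (int \<Rightarrow> real) \<Rightarrow> (int \<Rightarrow> real) \<Rightarrow> int \<Rightarrow> int \<Rightarrow> real" where
  "boundary_coeff m x u i p =
     (if i = 0 \<and> p = 0 then (step u 0 + step x 1) / step x 1
      else if i = m + 1 \<and> p = m + 1 then (step x m + step u (m + 1)) / step x m
      else if 1 \<le> i \<and> i \<le> m \<and> p = i then 1
      else if i = 1 \<and> p = 0 then - (step u 0 / step x 1)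
      else if i = m \<and> p = m + 1 then - (step u (m + 1) / step x m)
      else 0)"

text \<open>
  The restriction to the rectangle is left implicit: the functions below are only
  evaluated and differentiated within the rectangle.
\<close>

definition bspline ::
  "int \<Rightarrow> int \<Rightarrow> (int \<Rightarrow> real) \<Rightarrow> (int \<Rightarrow> real) \<Rightarrow> (int \<Rightarrow> real) \<Rightarrow> (int \<Rightarrow> real) \<Rightarrow>
   int \<Rightarrow> int \<Rightarrow> real \<times> real \<Rightarrow> real" where
  "bspline m n x y u v i j z =
     (\<Sum>p\<in>{0..m + 1}. \<Sum>q\<in>{0..n + 1}.
        boundary_coeff m x u i p * boundary_coeff n y v j q * classical_bspline m n u v p q z)"


section \<open>Quasi-interpolants\<close>

definition sigma :: "int \<Rightarrow> (int \<Rightarrow> real) \<Rightarrow> int \<Rightarrow> real" where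
  "sigma m x i =
     (if i = 1 then 1 else if i = m + 1 then 0 else step x i / (step x (i - 1) + step x i))"

definition sigma' :: "int \<Rightarrow> (int \<Rightarrow> real) \<Rightarrow> int \<Rightarrow> real" where
  "sigma' m x i =
     (if i = 1 then 0 else if i = m + 1 then 1 else 1 - sigma m x i)"

definition coeff_a :: "int \<Rightarrow> (int \<Rightarrow> real) \<Rightarrow> int \<Rightarrow> real" where
  "coeff_a m x i =
     (if 1 \<le> i \<and> i \<le> m
      then - ((sigma m x i)\<^sup>2 * sigma' m x (i + 1) / (sigma m x i + sigma' m x (i + 1)))
      else 0)"

definition coeff_c :: "int \<Rightarrow> (int \<Rightarrow> real) \<Rightarrow> int \<Rightarrow> real" where
  "coeff_c m x i =
     (if 1 \<le> i \<and> i \<le> m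
      then - (sigma m x i * (sigma' m x (i + 1))\<^sup>2 / (sigma m x i + sigma' m x (i + 1)))
      else 0)"

definition coeff_b ::
  "int \<Rightarrow> int \<Rightarrow> (int \<Rightarrow> real) \<Rightarrow> (int \<Rightarrow> real) \<Rightarrow> int \<Rightarrow> int \<Rightarrow> real" where
  "coeff_b m n x y i j = 1 - (coeff_a m x i + coeff_c m x i + coeff_a n y j + coeff_c n y j)"

text \<open>
  When \<open>i\<close> or \<open>j\<close> is extremal, the data sites with an index out of range carry the coefficient 0.
\<close>

definition mu_S2 ::
  "int \<Rightarrow> int \<Rightarrow> (int \<Rightarrow> real) \<Rightarrow> (int \<Rightarrow> real) \<Rightarrow> (real \<times> real \<Rightarrow> real) \<Rightarrow> int \<Rightarrow> int \<Rightarrow> real" where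
  "mu_S2 m n x y f i j =
     coeff_b m n x y i j * f (midpt x i, midpt y j) +
     coeff_a m x i * f (midpt x (i - 1), midpt y j) +
     coeff_c m x i * f (midpt x (i + 1), midpt y j) +
     coeff_a n y j * f (midpt x i, midpt y (j - 1)) +
     coeff_c n y j * f (midpt x i, midpt y (j + 1))"

definition S2 ::
  "int \<Rightarrow> int \<Rightarrow> (int \<Rightarrow> real) \<Rightarrow> (int \<Rightarrow> real) \<Rightarrow> (int \<Rightarrow> real) \<Rightarrow> (int \<Rightarrow> real) \<Rightarrow>
   (real \<times> real \<Rightarrow> real) \<Rightarrow> real \<times> real \<Rightarrow> real" where
  "S2 m n x y u v f z =
     (\<Sum>i\<in>{0..m + 1}. \<Sum>j\<in>{0..n + 1}. mu_S2 m n x y f i j * bspline m n x y u v i j z)"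

definition mu_W2 ::
  "(int \<Rightarrow> real) \<Rightarrow> (int \<Rightarrow> real) \<Rightarrow> (real \<times> real \<Rightarrow> real) \<Rightarrow> int \<Rightarrow> int \<Rightarrow> real" where
  "mu_W2 x y f i j =
     2 * f (midpt x i, midpt y j) -
     (f (x (i - 1), y (j - 1)) + f (x (i - 1), y j) + f (x i, y (j - 1)) + f (x i, y j)) / 4"

definition W2 ::
  "int \<Rightarrow> int \<Rightarrow> (int \<Rightarrow> real) \<Rightarrow> (int \<Rightarrow> real) \<Rightarrow> (int \<Rightarrow> real) \<Rightarrow> (int \<Rightarrow> real) \<Rightarrow>
   (real \<times> real \<Rightarrow> real) \<Rightarrow> real \<times> real \<Rightarrow> real" where
  "W2 m n x y u v f z =
     (\<Sum>i\<in>{0..m + 1}. \<Sum>j\<in>{0..n + 1}. mu_W2 x y f i j * bspline m n x y u v i j z)"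

end

theory Submission
  imports Defs
begin

text \<open>
  The partial derivative \<open>\<partial>(Qf)/\<partial>x\<close> is continuous and affine on every triangle, so on a cell of the
  grid it is an average of its values at the four vertices and at the centre. These five values are
  themselves averages of the divided differences
  \<open>(\<mu>(i+1,j) - \<mu>(i,j)) / (s(i+1) - s(i))\<close> of the functional values \<open>\<mu>(i,j) = \<mu>\<^sub>i\<^sub>j(f)\<close> along rows of the
  centres \<open>M(i,j) = (s(i), t(j))\<close> of nearby cells (\<open>spline_dx_bound\<close>). Both functionals reproduce affine
  functions, hence differ from \<open>f(M(i,j))\<close> by at most \<open>K h \<omega>\<close>, where \<open>\<omega> = \<omega>(Df, h/2)\<close> and \<open>K\<close> is 4 for
  \<open>S\<^sub>2\<close> and 2 for \<open>W\<^sub>2\<^sup>*\<close>. Since \<open>s(i+1) - s(i) \<ge> \<delta>/2\<close>, a divided difference of the \<open>\<mu>\<close> differs from one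
  of \<open>f\<close> by at most \<open>4 K (h/\<delta>) \<omega>\<close>; and a divided difference of \<open>f\<close> near a point is within \<open>8 \<omega>\<close> of
  \<open>\<partial>f/\<partial>x\<close> at this point, because the points involved are at most \<open>3 h\<close> away from it. The sum
  \<open>(8 + 4 K h/\<delta>) \<omega>\<close> is at most \<open>(1 + (7 + 4 K) h/\<delta>) \<omega>\<close>, which gives the constants 23 and 15. The other
  partial derivative is the same statement with the two coordinates exchanged.

  This argument needs the splines in closed form, whereas the classical B-spline is given as the unique
  function with certain properties. The closed form uses Bernstein-Bezier coefficients. A \<open>C\<^sup>1\<close> quadratic
  spline on one cell is determined by eight of them, four at the corners and four in the middle of the edges
  (\<open>patch\<close>). A control net \<open>w\<close>, with \<open>w(i,j)\<close> placed at the centre of the cell \<open>(i,j)\<close>, produces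
  such eight numbers for every cell: an edge gets an interpolation of the two net values at its sides, a
  vertex the corresponding interpolation of the four surrounding ones. The patches then fit together to a
  \<open>C\<^sup>1\<close> function (\<open>C1_on_spline\<close>). The net with a single entry 1 has all the properties required of the
  classical B-spline, and these properties leave no choice: first the grid lines and then the interiors
  of the cells are determined (\<open>classical_bspline_eq_spline\<close>). By linearity \<open>Qf\<close> is the spline of a net
  computed from the \<open>\<mu>(i,j)\<close>; the boundary coefficients \<open>\<alpha>\<close> and \<open>\<beta>\<close> have the effect that near the
  boundary this spline looks as if the outer knots coincided with the boundary
  (\<open>quasi_interpolant_eq_spline\<close>, \<open>boundary_lift_knots\<close>).
\<close>

section \<open>Quadratic \<open>C\<^sup>1\<close> patches on a rectangle with both diagonals\<close>

text \<open>
  The function \<open>t\<bar>t\<bar>\<close> is the prototype of a \<open>C\<^sup>1\<close> piecewise quadratic; with \<open>t = X + Y\<close> and \<open>t = X - Y\<close>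
  it accounts for the breaks of a patch along the two diagonals.
\<close>

lemma has_real_derivative_mult_abs: "((\<lambda>t. t * \<bar>t\<bar>) has_real_derivative 2 * \<bar>t\<bar>) (at t)" for t :: real
proof (cases "t = 0")
  case True
  have "((\<lambda>h::real. \<bar>h\<bar>) \<longlongrightarrow> \<bar>0\<bar>) (at 0)" by (intro tendsto_intros)
  also have "?this \<longleftrightarrow> ((\<lambda>h::real. (h * \<bar>h\<bar> - 0 * \<bar>0\<bar>) / (h - 0)) \<longlongrightarrow> 0) (at 0)"
    by (rule filterlim_cong) (auto simp: eventually_at_filter)
  finally have "((\<lambda>h::real. (h * \<bar>h\<bar> - 0 * \<bar>0\<bar>) / (h - 0)) \<longlongrightarrow> 0) (at 0)" .
  then show ?thesis using True by (simp add: has_field_derivative_iff)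
next
  case False
  then consider "t > 0" | "t < 0" by linarith
  then show ?thesis
  proof cases
    case 1
    have "((\<lambda>t. t * t) has_real_derivative 2 * \<bar>t\<bar>) (at t)"
      using 1 by (auto intro!: derivative_eq_intros)
    then show ?thesis
      by (rule has_field_derivative_transform_within_open[of _ _ _ "{0<..}"]) (use 1 in auto)
  next
    case 2
    have "((\<lambda>t. - (t * t)) has_real_derivative 2 * \<bar>t\<bar>) (at t)"
      using 2 by (auto intro!: derivative_eq_intros)
    then show ?thesis
      by (rule has_field_derivative_transform_within_open[of _ _ _ "{..<0}"]) (use 2 in auto)
  qed
qed

text \<open>
  The general \<open>C\<^sup>1\<close> piecewise quadratic on the square \<open>[-1,1]\<times>[-1,1]\<close> cut by its diagonals, parametrised by
  its Bernstein-Bezier coefficients on the boundary: \<open>c00\<close>, \<open>c10\<close>, \<open>c01\<close>, \<open>c11\<close> are the values at the corners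
  \<open>(-1,-1)\<close>, \<open>(1,-1)\<close>, \<open>(-1,1)\<close>, \<open>(1,1)\<close>, and \<open>pb\<close>, \<open>pt\<close>, \<open>ql\<close>, \<open>qr\<close> are the middle coefficients of the
  bottom, top, left and right edge. The space has dimension 8, being spanned by the six monomials
  and by \<open>(X \<plusminus> Y)\<bar>X \<plusminus> Y\<bar>\<close>, so these eight numbers can be prescribed.
\<close>

definition patch ::
  "real \<Rightarrow> real \<Rightarrow> real \<Rightarrow> real \<Rightarrow> real \<Rightarrow> real \<Rightarrow> real \<Rightarrow> real \<Rightarrow> real \<Rightarrow> real \<Rightarrow> real" where
  "patch pb pt ql qr c00 c10 c01 c11 X Y =
     (pb + pt + ql + qr) / 4 + (qr - ql) / 2 * X + (pt - pb) / 2 * Y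
     + (c00 + c10 + c01 + c11 - 2 * pb - 2 * pt) / 8 * X\<^sup>2
     + (c11 + c00 - c10 - c01) / 4 * (X * Y)
     + (c00 + c10 + c01 + c11 - 2 * ql - 2 * qr) / 8 * Y\<^sup>2
     + (c11 - c00 - pt + pb - qr + ql) / 8 * ((X + Y) * \<bar>X + Y\<bar>)
     + (c10 - c01 + pt - pb - qr + ql) / 8 * ((X - Y) * \<bar>X - Y\<bar>)"

text \<open>
  The derivative of a patch with respect to \<open>X\<close>, written in the nodal basis of the continuous piecewise affine
  functions: the five factors depending on \<open>X\<close> and \<open>Y\<close> are the hat functions of the centre and of the corners.
  The derivative with respect to \<open>Y\<close> is obtained by exchanging the coordinates.
\<close>

definition patch_dx ::
  "real \<Rightarrow> real \<Rightarrow> real \<Rightarrow> real \<Rightarrow> real \<Rightarrow> real \<Rightarrow> real \<Rightarrow> real \<Rightarrow> real \<Rightarrow> real \<Rightarrow> real" where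
  "patch_dx pb pt ql qr c00 c10 c01 c11 X Y =
     (qr - ql) / 2 * (1 - (\<bar>X + Y\<bar> + \<bar>X - Y\<bar>) / 2)
     + (c11 - pt) * ((\<bar>X + Y\<bar> + (X + Y)) / 4) + (pb - c00) * ((\<bar>X + Y\<bar> - (X + Y)) / 4)
     + (c10 - pb) * ((\<bar>X - Y\<bar> + (X - Y)) / 4) + (pt - c01) * ((\<bar>X - Y\<bar> - (X - Y)) / 4)"

lemma patch_swap:
  "patch pb pt ql qr c00 c10 c01 c11 X Y = patch ql qr pb pt c00 c01 c10 c11 Y X"
proof -
  have "\<bar>Y - X\<bar> = \<bar>X - Y\<bar>" "\<bar>Y + X\<bar> = \<bar>X + Y\<bar>" by linarith+
  then show ?thesis unfolding patch_def by (simp only:) (simp add: field_simps)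
qed

lemma has_derivative_mult_abs [derivative_intros]:
  assumes "(f has_derivative f') (at x within S)"
  shows "((\<lambda>x. f x * \<bar>f x\<bar> :: real) has_derivative (\<lambda>d. 2 * \<bar>f x\<bar> * f' d)) (at x within S)"
  using has_derivative_compose[OF assms
      has_real_derivative_mult_abs[unfolded has_field_derivative_def]]
  by (simp add: o_def)

lemma patch_has_derivative:
  assumes "(f has_derivative f') (at z within S)" "(g has_derivative g') (at z within S)"
  shows "((\<lambda>z. patch pb pt ql qr c00 c10 c01 c11 (f z) (g z)) has_derivative
    (\<lambda>d. patch_dx pb pt ql qr c00 c10 c01 c11 (f z) (g z) * f' d
       + patch_dx ql qr pb pt c00 c01 c10 c11 (g z) (f z) * g' d)) (at z within S)"
proof -
  have eq: "\<bar>g z - f z\<bar> = \<bar>f z - g z\<bar>" "\<bar>g z + f z\<bar> = \<bar>f z + g z\<bar>" by linarith+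
  show ?thesis
    unfolding patch_def
    by (rule derivative_eq_intros assms refl)+
      (simp add: patch_dx_def eq fun_eq_iff field_simps)
qed

text \<open>
  On an edge only the three coefficients of this edge matter, which makes neighbouring patches fit together.
  The normal derivative is affine along an edge, so its agreement reduces to the end points.
\<close>

lemma patch_right:
  assumes "\<bar>Y\<bar> \<le> 1"
  shows "patch pb pt ql qr c00 c10 c01 c11 1 Y =
    (c10 * (1 - Y)\<^sup>2 + 2 * qr * (1 - Y) * (1 + Y) + c11 * (1 + Y)\<^sup>2) / 4"
proof -
  have "\<bar>1 + Y\<bar> = 1 + Y" "\<bar>1 - Y\<bar> = 1 - Y" using assms by auto
  then show ?thesis unfolding patch_def by (simp only:) (simp add: field_simps power2_eq_square)
qed

lemma patch_left:
  assumes "\<bar>Y\<bar> \<le> 1"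
  shows "patch pb pt ql qr c00 c10 c01 c11 (- 1) Y =
    (c00 * (1 - Y)\<^sup>2 + 2 * ql * (1 - Y) * (1 + Y) + c01 * (1 + Y)\<^sup>2) / 4"
proof -
  have "\<bar>- 1 + Y\<bar> = 1 - Y" "\<bar>- 1 - Y\<bar> = 1 + Y" using assms by auto
  then show ?thesis unfolding patch_def by (simp only:) (simp add: field_simps power2_eq_square)
qed

lemma patch_dx_right:
  assumes "\<bar>Y\<bar> \<le> 1"
  shows "patch_dx pb pt ql qr c00 c10 c01 c11 1 Y = (c10 - pb) * ((1 - Y) / 2) + (c11 - pt) * ((1 + Y) / 2)"
proof -
  have "\<bar>1 + Y\<bar> = 1 + Y" "\<bar>1 - Y\<bar> = 1 - Y" using assms by auto
  then show ?thesis unfolding patch_dx_def by (simp only:) (simp add: field_simps)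
qed

lemma patch_dx_left:
  assumes "\<bar>Y\<bar> \<le> 1"
  shows "patch_dx pb pt ql qr c00 c10 c01 c11 (- 1) Y = (pb - c00) * ((1 - Y) / 2) + (pt - c01) * ((1 + Y) / 2)"
proof -
  have "\<bar>- 1 + Y\<bar> = 1 - Y" "\<bar>- 1 - Y\<bar> = 1 + Y" using assms by auto
  then show ?thesis unfolding patch_dx_def by (simp only:) (simp add: field_simps)
qed

lemma patch_dx_top:
  assumes "\<bar>X\<bar> \<le> 1"
  shows "patch_dx pb pt ql qr c00 c10 c01 c11 X 1 = (c11 - pt) * ((1 + X) / 2) + (pt - c01) * ((1 - X) / 2)"
proof -
  have "\<bar>X + 1\<bar> = 1 + X" "\<bar>X - 1\<bar> = 1 - X" using assms by auto
  then show ?thesis unfolding patch_dx_def by (simp only:) (simp add: field_simps)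
qed

lemma patch_dx_bottom:
  assumes "\<bar>X\<bar> \<le> 1"
  shows "patch_dx pb pt ql qr c00 c10 c01 c11 X (- 1) = (c10 - pb) * ((1 + X) / 2) + (pb - c00) * ((1 - X) / 2)"
proof -
  have "\<bar>X + - 1\<bar> = 1 - X" "\<bar>X - - 1\<bar> = 1 + X" using assms by auto
  then show ?thesis unfolding patch_dx_def by (simp only:) (simp add: field_simps)
qed

lemma patch_linear:
  "patch (a * b1 + c1) (a * b2 + c2) (a * b3 + c3) (a * b4 + c4) (a * b5 + c5) (a * b6 + c6)
     (a * b7 + c7) (a * b8 + c8) X Y
    = a * patch b1 b2 b3 b4 b5 b6 b7 b8 X Y + patch c1 c2 c3 c4 c5 c6 c7 c8 X Y"
proof -
  have poly: "k0 + k1 * X + k2 * Y + k3 * X2 + k4 * XY + k5 * Y2 + k6 * S + k7 * D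
      = a * (l0 + l1 * X + l2 * Y + l3 * X2 + l4 * XY + l5 * Y2 + l6 * S + l7 * D)
        + (m0 + m1 * X + m2 * Y + m3 * X2 + m4 * XY + m5 * Y2 + m6 * S + m7 * D)"
    if "k0 = a * l0 + m0" "k1 = a * l1 + m1" "k2 = a * l2 + m2" "k3 = a * l3 + m3" "k4 = a * l4 + m4"
      "k5 = a * l5 + m5" "k6 = a * l6 + m6" "k7 = a * l7 + m7"
    for k0 k1 k2 k3 k4 k5 k6 k7 l0 l1 l2 l3 l4 l5 l6 l7 m0 m1 m2 m3 m4 m5 m6 m7 X Y X2 XY Y2 S D :: real
    unfolding that by (simp only: algebra_simps)
  show ?thesis unfolding patch_def by (rule poly) (simp_all only: field_simps, argo+)
qed

text \<open>
  If the only nonzero coefficient belongs to a corner, the patch is a multiple of \<open>(X + Y)\<^sub>+\<^sup>2\<close> or of one of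
  its reflections. This is what cuts the corners off the support of the B-spline.
\<close>

lemma patch_corner_zero:
  "X + Y \<le> 0 \<Longrightarrow> patch 0 0 0 0 0 0 0 c X Y = 0"
  "0 \<le> X + Y \<Longrightarrow> patch 0 0 0 0 c 0 0 0 X Y = 0"
  "X \<le> Y \<Longrightarrow> patch 0 0 0 0 0 c 0 0 X Y = 0"
  "Y \<le> X \<Longrightarrow> patch 0 0 0 0 0 0 c 0 X Y = 0"
  unfolding patch_def by (simp_all add: power2_eq_square algebra_simps)

text \<open>
  The hat functions are nonnegative and sum to 1, so the derivative is an average of its five nodal values.
  The factor \<open>t\<close> stands for the derivative of the local coordinate.
\<close>

lemma patch_dx_bound:
  assumes XY: "\<bar>X\<bar> \<le> 1" "\<bar>Y\<bar> \<le> 1" and t: "t \<ge> 0"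
    and "\<bar>t * ((qr - ql) / 2) - D\<bar> \<le> E"
    and "\<bar>t * (c11 - pt) - D\<bar> \<le> E" "\<bar>t * (pb - c00) - D\<bar> \<le> E"
    and "\<bar>t * (c10 - pb) - D\<bar> \<le> E" "\<bar>t * (pt - c01) - D\<bar> \<le> E"
  shows "\<bar>t * patch_dx pb pt ql qr c00 c10 c01 c11 X Y - D\<bar> \<le> E"
proof -
  define w0 where "w0 = 1 - (\<bar>X + Y\<bar> + \<bar>X - Y\<bar>) / 2"
  define w1 where "w1 = (\<bar>X + Y\<bar> + (X + Y)) / 4"
  define w2 where "w2 = (\<bar>X + Y\<bar> - (X + Y)) / 4"
  define w3 where "w3 = (\<bar>X - Y\<bar> + (X - Y)) / 4"
  define w4 where "w4 = (\<bar>X - Y\<bar> - (X - Y)) / 4"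
  have nn: "w0 \<ge> 0" "w1 \<ge> 0" "w2 \<ge> 0" "w3 \<ge> 0" "w4 \<ge> 0"
    using XY unfolding w0_def w1_def w2_def w3_def w4_def by (auto simp: abs_if)
  have sum1: "w0 + w1 + w2 + w3 + w4 = 1"
    unfolding w0_def w1_def w2_def w3_def w4_def by (simp add: field_simps)
  have "t * patch_dx pb pt ql qr c00 c10 c01 c11 X Y - D =
    t * patch_dx pb pt ql qr c00 c10 c01 c11 X Y - D * (w0 + w1 + w2 + w3 + w4)"
    by (simp add: sum1)
  also have "\<dots> = w0 * (t * ((qr - ql) / 2) - D) + w1 * (t * (c11 - pt) - D) + w2 * (t * (pb - c00) - D)
      + w3 * (t * (c10 - pb) - D) + w4 * (t * (pt - c01) - D)"
    unfolding patch_dx_def w0_def[symmetric] w1_def[symmetric] w2_def[symmetric] w3_def[symmetric]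
      w4_def[symmetric] by (simp add: algebra_simps)
  also have "\<bar>\<dots>\<bar> \<le> w0 * E + w1 * E + w2 * E + w3 * E + w4 * E"
  proof -
    have *: "\<bar>w * r\<bar> \<le> w * E" if "w \<ge> 0" "\<bar>r\<bar> \<le> E" for w r
      using that by (simp add: abs_mult mult_left_mono)
    show ?thesis
      using *[OF nn(1) assms(4)] *[OF nn(2) assms(5)] *[OF nn(3) assms(6)]
        *[OF nn(4) assms(7)] *[OF nn(5) assms(8)] by linarith
  qed
  also have "\<dots> = E" using sum1 by (simp flip: distrib_right)
  finally show ?thesis .
qed

section \<open>Splines from control nets\<close>

text \<open>
  The value at the knot \<open>u i\<close> of the univariate quadratic spline with B-spline coefficients \<open>w\<close>; equivalently,
  the value there of the affine function with the values \<open>w i\<close> and \<open>w (i + 1)\<close> at the midpoints of the two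
  intervals that meet in \<open>u i\<close>.
\<close>

definition knot_value :: "(int \<Rightarrow> real) \<Rightarrow> (int \<Rightarrow> real) \<Rightarrow> int \<Rightarrow> real" where
  "knot_value u w i = (step u (i + 1) * w i + step u i * w (i + 1)) / (step u i + step u (i + 1))"

definition vertex :: "(int \<Rightarrow> real) \<Rightarrow> (int \<Rightarrow> real) \<Rightarrow> (int \<Rightarrow> int \<Rightarrow> real) \<Rightarrow> int \<Rightarrow> int \<Rightarrow> real" where
  "vertex u v w i j = knot_value u (\<lambda>p. knot_value v (w p) j) i"

definition local_coord :: "(int \<Rightarrow> real) \<Rightarrow> int \<Rightarrow> real \<Rightarrow> real" where
  "local_coord u i t = (2 * t - u (i - 1) - u i) / step u i"

text \<open>
  The net values \<open>w i j\<close> sit at the centres of the cells. The middle coefficient of an edge interpolates the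
  two cells at its sides, and the value at a vertex the four cells around it.
\<close>

definition cell_spline ::
  "(int \<Rightarrow> real) \<Rightarrow> (int \<Rightarrow> real) \<Rightarrow> (int \<Rightarrow> int \<Rightarrow> real) \<Rightarrow> int \<Rightarrow> int \<Rightarrow> real \<times> real \<Rightarrow> real" where
  "cell_spline u v w i j z = patch (knot_value v (w i) (j - 1)) (knot_value v (w i) j)
     (knot_value u (\<lambda>p. w p j) (i - 1)) (knot_value u (\<lambda>p. w p j) i)
     (vertex u v w (i - 1) (j - 1)) (vertex u v w i (j - 1)) (vertex u v w (i - 1) j) (vertex u v w i j)
     (local_coord u i (fst z)) (local_coord v j (snd z))"

definition cell_spline_dx ::
  "(int \<Rightarrow> real) \<Rightarrow> (int \<Rightarrow> real) \<Rightarrow> (int \<Rightarrow> int \<Rightarrow> real) \<Rightarrow> int \<Rightarrow> int \<Rightarrow> real \<times> real \<Rightarrow> real" where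
  "cell_spline_dx u v w i j z = 2 / step u i *
     patch_dx (knot_value v (w i) (j - 1)) (knot_value v (w i) j)
     (knot_value u (\<lambda>p. w p j) (i - 1)) (knot_value u (\<lambda>p. w p j) i)
     (vertex u v w (i - 1) (j - 1)) (vertex u v w i (j - 1)) (vertex u v w (i - 1) j) (vertex u v w i j)
     (local_coord u i (fst z)) (local_coord v j (snd z))"

abbreviation (input) transpose_net :: "(int \<Rightarrow> int \<Rightarrow> real) \<Rightarrow> int \<Rightarrow> int \<Rightarrow> real" where
  "transpose_net w \<equiv> \<lambda>i j. w j i"

definition cell_index :: "(int \<Rightarrow> real) \<Rightarrow> real \<Rightarrow> int" where
  "cell_index u t = (SOME i. u (i - 1) < t \<and> t \<le> u i)"

definition spline ::
  "(int \<Rightarrow> real) \<Rightarrow> (int \<Rightarrow> real) \<Rightarrow> (int \<Rightarrow> int \<Rightarrow> real) \<Rightarrow> real \<times> real \<Rightarrow> real" where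
  "spline u v w z = cell_spline u v w (cell_index u (fst z)) (cell_index v (snd z)) z"

definition spline_dx ::
  "(int \<Rightarrow> real) \<Rightarrow> (int \<Rightarrow> real) \<Rightarrow> (int \<Rightarrow> int \<Rightarrow> real) \<Rightarrow> real \<times> real \<Rightarrow> real" where
  "spline_dx u v w z = cell_spline_dx u v w (cell_index u (fst z)) (cell_index v (snd z)) z"

text \<open>
  Interpolation in the two directions commutes, so the whole construction is symmetric under exchange of the
  coordinates. This is used to derive every statement about \<open>y\<close> from the one about \<open>x\<close>.
\<close>

lemma vertex_transpose: "vertex v u (transpose_net w) j i = vertex u v w i j"
proof -
  have *: "(a * ((b * p + c * q) / S) + d * ((b * r + c * s) / S)) / T
      = (b * ((a * p + d * r) / T) + c * ((a * q + d * s) / T)) / S" for a b c d p q r s S T :: real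
    by (cases "S = 0"; cases "T = 0") (simp_all add: field_simps)
  show ?thesis unfolding vertex_def knot_value_def by (rule * )
qed

lemma cell_spline_transpose:
  "cell_spline v u (transpose_net w) j i (prod.swap z) = cell_spline u v w i j z"
  unfolding cell_spline_def by (subst patch_swap) (simp add: vertex_transpose[of v u w])

lemma cell_spline_has_derivative:
  "(cell_spline u v w i j has_derivative
     (\<lambda>d. cell_spline_dx u v w i j z * fst d
        + cell_spline_dx v u (transpose_net w) j i (prod.swap z) * snd d)) (at z within S)"
proof -
  have 1: "((\<lambda>z. local_coord u i (fst z)) has_derivative (\<lambda>d. 2 / step u i * fst d)) (at z within S)"
    unfolding local_coord_def divide_inverse by (auto intro!: derivative_eq_intros simp: fun_eq_iff)
  have 2: "((\<lambda>z. local_coord v j (snd z)) has_derivative (\<lambda>d. 2 / step v j * snd d)) (at z within S)"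
    unfolding local_coord_def divide_inverse by (auto intro!: derivative_eq_intros simp: fun_eq_iff)
  show ?thesis
    unfolding cell_spline_def
    by (rule has_derivative_eq_rhs[OF patch_has_derivative[OF 1 2]])
      (simp add: cell_spline_dx_def fun_eq_iff vertex_transpose[of v u w] mult_ac)
qed

lemma continuous_on_cell_spline_dx: "continuous_on S (cell_spline_dx u v w i j)"
  unfolding cell_spline_dx_def patch_dx_def local_coord_def divide_inverse by (intro continuous_intros)

subsection \<open>Gluing\<close>

definition cell :: "(int \<Rightarrow> real) \<Rightarrow> (int \<Rightarrow> real) \<Rightarrow> int \<Rightarrow> int \<Rightarrow> (real \<times> real) set" where
  "cell u v i j = {u (i - 1)..u i} \<times> {v (j - 1)..v j}"

text \<open>
  Knots that divide the whole line into half-open intervals, so that every point of the plane has its cell.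
\<close>

definition knot_line :: "(int \<Rightarrow> real) \<Rightarrow> bool" where
  "knot_line u \<longleftrightarrow> (\<forall>i. 0 < step u i) \<and> (\<forall>t. \<exists>i. u (i - 1) < t \<and> t \<le> u i)"

lemma knot_line_step: "knot_line u \<Longrightarrow> 0 < step u i"
  by (simp add: knot_line_def)

lemma knot_line_strict_mono:
  assumes "knot_line u" shows "strict_mono u"
proof (rule strict_monoI)
  fix i j :: int assume "i < j"
  then show "u i < u j"
  proof (induction j rule: int_gr_induct)
    case base
    show ?case using knot_line_step[OF assms, of "i + 1"] by (simp add: step_def)
  next
    case (step j)
    then show ?case using knot_line_step[OF assms, of "j + 1"] by (simp add: step_def)
  qed
qed

lemma cell_index:
  assumes "knot_line u" shows "u (cell_index u t - 1) < t" "t \<le> u (cell_index u t)"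
  using someI_ex[of "\<lambda>i. u (i - 1) < t \<and> t \<le> u i"] assms
  unfolding knot_line_def cell_index_def by blast+

text \<open>
  Cells are selected by half-open intervals. A point of a closed cell lies in the selected one, unless it is on
  the left end, where the preceding interval is selected; there the two patches must agree.
\<close>

lemma cell_index_cases:
  assumes "knot_line u" "u (i - 1) \<le> t" "t \<le> u i"
  obtains "cell_index u t = i" | "cell_index u t = i - 1" "t = u (i - 1)"
proof -
  note mono = strict_mono_less[OF knot_line_strict_mono[OF assms(1)]]
    strict_mono_less_eq[OF knot_line_strict_mono[OF assms(1)]]
  let ?k = "cell_index u t"
  have "u (?k - 1) < u i" "u (i - 1) \<le> u ?k"
    using cell_index[OF assms(1), of t] assms(2,3) by linarith+
  then have "?k = i \<or> ?k = i - 1" by (auto simp: mono)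
  moreover have "t = u (i - 1)" if "?k = i - 1"
    using cell_index(2)[OF assms(1), of t] assms(2) that by simp
  ultimately show thesis using that by blast
qed

lemma local_coord_bounds:
  assumes "0 < step u i" "t \<in> {u (i - 1)..u i}" shows "\<bar>local_coord u i t\<bar> \<le> 1"
  using assms unfolding local_coord_def by (simp add: abs_le_iff divide_le_eq le_divide_eq step_def)

lemma local_coord_knots:
  assumes "0 < step u i" shows "local_coord u i (u i) = 1" "local_coord u i (u (i - 1)) = -1"
  using assms unfolding local_coord_def by (simp_all add: divide_simps step_def)

text \<open>
  The slopes on the two sides of a knot coincide because the interpolated value lies on the line through both
  data points; this is the \<open>C\<^sup>1\<close> condition at a knot.
\<close>

lemma knot_value_slopes:
  assumes "0 < step u i" "0 < step u (i + 1)"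
  shows "(knot_value u w i - w i) / step u i = (w (i + 1) - w i) / (step u i + step u (i + 1))"
    and "(w (i + 1) - knot_value u w i) / step u (i + 1) = (w (i + 1) - w i) / (step u i + step u (i + 1))"
proof -
  let ?S = "step u i + step u (i + 1)"
  have S: "?S \<noteq> 0" using assms by linarith
  have "knot_value u w i - w i = step u i * ((w (i + 1) - w i) / ?S)"
    "w (i + 1) - knot_value u w i = step u (i + 1) * ((w (i + 1) - w i) / ?S)"
    using S unfolding knot_value_def by (simp_all add: divide_simps) (simp_all add: algebra_simps)
  then show "(knot_value u w i - w i) / step u i = (w (i + 1) - w i) / ?S"
    "(w (i + 1) - knot_value u w i) / step u (i + 1) = (w (i + 1) - w i) / ?S"
    using assms by simp_all
qed

lemma cell_spline_agree:
  assumes "knot_line u" "knot_line v" "snd z \<in> {v (j - 1)..v j}" "fst z = u i"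
  shows "cell_spline u v w i j z = cell_spline u v w (i + 1) j z"
    and "cell_spline_dx u v w i j z = cell_spline_dx u v w (i + 1) j z"
    and "cell_spline_dx v u (transpose_net w) j i (prod.swap z)
       = cell_spline_dx v u (transpose_net w) j (i + 1) (prod.swap z)"
proof -
  note pos = knot_line_step[OF assms(1), of i] knot_line_step[OF assms(1), of "i + 1"]
  have Y: "\<bar>local_coord v j (snd z)\<bar> \<le> 1"
    using assms(3) by (rule local_coord_bounds[OF knot_line_step[OF assms(2)]])
  have X: "local_coord u i (u i) = 1" "local_coord u (i + 1) (u i) = -1"
    using local_coord_knots[OF pos(1)] local_coord_knots[OF pos(2)] by simp_all
  show "cell_spline u v w i j z = cell_spline u v w (i + 1) j z"
    unfolding cell_spline_def assms(4) X patch_left[OF Y] patch_right[OF Y] by simp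
  show "cell_spline_dx v u (transpose_net w) j i (prod.swap z)
       = cell_spline_dx v u (transpose_net w) j (i + 1) (prod.swap z)"
    unfolding cell_spline_dx_def fst_swap snd_swap assms(4) X patch_dx_top[OF Y] patch_dx_bottom[OF Y]
    by (simp add: vertex_transpose[of v u w])
  have s: "2 / step u i * (vertex u v w i l - knot_value v (w i) l)
      = 2 / step u (i + 1) * (knot_value v (w (i + 1)) l - vertex u v w i l)" for l
    using knot_value_slopes[OF pos, of "\<lambda>p. knot_value v (w p) l"]
    unfolding vertex_def times_divide_eq_left times_divide_eq_right[symmetric] by metis
  show "cell_spline_dx u v w i j z = cell_spline_dx u v w (i + 1) j z"
    unfolding cell_spline_dx_def assms(4) X patch_dx_left[OF Y] patch_dx_right[OF Y]
    by (simp only: distrib_left mult.assoc[symmetric] s add_diff_cancel_right')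
qed

text \<open>
  The formulas of all closed cells that contain a point give the same value and gradient there. The proof passes to
  the selected cell in two moves, first horizontally and then vertically.
\<close>

lemma spline_on_cell:
  assumes u: "knot_line u" and v: "knot_line v" and z: "z \<in> cell u v i j"
  shows "spline u v w z = cell_spline u v w i j z"
    and "spline_dx u v w z = cell_spline_dx u v w i j z"
proof -
  obtain x y where zxy: "z = (x, y)" by (cases z)
  let ?k = "cell_index u x" and ?l = "cell_index v y"
  have x: "u (i - 1) \<le> x" "x \<le> u i" and y: "v (j - 1) \<le> y" "y \<le> v j"
    using z by (auto simp: cell_def zxy)
  have 1: "cell_spline u v w i j z = cell_spline u v w ?k j z \<and>
      cell_spline_dx u v w i j z = cell_spline_dx u v w ?k j z"
    using cell_index_cases[OF u x]
  proof cases
    case 2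
    then show ?thesis using cell_spline_agree[OF u v, of z j "i - 1" w] y by (simp add: zxy)
  qed simp
  have 2: "cell_spline u v w ?k j z = cell_spline u v w ?k ?l z \<and>
      cell_spline_dx u v w ?k j z = cell_spline_dx u v w ?k ?l z"
    using cell_index_cases[OF v y]
  proof cases
    case 2
    have "x \<in> {u (?k - 1)..u ?k}" using cell_index[OF u, of x] by simp
    then show ?thesis
      using cell_spline_agree[OF v u, of "prod.swap z" ?k "j - 1" "transpose_net w"] 2
      unfolding cell_spline_transpose[of v u w] by (simp add: zxy)
  qed simp
  show "spline u v w z = cell_spline u v w i j z" "spline_dx u v w z = cell_spline_dx u v w i j z"
    using 1 2 unfolding spline_def spline_dx_def by (simp_all add: zxy)
qed

lemma spline_dy_on_cell:
  assumes u: "knot_line u" and v: "knot_line v" and z: "z \<in> cell u v i j"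
  shows "spline_dx v u (transpose_net w) (prod.swap z) = cell_spline_dx v u (transpose_net w) j i (prod.swap z)"
  by (rule spline_on_cell(2)[OF v u]) (use z in \<open>simp add: cell_def mem_Times_iff\<close>)

lemma closed_cell: "closed (cell u v i j)"
  unfolding cell_def by (intro closed_Times closed_atLeastAtMost)

text \<open>
  Limits, and therefore derivatives and continuity, can be checked on the members of a finite closed cover: those
  that miss the point keep a distance from it.
\<close>

lemma tendsto_at_finite_closed_cover:
  fixes z :: "'a :: topological_space"
  assumes fin: "finite \<C>" and U: "open U" "z \<in> U" "U \<subseteq> \<Union>\<C>"
    and C: "\<And>C. C \<in> \<C> \<Longrightarrow> closed C" "\<And>C. C \<in> \<C> \<Longrightarrow> z \<in> C \<Longrightarrow> (f \<longlongrightarrow> l) (at z within C)"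
  shows "(f \<longlongrightarrow> l) (at z)"
proof -
  have each: "(f \<longlongrightarrow> l) (at z within C)" if "C \<in> \<C>" for C
  proof (cases "z \<in> C")
    case False
    have "\<not> z islimpt C" using C(1)[OF that] False unfolding closed_limpt by blast
    then have "at z within C = bot" unfolding trivial_limit_within by blast
    then show ?thesis by (simp only: tendsto_bot)
  qed (use C that in blast)
  have "(f \<longlongrightarrow> l) (at z within \<Union>\<C>)"
    using fin each
  proof (induction \<C>)
    case (insert C \<C>)
    have "(f \<longlongrightarrow> l) (at z within C)" "(f \<longlongrightarrow> l) (at z within \<Union>\<C>)"
      using insert.prems insert.IH by blast+
    then show ?case unfolding Union_insert Lim_within_Un by blast
  qed simp
  then have "(f \<longlongrightarrow> l) (at z within U)" using U(3) by (rule tendsto_within_subset)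
  then show ?thesis unfolding at_within_open[OF U(2,1)] .
qed

lemma cells_cover_neighbourhood:
  assumes u: "knot_line u" and v: "knot_line v"
  obtains U \<C> where "open U" "z \<in> U" "finite \<C>" "U \<subseteq> \<Union>\<C>"
    "\<And>C. C \<in> \<C> \<Longrightarrow> \<exists>i j. C = cell u v i j"
proof -
  obtain x y where zxy: "z = (x, y)" by (cases z)
  let ?k = "cell_index u x" and ?l = "cell_index v y"
  let ?U = "{u (?k - 1)<..<u (?k + 1)} \<times> {v (?l - 1)<..<v (?l + 1)}"
  let ?\<C> = "(\<lambda>(i, j). cell u v i j) ` ({?k, ?k + 1} \<times> {?l, ?l + 1})"
  show thesis
  proof
    show "open ?U" by (intro open_Times open_greaterThanLessThan)
    show "z \<in> ?U"
      using cell_index[OF u, of x] cell_index[OF v, of y] knot_line_step[OF u, of "?k + 1"]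
        knot_line_step[OF v, of "?l + 1"] by (auto simp: zxy step_def)
    show "finite ?\<C>" by simp
    show "?U \<subseteq> \<Union>?\<C>"
    proof
      fix p assume p: "p \<in> ?U"
      let ?i = "if fst p \<le> u ?k then ?k else ?k + 1"
      let ?j = "if snd p \<le> v ?l then ?l else ?l + 1"
      have "p \<in> cell u v ?i ?j" using p by (auto simp: cell_def mem_Times_iff)
      then show "p \<in> \<Union>?\<C>" by (intro UnionI image_eqI[of _ _ "(?i, ?j)"]) auto
    qed
    show "\<exists>i j. C = cell u v i j" if "C \<in> ?\<C>" for C using that by auto
  qed
qed

lemma spline_has_derivative:
  assumes u: "knot_line u" and v: "knot_line v"
  shows "(spline u v w has_derivative
     (\<lambda>d. spline_dx u v w z * fst d + spline_dx v u (transpose_net w) (prod.swap z) * snd d)) (at z)"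
    (is "(_ has_derivative ?D) _")
proof -
  obtain U \<C> where cov: "finite \<C>" "open U" "z \<in> U" "U \<subseteq> \<Union>\<C>"
    "\<And>C. C \<in> \<C> \<Longrightarrow> \<exists>i j. C = cell u v i j"
    using cells_cover_neighbourhood[OF u v] by metis
  have lin: "bounded_linear ?D"
    by (intro bounded_linear_add bounded_linear_const_mult bounded_linear_fst bounded_linear_snd)
  have "((\<lambda>y. ((spline u v w y - spline u v w z) - ?D (y - z)) /\<^sub>R norm (y - z)) \<longlongrightarrow> 0) (at z)"
  proof (rule tendsto_at_finite_closed_cover[OF cov(1-4)])
    fix C assume "C \<in> \<C>"
    then obtain i j where C: "C = cell u v i j" using cov by blast
    then show "closed C" by (simp add: closed_cell)
    assume z: "z \<in> C"
    have "(spline u v w has_derivative ?D) (at z within C)"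
    proof (rule has_derivative_transform[OF z])
      show "spline u v w y = cell_spline u v w i j y" if "y \<in> C" for y
        using that C by (simp add: spline_on_cell[OF u v])
      show "(cell_spline u v w i j has_derivative ?D) (at z within C)"
        using cell_spline_has_derivative[of u v w i j z C] z C
        by (simp add: spline_on_cell[OF u v] spline_dy_on_cell[OF u v])
    qed
    then show "((\<lambda>y. ((spline u v w y - spline u v w z) - ?D (y - z)) /\<^sub>R norm (y - z)) \<longlongrightarrow> 0) (at z within C)"
      by (simp only: has_derivative_at_within)
  qed
  then show ?thesis using lin by (simp only: has_derivative_at_within)
qed

lemma continuous_spline_dx:
  assumes u: "knot_line u" and v: "knot_line v"
  shows "continuous_on S (spline_dx u v w)"
proof -
  have "isCont (spline_dx u v w) z" for z
  proof -
    obtain U \<C> where cov: "finite \<C>" "open U" "z \<in> U" "U \<subseteq> \<Union>\<C>"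
      "\<And>C. C \<in> \<C> \<Longrightarrow> \<exists>i j. C = cell u v i j"
      using cells_cover_neighbourhood[OF u v] by metis
    show ?thesis
      unfolding isCont_def
    proof (rule tendsto_at_finite_closed_cover[OF cov(1-4)])
      fix C assume "C \<in> \<C>"
      then obtain i j where C: "C = cell u v i j" using cov by blast
      then show "closed C" by (simp add: closed_cell)
      assume z: "z \<in> C"
      have "continuous_on C (spline_dx u v w)"
        using continuous_on_cell_spline_dx[of C u v w i j]
        by (rule continuous_on_eq) (simp add: C spline_on_cell[OF u v])
      then show "(spline_dx u v w \<longlongrightarrow> spline_dx u v w z) (at z within C)"
        using z by (simp add: continuous_on_def)
    qed
  qed
  then show ?thesis by (simp add: continuous_at_imp_continuous_on)
qed

lemma C1_on_spline:
  assumes u: "knot_line u" and v: "knot_line v"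
  shows "C1_on UNIV (spline u v w)"
proof -
  let ?D = "\<lambda>z. spline_dx u v w z *\<^sub>R fst_blinfun
    + spline_dx v u (transpose_net w) (prod.swap z) *\<^sub>R snd_blinfun"
  have sw: "continuous_on UNIV (\<lambda>z :: real \<times> real. spline_dx v u (transpose_net w) (prod.swap z))"
    by (rule continuous_on_compose2[OF continuous_spline_dx[OF v u, of UNIV]])
      (auto intro!: continuous_intros)
  have "continuous_on UNIV ?D"
    by (intro continuous_intros sw continuous_spline_dx[OF u v])
  moreover have "(spline u v w has_derivative blinfun_apply (?D z)) (at z)" for z
    by (rule has_derivative_eq_rhs[OF spline_has_derivative[OF u v]])
      (simp add: fun_eq_iff blinfun.add_left blinfun.scaleR_left)
  ultimately show ?thesis unfolding C1_on_def by (intro exI[of _ ?D]) simp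
qed

section \<open>Splines with support in nine cells\<close>

lemma has_vector_derivative_along_line:
  assumes "(g has_derivative D) (at (P + s *\<^sub>R v))"
  shows "((\<lambda>s. g (P + s *\<^sub>R v)) has_vector_derivative D v) (at s within S)"
proof -
  have "((\<lambda>s. P + s *\<^sub>R v) has_derivative (\<lambda>s. s *\<^sub>R v)) (at s within S)"
    by (auto intro!: derivative_eq_intros)
  from has_derivative_compose[OF this assms]
  have "((\<lambda>s. g (P + s *\<^sub>R v)) has_derivative (\<lambda>s. D (s *\<^sub>R v))) (at s within S)" .
  moreover have "D (s *\<^sub>R v) = s *\<^sub>R D v" for s
    using has_derivative_bounded_linear[OF assms] by (simp add: bounded_linear.linear linear_cmul)
  ultimately show ?thesis by (simp add: has_vector_derivative_def)
qed

lemma quadratic_on_segment: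
  fixes P R :: "real \<times> real"
  assumes "quadratic_on T g" "convex T" "P \<in> T" "R \<in> T"
  obtains A B C where "\<And>s. s \<in> {0..1} \<Longrightarrow> g (P + s *\<^sub>R (R - P)) = A + B * s + C * s\<^sup>2"
proof -
  obtain c0 c1 c2 c3 c4 c5 where q: "\<forall>(s, t)\<in>T. g (s, t) = c0 + c1 * s + c2 * t + c3 * s\<^sup>2 + c4 * s * t + c5 * t\<^sup>2"
    using assms(1) unfolding quadratic_on_def by blast
  obtain p1 p2 r1 r2 where PR: "P = (p1, p2)" "R = (r1, r2)" by (cases P; cases R)
  define d1 where "d1 = r1 - p1"
  define d2 where "d2 = r2 - p2"
  show thesis
  proof
    fix s :: real assume s: "s \<in> {0..1}"
    have "P + s *\<^sub>R (R - P) = (1 - s) *\<^sub>R P + s *\<^sub>R R" by (simp add: algebra_simps)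
    also have "\<dots> \<in> T" using assms(2-4) s by (intro convexD) auto
    finally have "(p1 + s * d1, p2 + s * d2) \<in> T" by (simp add: PR d1_def d2_def)
    then have "g (p1 + s * d1, p2 + s * d2) = c0 + c1 * (p1 + s * d1) + c2 * (p2 + s * d2)
        + c3 * (p1 + s * d1)\<^sup>2 + c4 * (p1 + s * d1) * (p2 + s * d2) + c5 * (p2 + s * d2)\<^sup>2"
      using q by blast
    then show "g (P + s *\<^sub>R (R - P)) = (c0 + c1 * p1 + c2 * p2 + c3 * p1\<^sup>2 + c4 * p1 * p2 + c5 * p2\<^sup>2)
      + (c1 * d1 + c2 * d2 + 2 * c3 * p1 * d1 + c4 * (p1 * d2 + d1 * p2) + 2 * c5 * p2 * d2) * s
      + (c3 * d1\<^sup>2 + c4 * d1 * d2 + c5 * d2\<^sup>2) * s\<^sup>2"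
      by (simp add: PR d1_def[symmetric] d2_def[symmetric] power2_eq_square algebra_simps)
  qed
qed

text \<open>
  A quadratic polynomial in one variable is determined by its end values and one end slope. All of the
  uniqueness proof rests on this observation, applied to segments inside the triangles.
\<close>

lemma quadratic_segment:
  fixes P R :: "real \<times> real"
  assumes T: "quadratic_on T g" "convex T" "P \<in> T" "R \<in> T"
    and DP: "(g has_derivative DP) (at P)" and DR: "(g has_derivative DR) (at R)"
  shows "DP (R - P) + DR (R - P) = 2 * (g R - g P)"
    and "\<And>s. s \<in> {0..1} \<Longrightarrow>
      g (P + s *\<^sub>R (R - P)) = g P + s * DP (R - P) + s\<^sup>2 * (g R - g P - DP (R - P))"
proof -
  obtain A B C where q: "\<And>s. s \<in> {0..1} \<Longrightarrow> g (P + s *\<^sub>R (R - P)) = A + B * s + C * s\<^sup>2"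
    using quadratic_on_segment[OF T] by blast
  have der: "D (R - P) = B + 2 * C * s" if s: "s \<in> {0..1}" and D: "(g has_derivative D) (at (P + s *\<^sub>R (R - P)))" for s D
  proof -
    have 1: "((\<lambda>s. g (P + s *\<^sub>R (R - P))) has_vector_derivative D (R - P)) (at s within {0..1})"
      using D by (rule has_vector_derivative_along_line)
    have "((\<lambda>s. A + B * s + C * s\<^sup>2) has_vector_derivative B + 2 * C * s) (at s within {0..1})"
      by (auto intro!: derivative_eq_intros simp flip: has_real_derivative_iff_has_vector_derivative)
    then have 2: "((\<lambda>s. g (P + s *\<^sub>R (R - P))) has_vector_derivative B + 2 * C * s) (at s within {0..1})"
      by (rule has_vector_derivative_transform[OF s, rotated]) (simp add: q)
    show ?thesis
      by (rule vector_derivative_unique_within[OF _ 1 2])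
        (use s at_within_Icc_at_right in \<open>auto simp: trivial_limit_within islimpt_Icc\<close>)
  qed
  have B: "DP (R - P) = B" using der[of 0 DP] DP by simp
  have C: "DR (R - P) = B + 2 * C" using der[of 1 DR] DR by simp
  have A: "g P = A" "g R = A + B + C" using q[of 0] q[of 1] by simp_all
  show "DP (R - P) + DR (R - P) = 2 * (g R - g P)" using A B C by simp
  show "g (P + s *\<^sub>R (R - P)) = g P + s * DP (R - P) + s\<^sup>2 * (g R - g P - DP (R - P))"
    if "s \<in> {0..1}" for s using q[OF that] A B by (simp add: algebra_simps)
qed

text \<open>
  A one-sided version of the fact that a differentiable function has zero value and slope at the end of
  an interval on which it vanishes.
\<close>

lemma zero_along_ray:
  fixes g :: "real \<times> real \<Rightarrow> real"
  assumes D: "(g has_derivative D) (at z)" and 0: "\<And>s. 0 < s \<Longrightarrow> s \<le> 1 \<Longrightarrow> g (z + s *\<^sub>R v) = 0"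
  shows "g z = 0" "D v = 0"
proof -
  have 1: "((\<lambda>s. g (z + s *\<^sub>R v)) has_vector_derivative D v) (at 0 within {0..1})"
    using D by (intro has_vector_derivative_along_line) simp
  have nt: "at 0 within {0..1::real} \<noteq> bot" by (simp add: trivial_limit_within islimpt_Icc)
  have "((\<lambda>s. g (z + s *\<^sub>R v)) \<longlongrightarrow> g (z + 0 *\<^sub>R v)) (at 0 within {0..1})"
    using has_vector_derivative_continuous[OF 1] by (simp add: continuous_within)
  moreover have "((\<lambda>s. g (z + s *\<^sub>R v)) \<longlongrightarrow> 0) (at 0 within {0..1})"
    by (rule tendsto_eventually) (auto simp: eventually_at_filter 0 intro!: always_eventually)
  ultimately show z: "g z = 0" using tendsto_unique[OF nt] by fastforce
  have 2: "((\<lambda>s. g (z + s *\<^sub>R v)) has_vector_derivative 0) (at 0 within {0..1})"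
  proof (rule has_vector_derivative_transform[of 0 _ _ "\<lambda>_. 0"])
    show "g (z + s *\<^sub>R v) = 0" if "s \<in> {0..1}" for s
      using that z 0 by (cases "s = 0") auto
  qed simp_all
  show "D v = 0" by (rule vector_derivative_unique_within[OF nt 1 2])
qed

text \<open>
  A univariate \<open>C\<^sup>1\<close> quadratic spline supported on three intervals is a multiple of the B-spline, whose inner
  knot values are positive; so it vanishes as soon as it vanishes at one inner knot.
\<close>

lemma zero_on_grid_line:
  fixes g :: "real \<times> real \<Rightarrow> real" and e :: "real \<times> real"
  assumes D: "\<And>z. (g has_derivative D z) (at z)"
    and h: "h1 > 0" "h2 > 0" "h3 > 0"
    and P: "P1 = P0 + h1 *\<^sub>R e" "P2 = P1 + h2 *\<^sub>R e" "P3 = P2 + h3 *\<^sub>R e"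
    and T1: "quadratic_on T1 g" "convex T1" "P0 \<in> T1" "P1 \<in> T1"
    and T2: "quadratic_on T2 g" "convex T2" "P1 \<in> T2" "P2 \<in> T2"
    and T3: "quadratic_on T3 g" "convex T3" "P2 \<in> T3" "P3 \<in> T3"
    and z: "g P0 = 0" "D P0 e = 0" "g P2 = 0" "g P3 = 0" "D P3 e = 0"
    and s: "0 \<le> s" "s \<le> h1 + h2 + h3"
  shows "g (P0 + s *\<^sub>R e) = 0"
proof -
  have lin: "D z (r *\<^sub>R e) = r * D z e" for z r
    using has_derivative_bounded_linear[OF D] by (simp add: bounded_linear.linear linear_cmul)
  have d: "P1 - P0 = h1 *\<^sub>R e" "P2 - P1 = h2 *\<^sub>R e" "P3 - P2 = h3 *\<^sub>R e"
    using P by (simp_all add: algebra_simps)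
  note q1 = quadratic_segment[OF T1 D D, unfolded d lin]
  note q2 = quadratic_segment[OF T2 D D, unfolded d lin]
  note q3 = quadratic_segment[OF T3 D D, unfolded d lin]
  have D2: "D P2 e = 0" using q3(1) z h by simp
  \<comment> \<open>The slopes from both sides force \<open>g P1\<close> and \<open>- g P1\<close> to have the same sign.\<close>
  have e1: "h1 * D P1 e = 2 * g P1" using q1(1) z by simp
  have e2: "h2 * D P1 e = - 2 * g P1" using q2(1) z D2 by simp
  have "(h1 + h2) * D P1 e = 0" using e1 e2 by (simp add: algebra_simps)
  then have D1: "D P1 e = 0" using h by simp
  then have g1: "g P1 = 0" using e1 by simp
  have seg: "g (P + r *\<^sub>R e) = 0"
    if "\<And>s. s \<in> {0..1} \<Longrightarrow> g (P + s *\<^sub>R h *\<^sub>R e) = 0" "0 \<le> r" "r \<le> h" "h > 0" for P r h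
    using that(1)[of "r / h"] that(2-4) by simp
  consider "s \<le> h1" | "h1 \<le> s" "s \<le> h1 + h2" | "h1 + h2 \<le> s" by linarith
  then show ?thesis
  proof cases
    case 1
    then show ?thesis using q1(2) z g1 D1 s h by (intro seg[of P0 h1]) simp_all
  next
    case 2
    have "g (P1 + (s - h1) *\<^sub>R e) = 0"
      using 2 q2(2) z g1 D1 D2 s h by (intro seg[of P1 h2]) simp_all
    then show ?thesis by (simp add: P algebra_simps)
  next
    case 3
    have "g (P2 + (s - h1 - h2) *\<^sub>R e) = 0"
      using 3 q3(2) z D2 s h by (intro seg[of P2 h3]) simp_all
    then show ?thesis by (simp add: P algebra_simps)
  qed
qed

text \<open>
  Every point of the triangle lies on a segment from \<open>M\<close> to the opposite edge, along which the function is quadratic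
  with zero value and slope at \<open>M\<close> and zero value at the other end.
\<close>

lemma zero_on_triangle:
  fixes g :: "real \<times> real \<Rightarrow> real"
  assumes q: "quadratic_on (convex hull {P, R, M}) g"
    and D: "\<And>z. (g has_derivative D z) (at z)"
    and edge: "\<And>z. z \<in> closed_segment P R \<Longrightarrow> g z = 0"
    and M: "g M = 0" "\<And>v. D M v = 0"
    and z: "z \<in> convex hull {P, R, M}"
  shows "g z = 0"
proof -
  let ?T = "convex hull {P, R, M}"
  obtain \<alpha> \<beta> \<gamma> where w: "\<alpha> \<ge> 0" "\<beta> \<ge> 0" "\<gamma> \<ge> 0" "\<alpha> + \<beta> + \<gamma> = 1" "z = \<alpha> *\<^sub>R P + \<beta> *\<^sub>R R + \<gamma> *\<^sub>R M"
    using z unfolding convex_hull_3 by blast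
  show ?thesis
  proof (cases "\<alpha> + \<beta> = 0")
    case True
    then have 0: "\<alpha> = 0" "\<beta> = 0" "\<gamma> = 1" using w(1-4) by linarith+
    show ?thesis using M(1) unfolding w(5) 0 by simp
  next
    case False
    define s where "s = \<alpha> + \<beta>"
    have s: "s > 0" "s \<le> 1" "\<gamma> = 1 - s" using False w unfolding s_def by linarith+
    define B where "B = (\<alpha> / s) *\<^sub>R P + (\<beta> / s) *\<^sub>R R"
    have sum1: "\<alpha> / s + \<beta> / s = 1" using s unfolding s_def by (simp flip: add_divide_distrib)
    have Bs: "B \<in> closed_segment P R"
      unfolding B_def closed_segment_def mem_Collect_eq
      using s w sum1 by (intro exI[of _ "\<beta> / s"]) (auto simp: eq_diff_eq divide_le_eq s_def)
    then have BT: "B \<in> ?T"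
      using hull_mono[of "{P, R}" "{P, R, M}" convex] by (auto simp: segment_convex_hull)
    have MT: "M \<in> ?T" by (simp add: hull_inc)
    have "z = M + s *\<^sub>R (B - M)"
      using s unfolding w(5) B_def s(3) by (simp add: scaleR_diff_right scaleR_add_right scaleR_diff_left)
    moreover have "g (M + s *\<^sub>R (B - M)) = 0"
      using quadratic_segment(2)[OF q convex_convex_hull MT BT D D, of s] M edge[OF Bs] s by simp
    ultimately show ?thesis by simp
  qed
qed

lemma rect_triangles_cover:
  fixes x0 x1 y0 y1 :: real
  assumes "x0 < x1" "y0 < y1" "z \<in> {x0..x1} \<times> {y0..y1}"
  shows "z \<in> \<Union>(rect_triangles x0 x1 y0 y1)"
proof -
  obtain x y where zxy: "z = (x, y)" by (cases z)
  define M where "M = ((x0 + x1) / 2, (y0 + y1) / 2)"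
  define X where "X = (2 * x - x0 - x1) / (x1 - x0)"
  define Y where "Y = (2 * y - y0 - y1) / (y1 - y0)"
  have x: "x = (x0 + x1) / 2 + X * (x1 - x0) / 2" and y: "y = (y0 + y1) / 2 + Y * (y1 - y0) / 2"
    using assms(1,2) unfolding X_def Y_def by (simp_all add: field_simps)
  have XY: "X \<le> 1" "- 1 \<le> X" "Y \<le> 1" "- 1 \<le> Y"
    using assms unfolding X_def Y_def zxy by (auto simp: divide_simps)
  have hull: "z \<in> convex hull {P, R, M}"
    if "z = \<alpha> *\<^sub>R P + \<beta> *\<^sub>R R + (1 - \<alpha> - \<beta>) *\<^sub>R M" "0 \<le> \<alpha>" "0 \<le> \<beta>" "\<alpha> + \<beta> \<le> 1" for \<alpha> \<beta> P R
    unfolding convex_hull_3 using that by (intro CollectI exI[of _ \<alpha>] exI[of _ \<beta>] exI[of _ "1 - \<alpha> - \<beta>"]) auto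
  consider "X + Y \<le> 0" "Y \<le> X" | "X + Y \<ge> 0" "Y \<le> X" | "X + Y \<ge> 0" "X \<le> Y" | "X + Y \<le> 0" "X \<le> Y"
    by linarith
  then have "z \<in> convex hull {(x0, y0), (x1, y0), M} \<or> z \<in> convex hull {(x1, y0), (x1, y1), M} \<or>
      z \<in> convex hull {(x1, y1), (x0, y1), M} \<or> z \<in> convex hull {(x0, y1), (x0, y0), M}"
  proof cases
    case 1
    have "z \<in> convex hull {(x0, y0), (x1, y0), M}"
      by (rule hull[of "(- Y - X) / 2" _ "(X - Y) / 2"]) (use 1 XY in \<open>auto simp: zxy x y M_def field_simps\<close>)
    then show ?thesis by blast
  next
    case 2
    have "z \<in> convex hull {(x1, y0), (x1, y1), M}"
      by (rule hull[of "(X - Y) / 2" _ "(X + Y) / 2"]) (use 2 XY in \<open>auto simp: zxy x y M_def field_simps\<close>)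
    then show ?thesis by blast
  next
    case 3
    have "z \<in> convex hull {(x1, y1), (x0, y1), M}"
      by (rule hull[of "(X + Y) / 2" _ "(Y - X) / 2"]) (use 3 XY in \<open>auto simp: zxy x y M_def field_simps\<close>)
    then show ?thesis by blast
  next
    case 4
    have "z \<in> convex hull {(x0, y1), (x0, y0), M}"
      by (rule hull[of "(Y - X) / 2" _ "(- X - Y) / 2"]) (use 4 XY in \<open>auto simp: zxy x y M_def field_simps\<close>)
    then show ?thesis by blast
  qed
  then show ?thesis unfolding rect_triangles_def Let_def M_def by blast
qed

text \<open>
  Let \<open>M\<close> be the centre. At each corner \<open>c\<close> the gradient is zero, so the slope at \<open>M\<close> in the direction \<open>M - c\<close>
  is \<open>2 g(M)\<close>. Opposite corners give opposite directions, whence \<open>g(M) = 0\<close> and the gradient at \<open>M\<close>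
  vanishes too.
\<close>

lemma zero_on_cell:
  fixes g :: "real \<times> real \<Rightarrow> real"
  assumes xy: "x0 < x1" "y0 < y1"
    and q: "\<And>T. T \<in> rect_triangles x0 x1 y0 y1 \<Longrightarrow> quadratic_on T g"
    and D: "\<And>z. (g has_derivative D z) (at z)"
    and bottom: "\<And>x. x \<in> {x0..x1} \<Longrightarrow> g (x, y0) = 0" and top: "\<And>x. x \<in> {x0..x1} \<Longrightarrow> g (x, y1) = 0"
    and left: "\<And>y. y \<in> {y0..y1} \<Longrightarrow> g (x0, y) = 0" and right: "\<And>y. y \<in> {y0..y1} \<Longrightarrow> g (x1, y) = 0"
    and z: "z \<in> {x0..x1} \<times> {y0..y1}"
  shows "g z = 0"
proof -
  define M where "M = ((x0 + x1) / 2, (y0 + y1) / 2)"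
  define h where "h = x1 - x0"
  define k where "k = y1 - y0"
  have hk: "h > 0" "k > 0" using xy by (simp_all add: h_def k_def)
  have lin: "linear (D z)" for z
    using has_derivative_bounded_linear[OF D] by (rule bounded_linear.linear)
  let ?T1 = "convex hull {(x0, y0), (x1, y0), M}" and ?T2 = "convex hull {(x1, y0), (x1, y1), M}"
  let ?T3 = "convex hull {(x1, y1), (x0, y1), M}" and ?T4 = "convex hull {(x0, y1), (x0, y0), M}"
  have tri: "rect_triangles x0 x1 y0 y1 = {?T1, ?T2, ?T3, ?T4}"
    unfolding rect_triangles_def Let_def M_def by simp
  have qT: "quadratic_on ?T1 g" "quadratic_on ?T2 g" "quadratic_on ?T3 g" "quadratic_on ?T4 g"
    using q unfolding tri by simp_all
  have xin: "x0 + s * h \<in> {x0..x1}" "x1 - s * h \<in> {x0..x1}" if "0 < s" "s \<le> 1" for s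
  proof -
    have "0 < s * h" "s * h \<le> h" "x1 = x0 + h"
      using that hk by (simp_all add: h_def)
    then show "x0 + s * h \<in> {x0..x1}" "x1 - s * h \<in> {x0..x1}" by auto
  qed
  have yin: "y0 + s * k \<in> {y0..y1}" "y1 - s * k \<in> {y0..y1}" if "0 < s" "s \<le> 1" for s
  proof -
    have "0 < s * k" "s * k \<le> k" "y1 = y0 + k"
      using that hk by (simp_all add: k_def)
    then show "y0 + s * k \<in> {y0..y1}" "y1 - s * k \<in> {y0..y1}" by auto
  qed
  \<comment> \<open>At a corner \<open>g\<close> vanishes along two edges, so its whole gradient vanishes.\<close>
  have split: "D z v = (fst v / a) * D z (a, 0) + (snd v / b) * D z (0, b)" if "a \<noteq> 0" "b \<noteq> 0" for z v a b
  proof -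
    have "v = (fst v / a) *\<^sub>R (a, 0) + (snd v / b) *\<^sub>R (0, b)" using that by (simp add: prod_eq_iff)
    then have "D z v = D z ((fst v / a) *\<^sub>R (a, 0) + (snd v / b) *\<^sub>R (0, b))" by simp
    then show ?thesis by (simp only: linear_add[OF lin] linear_cmul[OF lin] real_scaleR_def)
  qed
  have corner: "D c v = 0"
    if "a \<noteq> 0" "b \<noteq> 0" "\<And>s. 0 < s \<Longrightarrow> s \<le> 1 \<Longrightarrow> g (c + s *\<^sub>R (a, 0)) = 0"
      "\<And>s. 0 < s \<Longrightarrow> s \<le> 1 \<Longrightarrow> g (c + s *\<^sub>R (0, b)) = 0" for c a b v
    using split[OF that(1,2), of c v] zero_along_ray(2)[OF D that(3)] zero_along_ray(2)[OF D that(4)] by simp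
  have C1: "D (x0, y0) v = 0" for v
    by (rule corner[of h k]) (use hk bottom left xin yin in simp_all)
  have C2: "D (x1, y0) v = 0" for v
    by (rule corner[of "- h" k]) (use hk bottom right xin yin in simp_all)
  have C3: "D (x1, y1) v = 0" for v
    by (rule corner[of "- h" "- k"]) (use hk top right xin yin in simp_all)
  note C = C1 C2 C3
  have g0: "g (x0, y0) = 0" "g (x1, y0) = 0" "g (x1, y1) = 0"
    using bottom[of x0] bottom[of x1] top[of x1] xy by simp_all
  have m: "D M (M - c) = 2 * g M" if "quadratic_on (convex hull S) g" "c \<in> S" "M \<in> S"
    "g c = 0" "\<And>v. D c v = 0" for c S
    using quadratic_segment(1)[OF that(1) convex_convex_hull _ _ D D, of c M] that(2-5) by (simp add: hull_inc)
  have m00: "D M (M - (x0, y0)) = 2 * g M" by (rule m[OF qT(1)]) (simp_all add: g0 C)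
  have m10: "D M (M - (x1, y0)) = 2 * g M" by (rule m[OF qT(1)]) (simp_all add: g0 C)
  have m11: "D M (M - (x1, y1)) = 2 * g M" by (rule m[OF qT(2)]) (simp_all add: g0 C)
  \<comment> \<open>Opposite corners give opposite directions from the centre.\<close>
  have "M - (x1, y1) = - (M - (x0, y0))" unfolding M_def by (simp add: field_simps)
  then have gM: "g M = 0" using m00 m11 linear_neg[OF lin, of M "M - (x0, y0)"] by simp
  have "(h, 0) = (M - (x0, y0)) - (M - (x1, y0))" "(0, k) = (M - (x1, y0)) - (M - (x1, y1))"
    by (simp_all add: h_def k_def)
  then have "D M (h, 0) = 0" "D M (0, k) = 0"
    using m00 m10 m11 gM by (simp_all only: linear_diff[OF lin])
  then have DM: "D M v = 0" for v using split[of h k M v] hk by simp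
  have edge1: "g p = 0" if p: "p \<in> closed_segment (x0, y0) (x1, y0)" for p
    using bottom closed_segment_PairD[of "fst p" "snd p" x0 y0 x1 y0] p xy
    by (simp add: closed_segment_eq_real_ivl) (metis prod.collapse)
  have edge2: "g p = 0" if p: "p \<in> closed_segment (x1, y0) (x1, y1)" for p
    using right closed_segment_PairD[of "fst p" "snd p" x1 y0 x1 y1] p xy
    by (simp add: closed_segment_eq_real_ivl) (metis prod.collapse)
  have edge3: "g p = 0" if p: "p \<in> closed_segment (x1, y1) (x0, y1)" for p
    using top closed_segment_PairD[of "fst p" "snd p" x1 y1 x0 y1] p xy
    by (simp add: closed_segment_eq_real_ivl) (metis prod.collapse)
  have edge4: "g p = 0" if p: "p \<in> closed_segment (x0, y1) (x0, y0)" for p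
    using left closed_segment_PairD[of "fst p" "snd p" x0 y1 x0 y0] p xy
    by (simp add: closed_segment_eq_real_ivl) (metis prod.collapse)
  have "z \<in> ?T1 \<or> z \<in> ?T2 \<or> z \<in> ?T3 \<or> z \<in> ?T4"
    using rect_triangles_cover[OF xy z] unfolding tri by blast
  then show ?thesis
    by (elim disjE) (rule zero_on_triangle[OF qT(1) D edge1 gM DM] zero_on_triangle[OF qT(2) D edge2 gM DM]
      zero_on_triangle[OF qT(3) D edge3 gM DM] zero_on_triangle[OF qT(4) D edge4 gM DM], assumption+)+
qed

lemma horizontal_edge_in_triangle:
  assumes "y = y0 \<or> y = y1"
  obtains T where "T \<in> rect_triangles x0 x1 y0 y1" "convex T" "(x0, y) \<in> T" "(x1, y) \<in> T"
proof -
  let ?M = "((x0 + x1) / 2, (y0 + y1) / 2)"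
  from assms show thesis
  proof
    assume "y = y0"
    then show thesis
      by (intro that[of "convex hull {(x0, y0), (x1, y0), ?M}"])
        (simp_all add: rect_triangles_def Let_def hull_inc)
  next
    assume "y = y1"
    then show thesis
      by (intro that[of "convex hull {(x1, y1), (x0, y1), ?M}"])
        (simp_all add: rect_triangles_def Let_def hull_inc)
  qed
qed

lemma vertical_edge_in_triangle:
  assumes "x = x0 \<or> x = x1"
  obtains T where "T \<in> rect_triangles x0 x1 y0 y1" "convex T" "(x, y0) \<in> T" "(x, y1) \<in> T"
proof -
  let ?M = "((x0 + x1) / 2, (y0 + y1) / 2)"
  from assms show thesis
  proof
    assume "x = x0"
    then show thesis
      by (intro that[of "convex hull {(x0, y1), (x0, y0), ?M}"])
        (simp_all add: rect_triangles_def Let_def hull_inc)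
  next
    assume "x = x1"
    then show thesis
      by (intro that[of "convex hull {(x1, y0), (x1, y1), ?M}"])
        (simp_all add: rect_triangles_def Let_def hull_inc)
  qed
qed

text \<open>
  The zero at the inner vertex \<open>(s2, t2)\<close> spreads along the grid lines: the two lines through this vertex are
  zero, hence so are their intersections with the lines \<open>x = s1\<close> and \<open>y = t1\<close>, and then these lines. After this,
  all nine cells have zero boundary.
\<close>

lemma spline_on_nine_cells_zero:
  fixes g :: "real \<times> real \<Rightarrow> real"
  assumes s: "s0 < s1" "s1 < s2" "s2 < s3" and t: "t0 < t1" "t1 < t2" "t2 < t3"
    and D: "\<And>z. (g has_derivative D z) (at z)"
    and q: "\<And>a b c d T. (a, b) \<in> {(s0, s1), (s1, s2), (s2, s3)} \<Longrightarrow> (c, d) \<in> {(t0, t1), (t1, t2), (t2, t3)}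
      \<Longrightarrow> T \<in> rect_triangles a b c d \<Longrightarrow> quadratic_on T g"
    and out: "\<And>z. z \<notin> {s0..s3} \<times> {t0..t3} \<Longrightarrow> g z = 0"
    and c: "g (s2, t2) = 0"
  shows "g z = 0"
proof -
  have lin: "linear (D z)" for z
    using has_derivative_bounded_linear[OF D] by (rule bounded_linear.linear)
  have W: "g (s0, y) = 0" "D (s0, y) (1, 0) = 0" for y
  proof -
    have *: "g ((s0, y) + r *\<^sub>R (- 1, 0)) = 0" if "r > 0" for r using that by (intro out) simp
    show "g (s0, y) = 0" by (rule zero_along_ray(1)[OF D *])
    have "D (s0, y) (- (1, 0)) = 0" using zero_along_ray(2)[OF D *] by simp
    then show "D (s0, y) (1, 0) = 0" unfolding linear_neg[OF lin] by simp
  qed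
  have E: "g (s3, y) = 0" "D (s3, y) (1, 0) = 0" for y
  proof -
    have *: "g ((s3, y) + r *\<^sub>R (1, 0)) = 0" if "r > 0" for r using that by (intro out) simp
    show "g (s3, y) = 0" by (rule zero_along_ray(1)[OF D *])
    show "D (s3, y) (1, 0) = 0" by (rule zero_along_ray(2)[OF D *])
  qed
  have S: "g (x, t0) = 0" "D (x, t0) (0, 1) = 0" for x
  proof -
    have *: "g ((x, t0) + r *\<^sub>R (0, - 1)) = 0" if "r > 0" for r using that by (intro out) simp
    show "g (x, t0) = 0" by (rule zero_along_ray(1)[OF D *])
    have "D (x, t0) (- (0, 1)) = 0" using zero_along_ray(2)[OF D *] by simp
    then show "D (x, t0) (0, 1) = 0" unfolding linear_neg[OF lin] by simp
  qed
  have N: "g (x, t3) = 0" "D (x, t3) (0, 1) = 0" for x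
  proof -
    have *: "g ((x, t3) + r *\<^sub>R (0, 1)) = 0" if "r > 0" for r using that by (intro out) simp
    show "g (x, t3) = 0" by (rule zero_along_ray(1)[OF D *])
    show "D (x, t3) (0, 1) = 0" by (rule zero_along_ray(2)[OF D *])
  qed
  have hline: "g (x, y) = 0" if y: "y = t1 \<or> y = t2" and z: "g (s2, y) = 0" and x: "x \<in> {s0..s3}" for x y
  proof -
    have edge: "\<exists>T. quadratic_on T g \<and> convex T \<and> (a, y) \<in> T \<and> (b, y) \<in> T"
      if "(a, b) \<in> {(s0, s1), (s1, s2), (s2, s3)}" for a b
    proof -
      obtain T where "T \<in> rect_triangles a b t1 t2" "convex T" "(a, y) \<in> T" "(b, y) \<in> T"
        using horizontal_edge_in_triangle[OF y] by metis
      then show ?thesis using q[OF that, of t1 t2 T] by auto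
    qed
    obtain T1 where T1: "quadratic_on T1 g" "convex T1" "(s0, y) \<in> T1" "(s1, y) \<in> T1"
      using edge[of s0 s1] by auto
    obtain T2 where T2: "quadratic_on T2 g" "convex T2" "(s1, y) \<in> T2" "(s2, y) \<in> T2"
      using edge[of s1 s2] by auto
    obtain T3 where T3: "quadratic_on T3 g" "convex T3" "(s2, y) \<in> T3" "(s3, y) \<in> T3"
      using edge[of s2 s3] by auto
    have "g ((s0, y) + (x - s0) *\<^sub>R (1, 0)) = 0"
      by (rule zero_on_grid_line[OF D _ _ _ _ _ _ T1 T2 T3 W z E, of "s1 - s0" "s2 - s1" "s3 - s2"])
        (use s x in simp_all)
    then show ?thesis by simp
  qed
  have vline: "g (x, y) = 0" if x: "x = s1 \<or> x = s2" and z: "g (x, t2) = 0" and y: "y \<in> {t0..t3}" for x y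
  proof -
    have edge: "\<exists>T. quadratic_on T g \<and> convex T \<and> (x, a) \<in> T \<and> (x, b) \<in> T"
      if "(a, b) \<in> {(t0, t1), (t1, t2), (t2, t3)}" for a b
    proof -
      obtain T where "T \<in> rect_triangles s1 s2 a b" "convex T" "(x, a) \<in> T" "(x, b) \<in> T"
        using vertical_edge_in_triangle[OF x] by metis
      then show ?thesis using q[OF _ that, of s1 s2 T] by auto
    qed
    obtain T1 where T1: "quadratic_on T1 g" "convex T1" "(x, t0) \<in> T1" "(x, t1) \<in> T1"
      using edge[of t0 t1] by auto
    obtain T2 where T2: "quadratic_on T2 g" "convex T2" "(x, t1) \<in> T2" "(x, t2) \<in> T2"
      using edge[of t1 t2] by auto
    obtain T3 where T3: "quadratic_on T3 g" "convex T3" "(x, t2) \<in> T3" "(x, t3) \<in> T3"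
      using edge[of t2 t3] by auto
    have "g ((x, t0) + (y - t0) *\<^sub>R (0, 1)) = 0"
      by (rule zero_on_grid_line[OF D _ _ _ _ _ _ T1 T2 T3 S z N, of "t1 - t0" "t2 - t1" "t3 - t2"])
        (use t y in simp_all)
    then show ?thesis by simp
  qed
  have h2: "g (x, t2) = 0" if "x \<in> {s0..s3}" for x using hline[of t2] c that by blast
  have v2: "g (s2, y) = 0" if "y \<in> {t0..t3}" for y using vline[of s2] c that by blast
  have v1: "g (s1, y) = 0" if "y \<in> {t0..t3}" for y using vline[of s1] h2[of s1] s that by simp
  have h1: "g (x, t1) = 0" if "x \<in> {s0..s3}" for x using hline[of t1] v2[of t1] t that by simp
  have H: "g (x, y) = 0" if "y \<in> {t0, t1, t2, t3}" "x \<in> {s0..s3}" for x y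
    using that(1) S(1)[of x] N(1)[of x] h1[OF that(2)] h2[OF that(2)] by auto
  have V: "g (x, y) = 0" if "x \<in> {s0, s1, s2, s3}" "y \<in> {t0..t3}" for x y
    using that(1) W(1)[of y] E(1)[of y] v1[OF that(2)] v2[OF that(2)] by auto
  show ?thesis
  proof (cases "z \<in> {s0..s3} \<times> {t0..t3}")
    case False
    then show ?thesis by (rule out)
  next
    case True
    then obtain x y where zxy: "z = (x, y)" and xy: "x \<in> {s0..s3}" "y \<in> {t0..t3}" by auto
    have "x \<in> {s0..s1} \<or> x \<in> {s1..s2} \<or> x \<in> {s2..s3}" using xy(1) by auto
    then obtain a b where ab: "(a, b) \<in> {(s0, s1), (s1, s2), (s2, s3)}" "x \<in> {a..b}"
      using that[of s0 s1] that[of s1 s2] that[of s2 s3] by auto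
    have "y \<in> {t0..t1} \<or> y \<in> {t1..t2} \<or> y \<in> {t2..t3}" using xy(2) by auto
    then obtain c d where cd: "(c, d) \<in> {(t0, t1), (t1, t2), (t2, t3)}" "y \<in> {c..d}"
      using that[of t0 t1] that[of t1 t2] that[of t2 t3] by auto
    have ab': "a \<in> {s0, s1, s2, s3}" "b \<in> {s0, s1, s2, s3}" "a < b" "{a..b} \<subseteq> {s0..s3}"
      using ab s by auto
    have cd': "c \<in> {t0, t1, t2, t3}" "d \<in> {t0, t1, t2, t3}" "c < d" "{c..d} \<subseteq> {t0..t3}"
      using cd t by auto
    have "g (x, y) = 0"
    proof (rule zero_on_cell[OF ab'(3) cd'(3) q[OF ab(1) cd(1)] D])
      show "g (r, c) = 0" if "r \<in> {a..b}" for r using H[OF cd'(1)] ab'(4) that by blast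
      show "g (r, d) = 0" if "r \<in> {a..b}" for r using H[OF cd'(2)] ab'(4) that by blast
      show "g (a, r) = 0" if "r \<in> {c..d}" for r using V[OF ab'(1)] cd'(4) that by blast
      show "g (b, r) = 0" if "r \<in> {c..d}" for r using V[OF ab'(2)] cd'(4) that by blast
      show "(x, y) \<in> {a..b} \<times> {c..d}" using ab(2) cd(2) by simp
    qed
    then show ?thesis by (simp add: zxy)
  qed
qed

section \<open>The classical B-spline as the spline of a unit net\<close>

lemma quadratic_on_affine_coords:
  "quadratic_on T (\<lambda>(s, t). A + B * (\<alpha> * s + \<beta>) + C * (\<gamma> * t + \<epsilon>) + D * (\<alpha> * s + \<beta>)\<^sup>2
     + E * ((\<alpha> * s + \<beta>) * (\<gamma> * t + \<epsilon>)) + F * (\<gamma> * t + \<epsilon>)\<^sup>2)"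
  unfolding quadratic_on_def
  by (rule exI[of _ "A + B * \<beta> + C * \<epsilon> + D * \<beta>\<^sup>2 + E * \<beta> * \<epsilon> + F * \<epsilon>\<^sup>2"],
      rule exI[of _ "B * \<alpha> + 2 * D * \<alpha> * \<beta> + E * \<alpha> * \<epsilon>"],
      rule exI[of _ "C * \<gamma> + E * \<beta> * \<gamma> + 2 * F * \<gamma> * \<epsilon>"],
      rule exI[of _ "D * \<alpha>\<^sup>2"], rule exI[of _ "E * \<alpha> * \<gamma>"], rule exI[of _ "F * \<gamma>\<^sup>2"])
    (auto simp: power2_eq_square algebra_simps)

lemma quadratic_on_cong:
  assumes "quadratic_on T f" "\<And>z. z \<in> T \<Longrightarrow> g z = f z"
  shows "quadratic_on T g"
proof -
  obtain c0 c1 c2 c3 c4 c5 where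
    "\<forall>(s, t)\<in>T. f (s, t) = c0 + c1 * s + c2 * t + c3 * s\<^sup>2 + c4 * s * t + c5 * t\<^sup>2"
    using assms(1) unfolding quadratic_on_def by blast
  then have "\<forall>(s, t)\<in>T. g (s, t) = c0 + c1 * s + c2 * t + c3 * s\<^sup>2 + c4 * s * t + c5 * t\<^sup>2"
    using assms(2) by fastforce
  then show ?thesis unfolding quadratic_on_def by blast
qed

text \<open>
  Where \<open>X + Y\<close> and \<open>X - Y\<close> have constant signs, the absolute values in the patch disappear.
\<close>

lemma cell_spline_quadratic_on:
  fixes \<sigma> \<tau> :: real
  assumes "\<And>z. z \<in> T \<Longrightarrow> \<bar>local_coord u i (fst z) + local_coord v j (snd z)\<bar>
      = \<sigma> * (local_coord u i (fst z) + local_coord v j (snd z))"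
    and "\<And>z. z \<in> T \<Longrightarrow> \<bar>local_coord u i (fst z) - local_coord v j (snd z)\<bar>
      = \<tau> * (local_coord u i (fst z) - local_coord v j (snd z))"
  shows "quadratic_on T (cell_spline u v w i j)"
proof -
  have lc: "local_coord u i t = 2 / step u i * t + - ((u (i - 1) + u i) / step u i)" for u i t
    unfolding local_coord_def by (simp add: diff_divide_distrib add_divide_distrib)
  have "\<exists>a0 a1 a2 a3 a4 a5 k1 k2. \<forall>z. cell_spline u v w i j z = a0 + a1 * local_coord u i (fst z) + a2 * local_coord v j (snd z)
        + a3 * (local_coord u i (fst z))\<^sup>2 + a4 * (local_coord u i (fst z) * local_coord v j (snd z)) + a5 * (local_coord v j (snd z))\<^sup>2
        + k1 * ((local_coord u i (fst z) + local_coord v j (snd z)) * \<bar>local_coord u i (fst z) + local_coord v j (snd z)\<bar>)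
        + k2 * ((local_coord u i (fst z) - local_coord v j (snd z)) * \<bar>local_coord u i (fst z) - local_coord v j (snd z)\<bar>)"
    unfolding cell_spline_def patch_def by (intro exI allI) (rule refl)
  then obtain a0 a1 a2 a3 a4 a5 k1 k2 where form: "\<And>z. cell_spline u v w i j z = a0 + a1 * local_coord u i (fst z) + a2 * local_coord v j (snd z)
        + a3 * (local_coord u i (fst z))\<^sup>2 + a4 * (local_coord u i (fst z) * local_coord v j (snd z)) + a5 * (local_coord v j (snd z))\<^sup>2
        + k1 * ((local_coord u i (fst z) + local_coord v j (snd z)) * \<bar>local_coord u i (fst z) + local_coord v j (snd z)\<bar>)
        + k2 * ((local_coord u i (fst z) - local_coord v j (snd z)) * \<bar>local_coord u i (fst z) - local_coord v j (snd z)\<bar>)"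
    by blast
  have eq: "a0 + a1 * X + a2 * Y + a3 * X\<^sup>2 + a4 * (X * Y) + a5 * Y\<^sup>2 + k1 * ((X + Y) * (\<sigma> * (X + Y)))
        + k2 * ((X - Y) * (\<tau> * (X - Y)))
      = a0 + a1 * X + a2 * Y + (a3 + k1 * \<sigma> + k2 * \<tau>) * X\<^sup>2
        + (a4 + 2 * k1 * \<sigma> - 2 * k2 * \<tau>) * (X * Y) + (a5 + k1 * \<sigma> + k2 * \<tau>) * Y\<^sup>2" for X Y :: real
    by (simp add: power2_eq_square algebra_simps)
  show ?thesis
  proof (rule quadratic_on_cong[OF quadratic_on_affine_coords])
    fix z assume z: "z \<in> T"
    show "cell_spline u v w i j z = (case z of (s, t) \<Rightarrow>
        a0 + a1 * (2 / step u i * s + - ((u (i - 1) + u i) / step u i))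
        + a2 * (2 / step v j * t + - ((v (j - 1) + v j) / step v j))
        + (a3 + k1 * \<sigma> + k2 * \<tau>) * (2 / step u i * s + - ((u (i - 1) + u i) / step u i))\<^sup>2
        + (a4 + 2 * k1 * \<sigma> - 2 * k2 * \<tau>) * ((2 / step u i * s + - ((u (i - 1) + u i) / step u i))
            * (2 / step v j * t + - ((v (j - 1) + v j) / step v j)))
        + (a5 + k1 * \<sigma> + k2 * \<tau>) * (2 / step v j * t + - ((v (j - 1) + v j) / step v j))\<^sup>2)"
      unfolding split_beta lc[symmetric] form assms(1)[OF z] assms(2)[OF z] by (rule eq)
  qed
qed

lemma affine_nonneg_on_hull:
  fixes S :: "(real \<times> real) set"
  assumes "\<And>z. z \<in> S \<Longrightarrow> 0 \<le> a * fst z + b * snd z + c" "z \<in> convex hull S"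
  shows "0 \<le> a * fst z + b * snd z + c"
proof -
  have "{z. inner (a, b) z \<ge> - c} = {z. 0 \<le> a * fst z + b * snd z + c}"
    by (auto simp: inner_prod_def)
  then have "convex {z :: real \<times> real. 0 \<le> a * fst z + b * snd z + c}"
    using convex_halfspace_ge[of "- c" "(a, b)"] by simp
  then have "convex hull S \<subseteq> {z. 0 \<le> a * fst z + b * snd z + c}"
    using assms(1) by (intro hull_minimal) auto
  then show ?thesis using assms(2) by blast
qed

lemma cell_spline_quadratic_on_triangles:
  assumes pos: "0 < step u i" "0 < step v j"
    and T: "T \<in> rect_triangles (u (i - 1)) (u i) (v (j - 1)) (v j)"
  shows "quadratic_on T (cell_spline u v w i j)"
proof -
  let ?X = "\<lambda>z. local_coord u i (fst z)" and ?Y = "\<lambda>z. local_coord v j (snd z)"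
  define M where "M = ((u (i - 1) + u i) / 2, (v (j - 1) + v j) / 2)"
  have M: "local_coord u i (fst M) = 0" "local_coord v j (snd M) = 0"
    unfolding local_coord_def M_def by (simp_all add: field_simps)
  note k = local_coord_knots[OF pos(1)] local_coord_knots[OF pos(2)] M
  have lc: "local_coord u i t = 2 / step u i * t - (u (i - 1) + u i) / step u i" for u i t
    unfolding local_coord_def by (simp add: diff_divide_distrib add_divide_distrib)
  have pos_hull: "0 \<le> r * ?X z + r' * ?Y z"
    if "\<forall>z\<in>S. 0 \<le> r * ?X z + r' * ?Y z" "z \<in> convex hull S" for S z r r'
  proof -
    have eq: "r * ?X z + r' * ?Y z = (r * (2 / step u i)) * fst z + (r' * (2 / step v j)) * snd z
      + (- r * ((u (i - 1) + u i) / step u i) - r' * ((v (j - 1) + v j) / step v j))" for z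
      unfolding lc by (simp add: right_diff_distrib)
    show ?thesis unfolding eq by (rule affine_nonneg_on_hull[OF bspec[OF that(1)[unfolded eq]] that(2)])
  qed
  have quad: "quadratic_on (convex hull S) (cell_spline u v w i j)"
    if "\<sigma> = 1 \<or> \<sigma> = - 1" "\<tau> = 1 \<or> \<tau> = - 1"
      "\<forall>z\<in>S. 0 \<le> \<sigma> * ?X z + \<sigma> * ?Y z" "\<forall>z\<in>S. 0 \<le> \<tau> * ?X z + (- \<tau>) * ?Y z" for S \<sigma> \<tau>
  proof (rule cell_spline_quadratic_on)
    fix z assume z: "z \<in> convex hull S"
    show "\<bar>?X z + ?Y z\<bar> = \<sigma> * (?X z + ?Y z)"
      using that(1) pos_hull[OF that(3) z] by (elim disjE) simp_all
    show "\<bar>?X z - ?Y z\<bar> = \<tau> * (?X z - ?Y z)"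
      using that(2) pos_hull[OF that(4) z] by (elim disjE) simp_all
  qed
  have "T \<in> {convex hull {(u (i - 1), v (j - 1)), (u i, v (j - 1)), M},
      convex hull {(u i, v (j - 1)), (u i, v j), M},
      convex hull {(u i, v j), (u (i - 1), v j), M},
      convex hull {(u (i - 1), v j), (u (i - 1), v (j - 1)), M}}"
    using T unfolding rect_triangles_def Let_def M_def .
  then consider "T = convex hull {(u (i - 1), v (j - 1)), (u i, v (j - 1)), M}"
    | "T = convex hull {(u i, v (j - 1)), (u i, v j), M}"
    | "T = convex hull {(u i, v j), (u (i - 1), v j), M}"
    | "T = convex hull {(u (i - 1), v j), (u (i - 1), v (j - 1)), M}"
    unfolding insert_iff empty_iff by (elim disjE FalseE) iprover+
  then show ?thesis
  proof cases
    case 1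
    show ?thesis unfolding 1 by (rule quad[of "- 1" 1]) (simp_all add: k)
  next
    case 2
    show ?thesis unfolding 2 by (rule quad[of 1 1]) (simp_all add: k)
  next
    case 3
    show ?thesis unfolding 3 by (rule quad[of 1 "- 1"]) (simp_all add: k)
  next
    case 4
    show ?thesis unfolding 4 by (rule quad[of "- 1" "- 1"]) (simp_all add: k)
  qed
qed

lemma rect_triangles_subset:
  fixes x0 x1 y0 y1 :: real
  assumes "x0 \<le> x1" "y0 \<le> y1" "T \<in> rect_triangles x0 x1 y0 y1"
  shows "T \<subseteq> {x0..x1} \<times> {y0..y1}"
proof -
  have "convex ({x0..x1} \<times> {y0..y1})" by (intro convex_Times convex_closed_interval)
  then have hull: "convex hull S \<subseteq> {x0..x1} \<times> {y0..y1}" if "S \<subseteq> {x0..x1} \<times> {y0..y1}" for S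
    using that by (simp add: hull_minimal)
  from assms(3) show ?thesis
    unfolding rect_triangles_def Let_def insert_iff empty_iff
    by (elim disjE FalseE) (use assms(1,2) hull in \<open>simp_all add: field_simps\<close>)
qed

lemma spline_quadratic_on_triangles:
  assumes u: "knot_line u" and v: "knot_line v"
    and T: "T \<in> rect_triangles (u (i - 1)) (u i) (v (j - 1)) (v j)"
  shows "quadratic_on T (spline u v w)"
proof (rule quadratic_on_cong)
  show "quadratic_on T (cell_spline u v w i j)"
    using cell_spline_quadratic_on_triangles[OF knot_line_step[OF u] knot_line_step[OF v] T] .
  have "T \<subseteq> cell u v i j"
    unfolding cell_def
    by (rule rect_triangles_subset[OF _ _ T])
      (use knot_line_step[OF u, of i] knot_line_step[OF v, of j] in \<open>simp_all add: step_def\<close>)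
  then show "spline u v w z = cell_spline u v w i j z" if "z \<in> T" for z
    using that by (intro spline_on_cell[OF u v]) blast
qed

subsection \<open>Support\<close>

text \<open>
  The net whose spline will turn out to be the classical B-spline with indices \<open>(p, q)\<close>.
\<close>

definition unit_net :: "int \<Rightarrow> int \<Rightarrow> int \<Rightarrow> int \<Rightarrow> real" where
  "unit_net p q i j = of_bool (i = p) * of_bool (j = q)"

lemma knot_value_unit:
  assumes "i \<noteq> p" "i \<noteq> p - 1"
  shows "knot_value u (\<lambda>k. of_bool (k = p)) i = 0"
  using assms unfolding knot_value_def by auto

lemma knot_value_scale: "knot_value u (\<lambda>k. c * w k) i = c * knot_value u w i"
  "knot_value u (\<lambda>k. w k * c) i = knot_value u w i * c"
  unfolding knot_value_def by (simp_all add: field_simps)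

lemma knot_value_unit_net:
  "knot_value v (unit_net p q i) j = of_bool (i = p) * knot_value v (\<lambda>k. of_bool (k = q)) j"
  "knot_value u (\<lambda>k. unit_net p q k j) i = knot_value u (\<lambda>k. of_bool (k = p)) i * of_bool (j = q)"
  "vertex u v (unit_net p q) i j
     = knot_value u (\<lambda>k. of_bool (k = p)) i * knot_value v (\<lambda>k. of_bool (k = q)) j"
proof -
  have eq: "unit_net p q i = (\<lambda>j. of_bool (i = p) * of_bool (j = q))" for i
    by (simp add: unit_net_def fun_eq_iff)
  show "knot_value v (unit_net p q i) j = of_bool (i = p) * knot_value v (\<lambda>k. of_bool (k = q)) j"
    "knot_value u (\<lambda>k. unit_net p q k j) i = knot_value u (\<lambda>k. of_bool (k = p)) i * of_bool (j = q)"
    "vertex u v (unit_net p q) i j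
     = knot_value u (\<lambda>k. of_bool (k = p)) i * knot_value v (\<lambda>k. of_bool (k = q)) j"
    unfolding vertex_def eq knot_value_scale by (rule refl)+
qed

lemma rect_subset_convex:
  fixes K :: "(real \<times> real) set"
  assumes "convex K" "(x0, y0) \<in> K" "(x0, y1) \<in> K" "(x1, y0) \<in> K" "(x1, y1) \<in> K"
    and "x \<in> {x0..x1}" "y \<in> {y0..y1}"
  shows "(x, y) \<in> K"
proof -
  have "convex hull ({x0, x1} \<times> {y0, y1}) \<subseteq> K"
    using assms(1-5) by (intro hull_minimal) auto
  then have "closed_segment x0 x1 \<times> closed_segment y0 y1 \<subseteq> K"
    by (simp only: convex_hull_Times segment_convex_hull)
  then show ?thesis using assms(6,7) by (auto simp: closed_segment_eq_real_ivl)
qed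

lemma corner_triangle_subset_convex:
  fixes K :: "(real \<times> real) set"
  assumes "convex K" "(xa, yb) \<in> K" "(xb, ya) \<in> K" "(xb, yb) \<in> K"
    and "0 \<le> \<alpha>" "0 \<le> \<beta>" "\<alpha> + \<beta> \<le> 1"
    and "x = \<alpha> * xa + (1 - \<alpha>) * xb" "y = \<beta> * ya + (1 - \<beta>) * yb"
  shows "(x, y) \<in> K"
proof -
  have "\<alpha> *\<^sub>R (xa, yb) + \<beta> *\<^sub>R (xb, ya) + (1 - \<alpha> - \<beta>) *\<^sub>R (xb, yb) \<in> convex hull {(xa, yb), (xb, ya), (xb, yb)}"
    unfolding convex_hull_3 using assms(5-7)
    by (intro CollectI exI[of _ \<alpha>] exI[of _ \<beta>] exI[of _ "1 - \<alpha> - \<beta>"]) auto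
  also have "\<alpha> *\<^sub>R (xa, yb) + \<beta> *\<^sub>R (xb, ya) + (1 - \<alpha> - \<beta>) *\<^sub>R (xb, yb) = (x, y)"
    using assms(8,9) by (simp add: algebra_simps)
  finally show ?thesis using hull_minimal[of "{(xa, yb), (xb, ya), (xb, yb)}" K convex] assms(1-4) by auto
qed

lemma octagon_contains_cross:
  assumes u: "knot_line u" and v: "knot_line v"
    and "z \<in> {u (p - 2)..u (p + 1)} \<times> {v (q - 1)..v q} \<or> z \<in> {u (p - 1)..u p} \<times> {v (q - 2)..v (q + 1)}"
  shows "z \<in> octagon u v p q"
proof -
  have c: "convex (octagon u v p q)" unfolding octagon_def by (rule convex_convex_hull)
  have "(x, y) \<in> octagon u v p q" if "x \<in> {u (p - 2)..u (p + 1)}" "y \<in> {v (q - 1)..v q}" for x y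
    by (rule rect_subset_convex[OF c _ _ _ _ that]) (simp_all add: octagon_def hull_inc)
  moreover have "(x, y) \<in> octagon u v p q" if "x \<in> {u (p - 1)..u p}" "y \<in> {v (q - 2)..v (q + 1)}" for x y
    by (rule rect_subset_convex[OF c _ _ _ _ that]) (simp_all add: octagon_def hull_inc)
  ultimately have "(fst z, snd z) \<in> octagon u v p q" using assms(3) unfolding mem_Times_iff by blast
  then show ?thesis by simp
qed

lemma local_coord_inverse:
  assumes "0 < step u i"
  shows "t = (1 - local_coord u i t) / 2 * u (i - 1) + (1 - (1 - local_coord u i t) / 2) * u i"
    and "t = (1 + local_coord u i t) / 2 * u i + (1 - (1 + local_coord u i t) / 2) * u (i - 1)"
  using assms unfolding local_coord_def by (simp_all add: step_def divide_simps) (simp_all add: algebra_simps)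

text \<open>
  The coefficients of a cell involve the net values of the cell and its eight neighbours only, so the spline lives
  on three by three cells. On each of the four corner cells a single corner coefficient is left, and the patch
  vanishes on the half of the cell that the octagon omits.
\<close>

lemma spline_unit_net_outside_octagon:
  assumes u: "knot_line u" and v: "knot_line v" and z: "z \<notin> octagon u v p q"
  shows "spline u v (unit_net p q) z = 0"
proof (rule ccontr)
  assume nz: "spline u v (unit_net p q) z \<noteq> 0"
  obtain x y where zxy: "z = (x, y)" by (cases z)
  define i where "i = cell_index u x"
  define j where "j = cell_index v y"
  have xy: "x \<in> {u (i - 1)..u i}" "y \<in> {v (j - 1)..v j}"
    using cell_index[OF u, of x] cell_index[OF v, of y] by (simp_all add: i_def j_def)
  let ?X = "local_coord u i x" and ?Y = "local_coord v j y"
  have X: "\<bar>?X\<bar> \<le> 1" and Y: "\<bar>?Y\<bar> \<le> 1"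
    using local_coord_bounds[OF knot_line_step[OF u] xy(1)] local_coord_bounds[OF knot_line_step[OF v] xy(2)] .
  have nz': "cell_spline u v (unit_net p q) i j z \<noteq> 0"
    using nz unfolding spline_def zxy i_def j_def by simp
  have mono: "u k \<le> u l" "v k \<le> v l" if "k \<le> l" for k l
    using that strict_mono_mono[OF knot_line_strict_mono[OF u]] strict_mono_mono[OF knot_line_strict_mono[OF v]]
    by (simp_all add: monoD)
  note coeffs = knot_value_unit_net knot_value_unit
  have i: "i \<in> {p - 1, p, p + 1}"
  proof (rule ccontr)
    assume "i \<notin> {p - 1, p, p + 1}"
    then have "cell_spline u v (unit_net p q) i j z = 0" unfolding cell_spline_def by (simp add: coeffs patch_def)
    then show False using nz' by simp
  qed
  have j: "j \<in> {q - 1, q, q + 1}"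
  proof (rule ccontr)
    assume "j \<notin> {q - 1, q, q + 1}"
    then have "cell_spline u v (unit_net p q) i j z = 0" unfolding cell_spline_def by (simp add: coeffs patch_def)
    then show False using nz' by simp
  qed
  have cross: False if "i = p \<or> j = q"
  proof -
    have "z \<in> octagon u v p q"
      using that
    proof
      assume [simp]: "i = p"
      have "v (q - 2) \<le> v (j - 1)" "v j \<le> v (q + 1)" using j by (auto intro!: mono)
      then show ?thesis using xy by (intro octagon_contains_cross[OF u v]) (auto simp: zxy)
    next
      assume [simp]: "j = q"
      have "u (p - 2) \<le> u (i - 1)" "u i \<le> u (p + 1)" using i by (auto intro!: mono)
      then show ?thesis using xy by (intro octagon_contains_cross[OF u v]) (auto simp: zxy)
    qed
    then show False using z by simp
  qed
  have c: "convex (octagon u v p q)" unfolding octagon_def by (rule convex_convex_hull)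
  have inner: "(u (p - 1), v (q - 1)) \<in> octagon u v p q" "(u p, v (q - 1)) \<in> octagon u v p q"
    "(u (p - 1), v q) \<in> octagon u v p q" "(u p, v q) \<in> octagon u v p q"
    by (rule octagon_contains_cross[OF u v], simp add: mono)+
  have oct: "(u (p - 2), v (q - 1)) \<in> octagon u v p q" "(u (p - 2), v q) \<in> octagon u v p q"
    "(u (p - 1), v (q + 1)) \<in> octagon u v p q" "(u p, v (q + 1)) \<in> octagon u v p q"
    "(u (p + 1), v q) \<in> octagon u v p q" "(u (p + 1), v (q - 1)) \<in> octagon u v p q"
    "(u p, v (q - 2)) \<in> octagon u v p q" "(u (p - 1), v (q - 2)) \<in> octagon u v p q"
    unfolding octagon_def by (simp_all add: hull_inc)
  have w: "0 \<le> (1 - ?X) / 2" "0 \<le> (1 + ?X) / 2" "0 \<le> (1 - ?Y) / 2" "0 \<le> (1 + ?Y) / 2"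
    using X Y by auto
  have "(x, y) \<in> octagon u v p q"
  proof -
    consider "i = p - 1" "j = q - 1" | "i = p - 1" "j = q + 1" | "i = p + 1" "j = q - 1" | "i = p + 1" "j = q + 1"
      using i j cross by auto
    then show ?thesis
    proof cases
      case 1
      have "0 < ?X + ?Y"
      proof (rule ccontr)
        assume "\<not> 0 < ?X + ?Y"
        then have "cell_spline u v (unit_net p q) i j z = 0"
          unfolding cell_spline_def by (simp add: 1 coeffs patch_corner_zero zxy)
        then show False using nz' by simp
      qed
      then have sum1: "(1 - ?X) / 2 + (1 - ?Y) / 2 \<le> 1" by argo
      show ?thesis
        by (rule corner_triangle_subset_convex[OF c _ _ _ w(1) w(3) sum1
              local_coord_inverse(1)[OF knot_line_step[OF u]] local_coord_inverse(1)[OF knot_line_step[OF v]]])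
          (simp_all add: 1 inner oct)
    next
      case 2
      have "0 < ?X - ?Y"
      proof (rule ccontr)
        assume "\<not> 0 < ?X - ?Y"
        then have "cell_spline u v (unit_net p q) i j z = 0"
          unfolding cell_spline_def by (simp add: 2 coeffs patch_corner_zero zxy)
        then show False using nz' by simp
      qed
      then have sum1: "(1 - ?X) / 2 + (1 + ?Y) / 2 \<le> 1" by argo
      show ?thesis
        by (rule corner_triangle_subset_convex[OF c _ _ _ w(1) w(4) sum1
              local_coord_inverse(1)[OF knot_line_step[OF u]] local_coord_inverse(2)[OF knot_line_step[OF v]]])
          (simp_all add: 2 inner oct)
    next
      case 3
      have "0 < ?Y - ?X"
      proof (rule ccontr)
        assume "\<not> 0 < ?Y - ?X"
        then have "cell_spline u v (unit_net p q) i j z = 0"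
          unfolding cell_spline_def by (simp add: 3 coeffs patch_corner_zero zxy)
        then show False using nz' by simp
      qed
      then have sum1: "(1 + ?X) / 2 + (1 - ?Y) / 2 \<le> 1" by argo
      show ?thesis
        by (rule corner_triangle_subset_convex[OF c _ _ _ w(2) w(3) sum1
              local_coord_inverse(2)[OF knot_line_step[OF u]] local_coord_inverse(1)[OF knot_line_step[OF v]]])
          (simp_all add: 3 inner oct)
    next
      case 4
      have "0 < - ?X - ?Y"
      proof (rule ccontr)
        assume "\<not> 0 < - ?X - ?Y"
        then have "cell_spline u v (unit_net p q) i j z = 0"
          unfolding cell_spline_def by (simp add: 4 coeffs patch_corner_zero zxy)
        then show False using nz' by simp
      qed
      then have sum1: "(1 + ?X) / 2 + (1 + ?Y) / 2 \<le> 1" by argo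
      show ?thesis
        by (rule corner_triangle_subset_convex[OF c _ _ _ w(2) w(4) sum1
              local_coord_inverse(2)[OF knot_line_step[OF u]] local_coord_inverse(2)[OF knot_line_step[OF v]]])
          (simp_all add: 4 inner oct)
    qed
  qed
  then show False using z zxy by simp
qed

lemma spline_at_knot:
  assumes u: "knot_line u" and v: "knot_line v"
  shows "spline u v w (u i, v j) = vertex u v w i j"
proof -
  have "(u i, v j) \<in> cell u v i j"
    using knot_line_step[OF u, of i] knot_line_step[OF v, of j] by (simp add: cell_def step_def)
  then have "spline u v w (u i, v j) = cell_spline u v w i j (u i, v j)"
    by (rule spline_on_cell(1)[OF u v])
  also have "\<dots> = vertex u v w i j"
    unfolding cell_spline_def
    by (simp add: local_coord_knots[OF knot_line_step[OF u]] local_coord_knots[OF knot_line_step[OF v]] patch_right)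
  finally show ?thesis .
qed

text \<open>
  The knots continued by unit steps on both sides. The continuation makes the plane a union of cells;
  B-splines with \<open>0 \<le> p \<le> m + 1\<close> see only the original knots.
\<close>

definition extend_knots :: "int \<Rightarrow> (int \<Rightarrow> real) \<Rightarrow> int \<Rightarrow> real" where
  "extend_knots m u i =
     (if i < -2 then u (-2) + (of_int i + 2)
      else if i > m + 2 then u (m + 2) + (of_int i - of_int m - 2)
      else u i)"

lemma extend_knots_eq: "-2 \<le> i \<Longrightarrow> i \<le> m + 2 \<Longrightarrow> extend_knots m u i = u i"
  by (simp add: extend_knots_def)

lemma knot_line_extend_knots:
  assumes m: "1 \<le> m" and u: "extended_knots m x u"
  shows "knot_line (extend_knots m u)"
  unfolding knot_line_def
proof (intro conjI allI)
  let ?U = "extend_knots m u"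
  show "0 < step ?U i" for i
  proof -
    consider "i \<le> -2" | "-1 \<le> i" "i \<le> m + 2" | "m + 3 \<le> i" by linarith
    then show ?thesis
    proof cases
      case 1
      then have "i = - 2 \<or> i < -2" by linarith
      then show ?thesis using m by (auto simp: step_def extend_knots_def)
    next
      case 2
      then have "u (i - 1) < u i" using u unfolding extended_knots_def by auto
      then show ?thesis using 2 by (simp add: step_def extend_knots_def)
    next
      case 3
      then have "i = m + 3 \<or> m + 3 < i" by linarith
      then show ?thesis using m by (auto simp: step_def extend_knots_def add.commute[of 2 m])
    qed
  qed
  fix t :: real
  define L where "L = min (- 3) (\<lfloor>t - u (- 2)\<rfloor> - 3)"
  define N where "N = max (m + 3) (m + 2 + \<lceil>t - u (m + 2)\<rceil>)"
  have L: "?U L < t"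
  proof -
    have "of_int L \<le> t - u (-2) - 3" unfolding L_def by linarith
    moreover have "L < - 2" unfolding L_def by linarith
    ultimately show ?thesis unfolding extend_knots_def by simp
  qed
  have N: "t \<le> ?U N"
  proof -
    have "of_int N \<ge> of_int m + 2 + (t - u (m + 2))" unfolding N_def by linarith
    moreover have "\<not> N < - 2" "N > m + 2" using m unfolding N_def by linarith+
    ultimately show ?thesis unfolding extend_knots_def by simp
  qed
  have LN: "L \<le> N" using m unfolding L_def N_def by linarith
  define k where "k = (LEAST k. t \<le> ?U (L + int k))"
  have "t \<le> ?U (L + int (nat (N - L)))" using N LN by simp
  then have k: "t \<le> ?U (L + int k)" unfolding k_def by (rule LeastI)
  have "k \<noteq> 0"
  proof
    assume "k = 0"
    then show False using k L by simp
  qed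
  then have "\<not> t \<le> ?U (L + int (k - 1))"
    using not_less_Least[of "k - 1" "\<lambda>k. t \<le> ?U (L + int k)"] unfolding k_def[symmetric] by simp
  then have "?U (L + int k - 1) < t" using \<open>k \<noteq> 0\<close> by (simp add: of_nat_diff algebra_simps)
  then show "\<exists>i. ?U (i - 1) < t \<and> t \<le> ?U i" using k by blast
qed

lemma quadratic_on_diff:
  assumes "quadratic_on T f" "quadratic_on T g"
  shows "quadratic_on T (\<lambda>z. f z - g z)"
proof -
  obtain c0 c1 c2 c3 c4 c5 where f: "\<forall>(s, t)\<in>T. f (s, t) = c0 + c1 * s + c2 * t + c3 * s\<^sup>2 + c4 * s * t + c5 * t\<^sup>2"
    using assms(1) unfolding quadratic_on_def by blast
  obtain d0 d1 d2 d3 d4 d5 where g: "\<forall>(s, t)\<in>T. g (s, t) = d0 + d1 * s + d2 * t + d3 * s\<^sup>2 + d4 * s * t + d5 * t\<^sup>2"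
    using assms(2) unfolding quadratic_on_def by blast
  have "\<forall>(s, t)\<in>T. f (s, t) - g (s, t) = (c0 - d0) + (c1 - d1) * s + (c2 - d2) * t
      + (c3 - d3) * s\<^sup>2 + (c4 - d4) * s * t + (c5 - d5) * t\<^sup>2"
  proof (clarify)
    fix s t assume "(s, t) \<in> T"
    then have "f (s, t) = c0 + c1 * s + c2 * t + c3 * s\<^sup>2 + c4 * s * t + c5 * t\<^sup>2"
      "g (s, t) = d0 + d1 * s + d2 * t + d3 * s\<^sup>2 + d4 * s * t + d5 * t\<^sup>2"
      using f g by blast+
    then show "f (s, t) - g (s, t) = (c0 - d0) + (c1 - d1) * s + (c2 - d2) * t
      + (c3 - d3) * s\<^sup>2 + (c4 - d4) * s * t + (c5 - d5) * t\<^sup>2"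
      by (simp add: algebra_simps)
  qed
  then show ?thesis unfolding quadratic_on_def by blast
qed

lemma C1_on_UNIV_derivative:
  assumes "C1_on UNIV g"
  obtains D where "\<And>z. (g has_derivative D z) (at z)"
proof -
  obtain f' :: "real \<times> real \<Rightarrow> (real \<times> real) \<Rightarrow>\<^sub>L real"
    where "\<forall>p\<in>UNIV. (g has_derivative blinfun_apply (f' p)) (at p within UNIV)"
    using assms unfolding C1_on_def by blast
  then show thesis using that[of "\<lambda>z. blinfun_apply (f' z)"] by blast
qed

lemma octagon_subset_box:
  assumes "strict_mono u" "strict_mono v"
  shows "octagon u v p q \<subseteq> {u (p - 2)..u (p + 1)} \<times> {v (q - 2)..v (q + 1)}"
  unfolding octagon_def
proof (rule hull_minimal)
  show "convex ({u (p - 2)..u (p + 1)} \<times> {v (q - 2)..v (q + 1)})"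
    by (intro convex_Times convex_closed_interval)
qed (simp add: strict_mono_less_eq[OF assms(1)] strict_mono_less_eq[OF assms(2)])

text \<open>
  The difference of two candidates is zero at the vertex \<open>(u p, v q)\<close> where both are normalised.
  All nine cells around it belong to the triangulation exactly because \<open>0 \<le> p \<le> m + 1\<close> and \<open>0 \<le> q \<le> n + 1\<close>.
\<close>

lemma is_classical_bspline_unique:
  assumes u: "strict_mono u" and v: "strict_mono v"
    and pq: "0 \<le> p" "p \<le> m + 1" "0 \<le> q" "q \<le> n + 1"
    and f: "is_classical_bspline m n u v p q f" and g: "is_classical_bspline m n u v p q g"
  shows "f = g"
proof
  fix z
  obtain Df where Df: "\<And>z. (f has_derivative Df z) (at z)"
    using f C1_on_UNIV_derivative unfolding is_classical_bspline_def by blast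
  obtain Dg where Dg: "\<And>z. (g has_derivative Dg z) (at z)"
    using g C1_on_UNIV_derivative unfolding is_classical_bspline_def by blast
  note less = strict_mono_less[OF u] strict_mono_less[OF v]
  have "f z - g z = 0"
  proof (rule spline_on_nine_cells_zero[where g = "\<lambda>z. f z - g z"])
    show "u (p - 2) < u (p - 1)" "u (p - 1) < u p" "u p < u (p + 1)"
      "v (q - 2) < v (q - 1)" "v (q - 1) < v q" "v q < v (q + 1)" by (simp_all add: less)
    show "((\<lambda>z. f z - g z) has_derivative (\<lambda>d. Df z d - Dg z d)) (at z)" for z
      by (intro has_derivative_diff Df Dg)
    show "f z - g z = 0" if "z \<notin> {u (p - 2)..u (p + 1)} \<times> {v (q - 2)..v (q + 1)}" for z
    proof -
      have "z \<notin> octagon u v p q" using that octagon_subset_box[OF u v, of p q] by blast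
      then have "f z = 0" "g z = 0" using f g unfolding is_classical_bspline_def by blast+
      then show ?thesis by simp
    qed
    show "f (u p, v q) - g (u p, v q) = 0" using f g unfolding is_classical_bspline_def by simp
    fix a b c d T
    assume ab: "(a, b) \<in> {(u (p - 2), u (p - 1)), (u (p - 1), u p), (u p, u (p + 1))}"
      and cd: "(c, d) \<in> {(v (q - 2), v (q - 1)), (v (q - 1), v q), (v q, v (q + 1))}"
      and T: "T \<in> rect_triangles a b c d"
    obtain i where i: "i \<in> {p - 1, p, p + 1}" "a = u (i - 1)" "b = u i"
      using ab that[of "p - 1"] that[of p] that[of "p + 1"] by auto
    obtain j where j: "j \<in> {q - 1, q, q + 1}" "c = v (j - 1)" "d = v j"
      using cd that[of "q - 1"] that[of q] that[of "q + 1"] by auto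
    have ij: "i \<in> {- 1..m + 2}" "j \<in> {- 1..n + 2}" using i(1) j(1) pq by auto
    have "T \<in> extended_triangulation m n u v"
      using T unfolding extended_triangulation_def i j by (intro UN_I[OF ij(1)] UN_I[OF ij(2)])
    then show "quadratic_on T (\<lambda>z. f z - g z)"
      using f g unfolding is_classical_bspline_def by (intro quadratic_on_diff) blast+
  qed
  then show "f z = g z" by simp
qed

lemma is_classical_bspline_spline:
  assumes u: "knot_line u" and v: "knot_line v"
  shows "is_classical_bspline m n u v p q (spline u v (unit_net p q))"
  unfolding is_classical_bspline_def
proof (intro conjI ballI allI impI)
  show "C1_on UNIV (spline u v (unit_net p q))" by (rule C1_on_spline[OF u v])
  show "quadratic_on T (spline u v (unit_net p q))" if "T \<in> extended_triangulation m n u v" for T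
    using that spline_quadratic_on_triangles[OF u v] unfolding extended_triangulation_def by blast
  show "spline u v (unit_net p q) z = 0" if "z \<notin> octagon u v p q" for z
    by (rule spline_unit_net_outside_octagon[OF u v that])
  show "spline u v (unit_net p q) (u p, v q) = (u (p + 1) - u p) / (u (p + 1) - u (p - 1)) *
      ((v (q + 1) - v q) / (v (q + 1) - v (q - 1)))"
    by (simp add: spline_at_knot[OF u v] knot_value_unit_net) (simp add: knot_value_def step_def)
qed

lemma is_classical_bspline_cong:
  assumes "\<And>i. - 2 \<le> i \<Longrightarrow> i \<le> m + 2 \<Longrightarrow> u i = u' i" "\<And>j. - 2 \<le> j \<Longrightarrow> j \<le> n + 2 \<Longrightarrow> v j = v' j"
    and "0 \<le> p" "p \<le> m + 1" "0 \<le> q" "q \<le> n + 1"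
  shows "is_classical_bspline m n u v p q = is_classical_bspline m n u' v' p q"
proof -
  have 1: "extended_triangulation m n u v = extended_triangulation m n u' v'"
    unfolding extended_triangulation_def by (intro SUP_cong refl) (simp add: assms(1,2))
  have 2: "octagon u v p q = octagon u' v' p q"
    unfolding octagon_def using assms by simp
  show ?thesis unfolding is_classical_bspline_def 1 2 fun_eq_iff using assms by simp
qed

lemma classical_bspline_eq_spline:
  assumes "1 \<le> m" "1 \<le> n" "extended_knots m x u" "extended_knots n y v"
    and pq: "0 \<le> p" "p \<le> m + 1" "0 \<le> q" "q \<le> n + 1"
  shows "classical_bspline m n u v p q = spline (extend_knots m u) (extend_knots n v) (unit_net p q)"
proof -
  let ?u = "extend_knots m u" and ?v = "extend_knots n v"
  note kl = knot_line_extend_knots[OF assms(1,3)] knot_line_extend_knots[OF assms(2,4)]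
  have eq: "is_classical_bspline m n u v p q = is_classical_bspline m n ?u ?v p q"
    by (rule is_classical_bspline_cong[OF _ _ pq]) (simp_all add: extend_knots_eq)
  show ?thesis
    unfolding classical_bspline_def eq
    using is_classical_bspline_spline[OF kl]
      is_classical_bspline_unique[OF knot_line_strict_mono[OF kl(1)] knot_line_strict_mono[OF kl(2)] pq]
    by (intro the_equality) blast+
qed

section \<open>Linearity in the control net\<close>

lemma spline_linear:
  "spline u v (\<lambda>i j. a * w i j + w' i j) z = a * spline u v w z + spline u v w' z"
proof -
  have k: "knot_value u (\<lambda>i. a * f i + g i) i = a * knot_value u f i + knot_value u g i" for u f g i
    unfolding knot_value_def by (simp add: field_simps add_divide_distrib)
  show ?thesis unfolding spline_def cell_spline_def vertex_def k patch_linear ..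
qed

lemma spline_sum:
  assumes "finite K"
  shows "spline u v (\<lambda>i j. \<Sum>k\<in>K. c k * w k i j) z = (\<Sum>k\<in>K. c k * spline u v (w k) z)"
  using assms
proof (induction K)
  case empty
  show ?case by (simp add: spline_def cell_spline_def vertex_def knot_value_def patch_def)
next
  case (insert k K)
  then show ?case by (simp add: spline_linear)
qed

section \<open>Quasi-interpolants as splines\<close>

text \<open>
  The univariate net produced by the boundary coefficients: a combination \<open>\<Sum>i. \<mu> i * B\<^sub>i\<close> of the modified
  B-splines has the coefficients \<open>boundary_lift m x u \<mu>\<close> with respect to the classical ones.
\<close>

definition boundary_lift :: "int \<Rightarrow> (int \<Rightarrow> real) \<Rightarrow> (int \<Rightarrow> real) \<Rightarrow> (int \<Rightarrow> real) \<Rightarrow> int \<Rightarrow> real" where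
  "boundary_lift m x u \<mu> p = (\<Sum>i\<in>{0..m + 1}. boundary_coeff m x u i p * \<mu> i)"

lemma boundary_lift_simps:
  assumes m: "1 \<le> m"
  shows "1 \<le> p \<Longrightarrow> p \<le> m \<Longrightarrow> boundary_lift m x u \<mu> p = \<mu> p"
    and "boundary_lift m x u \<mu> 0 = (step u 0 + step x 1) / step x 1 * \<mu> 0 - step u 0 / step x 1 * \<mu> 1"
    and "boundary_lift m x u \<mu> (m + 1) =
      (step x m + step u (m + 1)) / step x m * \<mu> (m + 1) - step u (m + 1) / step x m * \<mu> m"
    and "p \<notin> {0..m + 1} \<Longrightarrow> boundary_lift m x u \<mu> p = 0"
proof -
  have delta: "(\<Sum>i\<in>{0..m + 1}. (if i = k then c else 0) * \<mu> i) = c * \<mu> k" if "0 \<le> k" "k \<le> m + 1" for k c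
  proof -
    have "(\<Sum>i\<in>{0..m + 1}. (if i = k then c else 0) * \<mu> i) = (\<Sum>i\<in>{0..m + 1}. if i = k then c * \<mu> i else 0)"
      by (rule sum.cong) auto
    then show ?thesis using that by simp
  qed
  show "boundary_lift m x u \<mu> p = \<mu> p" if "1 \<le> p" "p \<le> m"
  proof -
    have "boundary_lift m x u \<mu> p = (\<Sum>i\<in>{0..m + 1}. (if i = p then 1 else 0) * \<mu> i)"
      unfolding boundary_lift_def by (rule sum.cong) (use that m in \<open>auto simp: boundary_coeff_def\<close>)
    then show ?thesis using delta[of p 1] that by simp
  qed
  have "boundary_lift m x u \<mu> 0 = (\<Sum>i\<in>{0..m + 1}. (if i = 0 then (step u 0 + step x 1) / step x 1 else 0) * \<mu> i
      + (if i = 1 then - (step u 0 / step x 1) else 0) * \<mu> i)"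
    unfolding boundary_lift_def by (rule sum.cong) (use m in \<open>auto simp: boundary_coeff_def\<close>)
  then show "boundary_lift m x u \<mu> 0 = (step u 0 + step x 1) / step x 1 * \<mu> 0 - step u 0 / step x 1 * \<mu> 1"
    unfolding sum.distrib using delta[of 0] delta[of 1] m by simp
  have "boundary_lift m x u \<mu> (m + 1) = (\<Sum>i\<in>{0..m + 1}.
      (if i = m + 1 then (step x m + step u (m + 1)) / step x m else 0) * \<mu> i
      + (if i = m then - (step u (m + 1) / step x m) else 0) * \<mu> i)"
    unfolding boundary_lift_def by (rule sum.cong) (use m in \<open>auto simp: boundary_coeff_def\<close>)
  then show "boundary_lift m x u \<mu> (m + 1) =
      (step x m + step u (m + 1)) / step x m * \<mu> (m + 1) - step u (m + 1) / step x m * \<mu> m"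
    unfolding sum.distrib using delta[of "m + 1"] delta[of m] m by simp
  show "boundary_lift m x u \<mu> p = 0" if "p \<notin> {0..m + 1}"
    unfolding boundary_lift_def by (rule sum.neutral) (use that m in \<open>auto simp: boundary_coeff_def\<close>)
qed

lemma partition_steps:
  assumes "is_partition m a b x"
  shows "1 \<le> i \<Longrightarrow> i \<le> m \<Longrightarrow> 0 < step x i" "step x 0 = 0" "step x (m + 1) = 0"
  using assms unfolding is_partition_def step_def by auto

lemma extend_knots_steps:
  assumes m: "1 \<le> m" and u: "extended_knots m x u"
  shows "1 \<le> i \<Longrightarrow> i \<le> m \<Longrightarrow> step (extend_knots m u) i = step x i"
    and "step (extend_knots m u) 0 = step u 0"
    and "step (extend_knots m u) (m + 1) = step u (m + 1)"
  using assms unfolding extended_knots_def step_def by (simp_all add: extend_knots_eq)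

text \<open>
  The lift extrapolates the data so that the values and slopes at the knots \<open>x 0, \<dots>, x m\<close> come out as if the outer
  steps were zero: on the right-hand sides \<open>step x 0 = step x (m + 1) = 0\<close>, and the outer knots of \<open>u\<close> have
  disappeared.
\<close>

lemma boundary_lift_knots:
  assumes m: "1 \<le> m" and x: "is_partition m a b x" and u: "extended_knots m x u"
    and i: "0 \<le> i" "i \<le> m"
  shows "(boundary_lift m x u \<mu> (i + 1) - boundary_lift m x u \<mu> i)
        / (step (extend_knots m u) i + step (extend_knots m u) (i + 1))
      = (\<mu> (i + 1) - \<mu> i) / (step x i + step x (i + 1))"
    and "knot_value (extend_knots m u) (boundary_lift m x u \<mu>) i = knot_value x \<mu> i"
proof -
  note L = boundary_lift_simps[OF m]
  note S = partition_steps[OF x] extend_knots_steps[OF m u]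
  have pos: "0 < step (extend_knots m u) i" for i
    by (rule knot_line_step[OF knot_line_extend_knots[OF m u]])
  have pos0: "0 < step u 0" "0 < step u (m + 1)" using pos[of 0] pos[of "m + 1"] by (simp_all add: S)
  consider "i = 0" | "i = m" "i \<noteq> 0" | "1 \<le> i" "i + 1 \<le> m" using i by linarith
  then have "(boundary_lift m x u \<mu> (i + 1) - boundary_lift m x u \<mu> i)
        / (step (extend_knots m u) i + step (extend_knots m u) (i + 1))
      = (\<mu> (i + 1) - \<mu> i) / (step x i + step x (i + 1))
    \<and> knot_value (extend_knots m u) (boundary_lift m x u \<mu>) i = knot_value x \<mu> i"
  proof cases
    case 1
    have p: "0 < step x 1" using S(1)[of 1] m by simp
    have q: "step u 0 + step x 1 \<noteq> 0" using p pos0 by linarith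
    have e: "boundary_lift m x u \<mu> 1 = \<mu> 1" using L(1)[where p = 1] m by simp
    have s: "step (extend_knots m u) 1 = step x 1" using S(4)[of 1] m by simp
    let ?A = "boundary_lift m x u \<mu> 0"
    have "\<mu> 1 - ?A = (step u 0 + step x 1) * ((\<mu> 1 - \<mu> 0) / step x 1)"
      "step x 1 * ?A + step u 0 * \<mu> 1 = (step u 0 + step x 1) * \<mu> 0"
      using p unfolding L(2) by (simp_all add: field_simps)
    then show ?thesis using p q unfolding knot_value_def by (simp add: 1 e s S)
  next
    case 2
    have p: "0 < step x m" using S(1)[of m] m by simp
    have q: "step x m + step u (m + 1) \<noteq> 0" using p pos0 by linarith
    have e: "boundary_lift m x u \<mu> m = \<mu> m" using L(1)[where p = m] m by simp
    have s: "step (extend_knots m u) m = step x m" using S(4)[of m] m by simp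
    let ?A = "boundary_lift m x u \<mu> (m + 1)"
    have "?A - \<mu> m = (step x m + step u (m + 1)) * ((\<mu> (m + 1) - \<mu> m) / step x m)"
      "step u (m + 1) * \<mu> m + step x m * ?A = (step x m + step u (m + 1)) * \<mu> (m + 1)"
      using p unfolding L(3) by (simp_all add: field_simps)
    then show ?thesis using p q unfolding knot_value_def by (simp add: 2 e s S)
  next
    case 3
    then show ?thesis unfolding knot_value_def by (simp add: L S)
  qed
  then show "(boundary_lift m x u \<mu> (i + 1) - boundary_lift m x u \<mu> i)
        / (step (extend_knots m u) i + step (extend_knots m u) (i + 1))
      = (\<mu> (i + 1) - \<mu> i) / (step x i + step x (i + 1))"
    "knot_value (extend_knots m u) (boundary_lift m x u \<mu>) i = knot_value x \<mu> i" by blast+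
qed

definition lifted_net ::
  "int \<Rightarrow> int \<Rightarrow> (int \<Rightarrow> real) \<Rightarrow> (int \<Rightarrow> real) \<Rightarrow> (int \<Rightarrow> real) \<Rightarrow> (int \<Rightarrow> real) \<Rightarrow>
   (int \<Rightarrow> int \<Rightarrow> real) \<Rightarrow> int \<Rightarrow> int \<Rightarrow> real" where
  "lifted_net m n x y u v \<mu> p q = boundary_lift m x u (\<lambda>i. boundary_lift n y v (\<mu> i) q) p"

lemma lifted_net_transpose:
  "lifted_net n m y x v u (transpose_net \<mu>) q p = lifted_net m n x y u v \<mu> p q"
  unfolding lifted_net_def boundary_lift_def sum_distrib_left
  by (subst sum.swap) (simp add: mult_ac)

text \<open>
  By linearity the sum is the spline of the net with entries \<open>\<Sum>i j. \<alpha> i p * \<beta> j q * \<mu> i j\<close>. This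
  net is automatically zero outside the index range of the B-splines.
\<close>

lemma quasi_interpolant_eq_spline:
  assumes "1 \<le> m" "1 \<le> n" "extended_knots m x u" "extended_knots n y v"
  shows "(\<Sum>i\<in>{0..m + 1}. \<Sum>j\<in>{0..n + 1}. \<mu> i j * bspline m n x y u v i j z)
    = spline (extend_knots m u) (extend_knots n v) (lifted_net m n x y u v \<mu>) z"
proof -
  let ?R = "{0..m + 1} \<times> {0..n + 1}" and ?w = "lifted_net m n x y u v \<mu>"
  let ?b = "\<lambda>i p. boundary_coeff m x u i p" and ?c = "\<lambda>j q. boundary_coeff n y v j q"
  have unit: "?w = (\<lambda>i j. \<Sum>k\<in>?R. (case k of (p, q) \<Rightarrow> ?w p q) * (case k of (p, q) \<Rightarrow> unit_net p q) i j)"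
  proof (intro ext)
    fix i j
    have "(\<Sum>k\<in>?R. (case k of (p, q) \<Rightarrow> ?w p q) * (case k of (p, q) \<Rightarrow> unit_net p q) i j)
        = (\<Sum>k\<in>?R. if k = (i, j) then ?w i j else 0)"
      by (rule sum.cong) (auto simp: unit_net_def split: prod.splits)
    also have "\<dots> = ?w i j"
    proof (cases "(i, j) \<in> ?R")
      case False
      then have "i \<notin> {0..m + 1} \<or> j \<notin> {0..n + 1}" by blast
      then have "?w i j = 0"
        using boundary_lift_simps(4)[OF assms(1)] boundary_lift_simps(4)[OF assms(2)]
        unfolding lifted_net_def by (auto simp: boundary_lift_def)
      then show ?thesis by simp
    qed simp
    finally show "?w i j = (\<Sum>k\<in>?R. (case k of (p, q) \<Rightarrow> ?w p q) * (case k of (p, q) \<Rightarrow> unit_net p q) i j)" ..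
  qed
  have "spline (extend_knots m u) (extend_knots n v) ?w z
      = (\<Sum>k\<in>?R. (case k of (p, q) \<Rightarrow> ?w p q)
          * spline (extend_knots m u) (extend_knots n v) (case k of (p, q) \<Rightarrow> unit_net p q) z)"
    by (subst unit, rule spline_sum) simp
  also have "\<dots> = (\<Sum>k\<in>?R. ?w (fst k) (snd k) * classical_bspline m n u v (fst k) (snd k) z)"
    by (rule sum.cong) (auto simp: classical_bspline_eq_spline[OF assms])
  also have "\<dots> = (\<Sum>k\<in>?R. \<Sum>l\<in>?R. \<mu> (fst l) (snd l) * (?b (fst l) (fst k) * ?c (snd l) (snd k)
      * classical_bspline m n u v (fst k) (snd k) z))"
    unfolding lifted_net_def boundary_lift_def sum_distrib_left sum_distrib_right sum.cartesian_product'
    by (simp add: mult_ac)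
  also have "\<dots> = (\<Sum>l\<in>?R. \<Sum>k\<in>?R. \<mu> (fst l) (snd l) * (?b (fst l) (fst k) * ?c (snd l) (snd k)
      * classical_bspline m n u v (fst k) (snd k) z))"
    by (rule sum.swap)
  also have "\<dots> = (\<Sum>i\<in>{0..m + 1}. \<Sum>j\<in>{0..n + 1}. \<mu> i j * bspline m n x y u v i j z)"
    unfolding bspline_def sum.cartesian_product' by (simp add: sum_distrib_left)
  finally show ?thesis ..
qed

definition divided_slope :: "(int \<Rightarrow> real) \<Rightarrow> (int \<Rightarrow> real) \<Rightarrow> int \<Rightarrow> real" where
  "divided_slope x \<mu> i = (\<mu> (i + 1) - \<mu> i) / (midpt x (i + 1) - midpt x i)"

lemma divided_slope_eq: "divided_slope x \<mu> i = 2 * ((\<mu> (i + 1) - \<mu> i) / (step x i + step x (i + 1)))"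
proof -
  have "midpt x (i + 1) - midpt x i = (step x i + step x (i + 1)) / 2"
    unfolding midpt_def step_def by (simp add: field_simps)
  then show ?thesis unfolding divided_slope_def by (simp only:) simp
qed

lemma knot_value_convex:
  assumes "0 \<le> step y j" "0 \<le> step y (j + 1)" "0 < step y j + step y (j + 1)"
    and "\<bar>g j - D\<bar> \<le> E" "\<bar>g (j + 1) - D\<bar> \<le> E"
  shows "\<bar>knot_value y g j - D\<bar> \<le> E"
proof -
  define S where "S = step y j + step y (j + 1)"
  have S: "0 < S" using assms(3) by (simp add: S_def)
  have "S * (knot_value y g j - D) = S * knot_value y g j - S * D" by (rule right_diff_distrib)
  also have "S * knot_value y g j = step y (j + 1) * g j + step y j * g (j + 1)"
    using S unfolding knot_value_def S_def by simp
  finally have "S * (knot_value y g j - D) = step y (j + 1) * (g j - D) + step y j * (g (j + 1) - D)"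
    by (simp add: S_def algebra_simps)
  also have "\<bar>\<dots>\<bar> \<le> step y (j + 1) * E + step y j * E"
    by (rule order_trans[OF abs_triangle_ineq])
      (simp add: abs_mult assms add_mono mult_left_mono)
  also have "\<dots> = S * E" by (simp add: S_def algebra_simps)
  finally show ?thesis using S by (simp add: abs_mult)
qed

text \<open>
  At a vertex, \<open>\<partial>/\<partial>x\<close> is the interpolation in \<open>y\<close> of the divided differences of the two adjacent rows; at the
  centre of a cell it is the mean of the divided differences to the left and to the right. All other values are
  averages of these.
\<close>

lemma spline_dx_bound:
  assumes mn: "1 \<le> m" "1 \<le> n" and x: "is_partition m a b x" and y: "is_partition n c d y"
    and u: "extended_knots m x u" and v: "extended_knots n y v"
    and i: "1 \<le> i" "i \<le> m" and j: "1 \<le> j" "j \<le> n"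
    and z: "z \<in> cell (extend_knots m u) (extend_knots n v) i j"
    and bound: "\<And>k l. k \<in> {i - 1..i} \<Longrightarrow> l \<in> {j - 1..j + 1} \<Longrightarrow> \<bar>divided_slope x (\<lambda>i. \<mu> i l) k - D\<bar> \<le> E"
  shows "\<bar>spline_dx (extend_knots m u) (extend_knots n v) (lifted_net m n x y u v \<mu>) z - D\<bar> \<le> E"
proof -
  let ?U = "extend_knots m u" and ?V = "extend_knots n v" and ?w = "lifted_net m n x y u v \<mu>"
  note U = knot_line_extend_knots[OF mn(1) u] and V = knot_line_extend_knots[OF mn(2) v]
  note pos = knot_line_step[OF U] knot_line_step[OF V]
  have i': "0 \<le> i - 1" "i - 1 \<le> m" "0 \<le> i" "i \<le> m" and j': "0 \<le> j - 1" "j - 1 \<le> n" "0 \<le> j" "j \<le> n"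
    using i j by auto
  have steps: "0 \<le> step y l \<and> 0 \<le> step y (l + 1) \<and> 0 < step y l + step y (l + 1)" if "0 \<le> l" "l \<le> n" for l
  proof -
    have nn: "0 \<le> step y k" if "0 \<le> k" "k \<le> n + 1" for k
    proof -
      from that consider "k = 0" | "k = n + 1" | "1 \<le> k" "k \<le> n" by linarith
      then show ?thesis using partition_steps[OF y] by cases (auto intro: less_imp_le)
    qed
    have "0 < step y l \<or> 0 < step y (l + 1)"
      using partition_steps(1)[OF y, of l] partition_steps(1)[OF y, of "l + 1"] that mn by (cases "l = 0") auto
    then show ?thesis using nn[of l] nn[of "l + 1"] that by auto
  qed
  have k_lin: "knot_value y (\<lambda>l. 2 * ((f l - g l) / r)) l = 2 * ((knot_value y f l - knot_value y g l) / r)" for f g r l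
    unfolding knot_value_def by (simp add: algebra_simps add_divide_distrib diff_divide_distrib)
  \<comment> \<open>Interpolating across the rows first reduces a horizontal grid line to the univariate case.\<close>
  have P: "knot_value ?V (?w p) l = knot_value y (\<lambda>l. boundary_lift m x u (\<lambda>i. \<mu> i l) p) l"
    if "0 \<le> l" "l \<le> n" for p l
  proof -
    have "?w p = boundary_lift n y v (\<lambda>l. boundary_lift m x u (\<lambda>i. \<mu> i l) p)"
      by (rule ext, subst lifted_net_transpose[symmetric]) (simp add: lifted_net_def)
    then show ?thesis using boundary_lift_knots(2)[OF mn(2) y v that] by simp
  qed
  have edge: "\<bar>2 * ((knot_value ?V (?w (k + 1)) l - knot_value ?V (?w k) l) / (step ?U k + step ?U (k + 1))) - D\<bar> \<le> E"
    if k: "k \<in> {i - 1..i}" and l: "l \<in> {j - 1..j}" for k l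
  proof -
    have kk: "0 \<le> k" "k \<le> m" and ll: "0 \<le> l" "l \<le> n" using k l i j by auto
    have "2 * ((knot_value ?V (?w (k + 1)) l - knot_value ?V (?w k) l) / (step ?U k + step ?U (k + 1)))
      = knot_value y (\<lambda>l. divided_slope x (\<lambda>i. \<mu> i l) k) l"
      unfolding P[OF ll] k_lin[symmetric] boundary_lift_knots(1)[OF mn(1) x u kk] divided_slope_eq ..
    moreover have "\<bar>knot_value y (\<lambda>l. divided_slope x (\<lambda>i. \<mu> i l) k) l - D\<bar> \<le> E"
      by (rule knot_value_convex) (use steps[OF ll] bound k l in auto)
    ultimately show ?thesis by simp
  qed
  have row: "2 * ((?w (k + 1) j - ?w k j) / (step ?U k + step ?U (k + 1))) = divided_slope x (\<lambda>i. \<mu> i j) k"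
    if "0 \<le> k" "k \<le> m" for k
    unfolding lifted_net_def boundary_lift_knots(1)[OF mn(1) x u that] divided_slope_eq
    using boundary_lift_simps(1)[OF mn(2) j] by simp
  have corner: "2 / step ?U i * (vertex ?U ?V ?w i l - knot_value ?V (?w i) l)
        = 2 * ((knot_value ?V (?w (i + 1)) l - knot_value ?V (?w i) l) / (step ?U i + step ?U (i + 1)))"
      (is "?c1")
      "2 / step ?U i * (knot_value ?V (?w i) l - vertex ?U ?V ?w (i - 1) l)
        = 2 * ((knot_value ?V (?w (i - 1 + 1)) l - knot_value ?V (?w (i - 1)) l) / (step ?U (i - 1) + step ?U (i - 1 + 1)))"
      (is "?c2") for l
  proof -
    have tw: "2 / s * t = 2 * (t / s)" for s t :: real by simp
    show ?c1 unfolding tw vertex_def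
      using knot_value_slopes(1)[OF pos(1)[of i] pos(1)[of "i + 1"], of "\<lambda>p. knot_value ?V (?w p) l"]
      by (rule arg_cong)
    have "(knot_value ?V (?w i) l - vertex ?U ?V ?w (i - 1) l) / step ?U i
      = (knot_value ?V (?w (i - 1 + 1)) l - knot_value ?V (?w (i - 1)) l) / (step ?U (i - 1) + step ?U (i - 1 + 1))"
      using knot_value_slopes(2)[OF pos(1)[of "i - 1"] pos(1)[of "i - 1 + 1"], of "\<lambda>p. knot_value ?V (?w p) l"]
      unfolding vertex_def by simp
    then show ?c2 unfolding tw by (rule arg_cong)
  qed
  have center: "2 / step ?U i * ((knot_value ?U (\<lambda>p. ?w p j) i - knot_value ?U (\<lambda>p. ?w p j) (i - 1)) / 2)
      = (divided_slope x (\<lambda>i. \<mu> i j) i + divided_slope x (\<lambda>i. \<mu> i j) (i - 1)) / 2"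
  proof -
    have "2 / step ?U i * ((knot_value ?U (\<lambda>p. ?w p j) i - knot_value ?U (\<lambda>p. ?w p j) (i - 1)) / 2)
      = (knot_value ?U (\<lambda>p. ?w p j) i - ?w i j) / step ?U i
        + (?w (i - 1 + 1) j - knot_value ?U (\<lambda>p. ?w p j) (i - 1)) / step ?U (i - 1 + 1)"
      by (simp add: diff_divide_distrib)
    also have "\<dots> = (?w (i + 1) j - ?w i j) / (step ?U i + step ?U (i + 1))
        + (?w (i - 1 + 1) j - ?w (i - 1) j) / (step ?U (i - 1) + step ?U (i - 1 + 1))"
      by (intro arg_cong2[of _ _ _ _ "(+)"] knot_value_slopes pos)
    finally have sum: "2 / step ?U i * ((knot_value ?U (\<lambda>p. ?w p j) i - knot_value ?U (\<lambda>p. ?w p j) (i - 1)) / 2)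
      = (?w (i + 1) j - ?w i j) / (step ?U i + step ?U (i + 1))
        + (?w (i - 1 + 1) j - ?w (i - 1) j) / (step ?U (i - 1) + step ?U (i - 1 + 1))" .
    have avg: "A = (g + g') / 2" if "A = r + r'" "2 * r = g" "2 * r' = g'" for A r r' g g' :: real
      using that by simp
    show ?thesis by (rule avg[OF sum row[OF i'(3,4)] row[OF i'(1,2)]])
  qed
  have c: "\<bar>divided_slope x (\<lambda>i. \<mu> i j) i - D\<bar> \<le> E" "\<bar>divided_slope x (\<lambda>i. \<mu> i j) (i - 1) - D\<bar> \<le> E"
    by (rule bound; simp)+
  have "\<bar>cell_spline_dx ?U ?V ?w i j z - D\<bar> \<le> E"
    unfolding cell_spline_dx_def
  proof (rule patch_dx_bound)
    show "\<bar>local_coord ?U i (fst z)\<bar> \<le> 1" "\<bar>local_coord ?V j (snd z)\<bar> \<le> 1"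
      using z local_coord_bounds[OF pos(1)] local_coord_bounds[OF pos(2)] by (auto simp: cell_def mem_Times_iff)
    show "0 \<le> 2 / step ?U i" using pos(1)[of i] by simp
    show "\<bar>2 / step ?U i * ((knot_value ?U (\<lambda>p. ?w p j) i - knot_value ?U (\<lambda>p. ?w p j) (i - 1)) / 2) - D\<bar> \<le> E"
      unfolding center using c by (simp add: abs_le_iff field_simps)
    show "\<bar>2 / step ?U i * (vertex ?U ?V ?w i j - knot_value ?V (?w i) j) - D\<bar> \<le> E"
      "\<bar>2 / step ?U i * (vertex ?U ?V ?w i (j - 1) - knot_value ?V (?w i) (j - 1)) - D\<bar> \<le> E"
      unfolding corner by (rule edge; simp)+
    show "\<bar>2 / step ?U i * (knot_value ?V (?w i) j - vertex ?U ?V ?w (i - 1) j) - D\<bar> \<le> E"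
      "\<bar>2 / step ?U i * (knot_value ?V (?w i) (j - 1) - vertex ?U ?V ?w (i - 1) (j - 1)) - D\<bar> \<le> E"
      unfolding corner by (rule edge; simp)+
  qed
  then show ?thesis by (simp add: spline_on_cell[OF U V z])
qed

section \<open>First-order estimates on a rectangle\<close>

text \<open>
  The modulus at a larger distance is controlled by cutting the segment, which stays in the convex set, into
  \<open>N\<close> equal parts.
\<close>

lemma modulus_chain:
  fixes g :: "'a :: real_normed_vector \<Rightarrow> real"
  assumes S: "convex S" and g: "\<And>z z'. z \<in> S \<Longrightarrow> z' \<in> S \<Longrightarrow> dist z z' \<le> r \<Longrightarrow> \<bar>g z - g z'\<bar> \<le> \<omega>"
    and z: "z \<in> S" "z' \<in> S" "dist z z' \<le> real N * r"
  shows "\<bar>g z - g z'\<bar> \<le> real N * \<omega>"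
  using z
proof (induction N arbitrary: z')
  case 0
  then show ?case by simp
next
  case (Suc N)
  define s where "s = real N / real (Suc N)"
  define y where "y = z + s *\<^sub>R (z' - z)"
  have s: "0 \<le> s" "s \<le> 1" "1 - s = 1 / real (Suc N)" by (simp_all add: s_def field_simps)
  have "y = (1 - s) *\<^sub>R z + s *\<^sub>R z'" by (simp add: y_def algebra_simps)
  then have y: "y \<in> S" using S Suc.prems s by (auto intro: convexD)
  have "dist z y = s * dist z z'" by (simp add: y_def dist_norm s norm_minus_commute)
  also have "\<dots> \<le> s * (real (Suc N) * r)" using Suc.prems(3) s(1) by (intro mult_left_mono)
  also have "\<dots> = real N * r" by (simp add: s_def)
  finally have 1: "\<bar>g z - g y\<bar> \<le> real N * \<omega>" using Suc.IH[of y] Suc.prems y by simp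
  have "z' - y = (1 - s) *\<^sub>R (z' - z)" by (simp add: y_def algebra_simps)
  then have "dist y z' = (1 - s) * dist z z'"
    using s by (simp add: dist_norm norm_minus_commute[of y] norm_minus_commute[of z z'])
  also have "\<dots> \<le> (1 - s) * (real (Suc N) * r)" using Suc.prems(3) s by (intro mult_left_mono) auto
  also have "\<dots> = r" by (simp add: s(3))
  finally have "\<bar>g y - g z'\<bar> \<le> \<omega>" using g y Suc.prems by simp
  then show ?case using 1 by (simp add: algebra_simps)
qed

lemma dist_pair_le: "dist (x, y) (x', y') \<le> \<bar>x - x'\<bar> + \<bar>y - y'\<bar>" for x y x' y' :: real
  unfolding dist_Pair_Pair dist_real_def by (rule sqrt_sum_squares_le_sum) simp_all

text \<open>
  The mean value theorem on the segment leaves the increments of the two partial derivatives, at a point at most as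
  far away as the other end.
\<close>

lemma first_order_remainder:
  fixes f :: "real \<times> real \<Rightarrow> real"
  assumes S: "convex S"
    and f: "\<And>z. z \<in> S \<Longrightarrow> (f has_derivative (\<lambda>d. fx z * fst d + fy z * snd d)) (at z within S)"
    and fx: "\<And>z z'. z \<in> S \<Longrightarrow> z' \<in> S \<Longrightarrow> dist z z' \<le> r \<Longrightarrow> \<bar>fx z - fx z'\<bar> \<le> \<omega>"
    and fy: "\<And>z z'. z \<in> S \<Longrightarrow> z' \<in> S \<Longrightarrow> dist z z' \<le> r \<Longrightarrow> \<bar>fy z - fy z'\<bar> \<le> \<omega>"
    and z: "z \<in> S" "z' \<in> S" "dist z z' \<le> real N * r"
  shows "\<bar>f z' - f z - fx z * (fst z' - fst z) - fy z * (snd z' - snd z)\<bar>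
    \<le> (\<bar>fst z' - fst z\<bar> + \<bar>snd z' - snd z\<bar>) * (real N * \<omega>)"
proof -
  define p where "p t = z + t *\<^sub>R (z' - z)" for t :: real
  have p: "p t \<in> S" if "t \<in> {0..1}" for t
  proof -
    have "p t = (1 - t) *\<^sub>R z + t *\<^sub>R z'" by (simp add: p_def algebra_simps)
    then show ?thesis using S z that by (auto intro: convexD)
  qed
  have "((\<lambda>t. f (p t)) has_derivative
      (\<lambda>s. fx (p t) * fst (s *\<^sub>R (z' - z)) + fy (p t) * snd (s *\<^sub>R (z' - z)))) (at t within {0..1})"
    if t: "t \<in> {0..1}" for t
  proof (rule has_derivative_in_compose2[of S f])
    show "(f has_derivative (\<lambda>d. fx y * fst d + fy y * snd d)) (at y within S)" if "y \<in> S" for y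
      using f[OF that] .
    show "p ` {0..1} \<subseteq> S" using p by blast
    show "(p has_derivative (\<lambda>s. s *\<^sub>R (z' - z))) (at t within {0..1})"
      unfolding p_def by (auto intro!: derivative_eq_intros)
  qed (rule t)
  then obtain t where t: "t \<in> {0<..<1}" and
    mv: "f (p 1) - f (p 0) = fx (p t) * fst ((1 - 0) *\<^sub>R (z' - z)) + fy (p t) * snd ((1 - 0) *\<^sub>R (z' - z))"
    using mvt_simple[of 0 1 "\<lambda>t. f (p t)"
        "\<lambda>t s. fx (p t) * fst (s *\<^sub>R (z' - z)) + fy (p t) * snd (s *\<^sub>R (z' - z))"] by auto
  have pt: "p t \<in> S" using t by (intro p) auto
  have "dist z (p t) = t * dist z z'" using t by (simp add: p_def dist_norm norm_minus_commute)
  also have "\<dots> \<le> dist z z'" using t by (simp add: mult_left_le_one_le)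
  finally have d: "dist (p t) z \<le> real N * r" using z(3) by (simp add: dist_commute)
  have X: "\<bar>fx (p t) - fx z\<bar> \<le> real N * \<omega>" by (rule modulus_chain[OF S fx pt z(1) d])
  have Y: "\<bar>fy (p t) - fy z\<bar> \<le> real N * \<omega>" by (rule modulus_chain[OF S fy pt z(1) d])
  have "f z' - f z - fx z * (fst z' - fst z) - fy z * (snd z' - snd z)
    = (fst z' - fst z) * (fx (p t) - fx z) + (snd z' - snd z) * (fy (p t) - fy z)"
    using mv by (simp add: p_def algebra_simps)
  also have "\<bar>\<dots>\<bar> \<le> \<bar>fst z' - fst z\<bar> * (real N * \<omega>) + \<bar>snd z' - snd z\<bar> * (real N * \<omega>)"
    by (rule order_trans[OF abs_triangle_ineq]) (simp only: abs_mult, intro add_mono mult_left_mono X Y abs_ge_zero)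
  finally show ?thesis by (simp add: distrib_right)
qed

section \<open>Geometry of the partition\<close>

lemma partition_step_bounds:
  assumes x: "is_partition m a b x" and m: "1 \<le> m" and h: "\<And>i. 1 \<le> i \<Longrightarrow> i \<le> m \<Longrightarrow> step x i \<le> h"
    and i: "0 \<le> i" "i \<le> m + 1"
  shows "0 \<le> step x i" "step x i \<le> h"
proof -
  have "0 < step x 1" "step x 1 \<le> h" using partition_steps(1)[OF x, of 1] h[of 1] m by auto
  then have "0 \<le> h" by linarith
  note h0 = this
  consider "i = 0" | "i = m + 1" | "1 \<le> i" "i \<le> m" using i by linarith
  then have "0 \<le> step x i \<and> step x i \<le> h"
  proof cases
    case 3
    then show ?thesis using partition_steps(1)[OF x 3] h[OF 3] by simp
  qed (simp_all add: partition_steps(2,3)[OF x] h0)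
  then show "0 \<le> step x i" "step x i \<le> h" by blast+
qed

lemma partition_mono:
  assumes x: "is_partition m a b x" and m: "1 \<le> m" and ij: "- 1 \<le> i" "i \<le> j" "j \<le> m + 1"
  shows "x i \<le> x j"
  using ij(2,3)
proof (induction j rule: int_ge_induct)
  case (step j)
  consider "j + 1 = 0" | "j + 1 = m + 1" | "1 \<le> j + 1" "j + 1 \<le> m" using step ij(1) by linarith
  then have "0 \<le> step x (j + 1)"
  proof cases
    case 3
    then show ?thesis using partition_steps(1)[OF x 3] by simp
  qed (simp_all only: partition_steps(2,3)[OF x] order_refl)
  then show ?case using step by (simp add: step_def)
qed simp

lemma partition_in_interval:
  assumes x: "is_partition m a b x" and m: "1 \<le> m"
  shows "- 1 \<le> i \<Longrightarrow> i \<le> m + 1 \<Longrightarrow> x i \<in> {a..b}"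
    and "0 \<le> i \<Longrightarrow> i \<le> m + 1 \<Longrightarrow> midpt x i \<in> {a..b}"
proof -
  have ab: "x (- 1) = a" "x (m + 1) = b" using x unfolding is_partition_def by auto
  show *: "x i \<in> {a..b}" if "- 1 \<le> i" "i \<le> m + 1" for i
    using partition_mono[OF x m, of "- 1" i] partition_mono[OF x m, of i "m + 1"] that ab m by auto
  show "midpt x i \<in> {a..b}" if "0 \<le> i" "i \<le> m + 1"
    using *[of i] *[of "i - 1"] that unfolding midpt_def by auto
qed

lemma midpt_eq: "midpt x i = x i - step x i / 2" "midpt x i = x (i - 1) + step x i / 2"
  unfolding midpt_def step_def by (simp_all add: field_simps)

text \<open>
  The factor \<open>3/2\<close> comes from a neighbouring interval: one full step and half of the next.
\<close>

lemma midpt_near_cell: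
  assumes x: "is_partition m a b x" and m: "1 \<le> m" and h: "\<And>i. 1 \<le> i \<Longrightarrow> i \<le> m \<Longrightarrow> step x i \<le> h"
    and i: "1 \<le> i" "i \<le> m" and t: "t \<in> {x (i - 1)..x i}" and k: "k \<in> {i - 1..i + 1}"
  shows "\<bar>midpt x k - t\<bar> \<le> 3 / 2 * h"
proof -
  have s: "0 \<le> step x k" "step x k \<le> h" "0 \<le> step x i" "step x i \<le> h"
    using partition_step_bounds[OF x m h] i k by auto
  have tb: "x (i - 1) \<le> t" "t \<le> x i" "x i = x (i - 1) + step x i" using t by (auto simp: step_def)
  consider "k = i - 1" | "k = i" | "k = i + 1" using k by fastforce
  then show ?thesis
  proof cases
    case 1
    then have "midpt x k = x (i - 1) - step x k / 2" using midpt_eq(1)[of x k] by simp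
    then show ?thesis using tb s by linarith
  next
    case 2
    then have "midpt x k = x i - step x i / 2" using midpt_eq(1)[of x k] by simp
    then show ?thesis using tb s by linarith
  next
    case 3
    then have "midpt x k = x i + step x k / 2" using midpt_eq(2)[of x k] by simp
    then show ?thesis using tb s by linarith
  qed
qed

lemma partition_cell:
  assumes x: "is_partition m a b x" and m: "1 \<le> m" and u: "extended_knots m x u" and t: "t \<in> {a..b}"
  obtains i where "1 \<le> i" "i \<le> m" "t \<in> {x (i - 1)..x i}"
proof -
  let ?U = "extend_knots m u"
  note U = knot_line_extend_knots[OF m u]
  note mono = strict_mono_less[OF knot_line_strict_mono[OF U]]
  have Ux: "?U i = x i" if "0 \<le> i" "i \<le> m" for i
    using that u unfolding extended_knots_def by (simp add: extend_knots_eq)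
  have ab: "x 0 = a" "x m = b" using x unfolding is_partition_def by auto
  define k where "k = cell_index ?U t"
  have k: "?U (k - 1) < t" "t \<le> ?U k" using cell_index[OF U, of t] by (simp_all add: k_def)
  show thesis
  proof (cases "1 \<le> k")
    case True
    have "?U (k - 1) < ?U m" using k(1) t ab Ux[of m] m by auto
    then have "k \<le> m" using mono by simp
    then show thesis using that[of k] True k Ux[of k] Ux[of "k - 1"] by auto
  next
    case False
    \<comment> \<open>The left end point belongs to the half-open interval before the first one.\<close>
    have "?U k \<le> ?U 0" using False strict_mono_less_eq[OF knot_line_strict_mono[OF U]] by simp
    then have "t = a" using k(2) t ab Ux[of 0] m by auto
    then show thesis using that[of 1] m ab partition_mono[OF x m, of 0 1] by auto
  qed
qed

section \<open>The derivative error of a quasi-interpolant\<close>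

text \<open>
  In the factor 8, a share of 2 compares a divided difference of \<open>f\<close> with \<open>fx\<close> at one of its two data sites, at
  distance at most \<open>h\<close>; a share of 6 moves from this site to \<open>z\<close>, over a distance of at most \<open>3 h\<close>. The term with
  \<open>K\<close> is the perturbation \<open>2 K h \<omega>\<close> of the numerator divided by the gap, which is at least \<open>\<delta> / 2\<close>.
\<close>

lemma spline_dx_error:
  fixes f :: "real \<times> real \<Rightarrow> real"
  assumes mn: "1 \<le> m" "1 \<le> n" and x: "is_partition m a b x" and y: "is_partition n c d y"
    and u: "extended_knots m x u" and v: "extended_knots n y v"
    and hx: "\<And>i. 1 \<le> i \<Longrightarrow> i \<le> m \<Longrightarrow> step x i \<le> h" and hy: "\<And>j. 1 \<le> j \<Longrightarrow> j \<le> n \<Longrightarrow> step y j \<le> h"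
    and \<delta>: "0 < \<delta>" "\<And>i. 1 \<le> i \<Longrightarrow> i \<le> m \<Longrightarrow> \<delta> \<le> step x i"
    and f: "\<And>z. z \<in> {a..b} \<times> {c..d} \<Longrightarrow>
      (f has_derivative (\<lambda>d. fx z * fst d + fy z * snd d)) (at z within {a..b} \<times> {c..d})"
    and fx: "\<And>z z'. z \<in> {a..b} \<times> {c..d} \<Longrightarrow> z' \<in> {a..b} \<times> {c..d} \<Longrightarrow> dist z z' \<le> h / 2 \<Longrightarrow> \<bar>fx z - fx z'\<bar> \<le> \<omega>"
    and fy: "\<And>z z'. z \<in> {a..b} \<times> {c..d} \<Longrightarrow> z' \<in> {a..b} \<times> {c..d} \<Longrightarrow> dist z z' \<le> h / 2 \<Longrightarrow> \<bar>fy z - fy z'\<bar> \<le> \<omega>"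
    and \<mu>: "\<And>i j. 0 \<le> i \<Longrightarrow> i \<le> m + 1 \<Longrightarrow> 0 \<le> j \<Longrightarrow> j \<le> n + 1 \<Longrightarrow>
      \<bar>\<mu> i j - f (midpt x i, midpt y j)\<bar> \<le> K * h * \<omega>"
    and z: "z \<in> {a..b} \<times> {c..d}"
  shows "\<bar>spline_dx (extend_knots m u) (extend_knots n v) (lifted_net m n x y u v \<mu>) z - fx z\<bar>
    \<le> (8 + 4 * K * (h / \<delta>)) * \<omega>"
proof -
  let ?\<Omega> = "{a..b} \<times> {c..d}"
  obtain X Y where zXY: "z = (X, Y)" by (cases z)
  have conv: "convex ?\<Omega>" by (intro convex_Times convex_closed_interval)
  have \<omega>: "0 \<le> \<omega>"
  proof -
    have "0 \<le> h" using hx[of 1] partition_steps(1)[OF x, of 1] mn by auto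
    then show ?thesis using fx[OF z z] by simp
  qed
  obtain i where i: "1 \<le> i" "i \<le> m" "X \<in> {x (i - 1)..x i}"
    using partition_cell[OF x mn(1) u, of X] z zXY by auto
  obtain j where j: "1 \<le> j" "j \<le> n" "Y \<in> {y (j - 1)..y j}"
    using partition_cell[OF y mn(2) v, of Y] z zXY by auto
  have "z \<in> cell (extend_knots m u) (extend_knots n v) i j"
    using i j u v unfolding cell_def extended_knots_def by (simp add: extend_knots_eq zXY)
  then show ?thesis
  proof (rule spline_dx_bound[OF mn x y u v i(1,2) j(1,2)])
    fix k l assume k: "k \<in> {i - 1..i}" and l: "l \<in> {j - 1..j + 1}"
    have kl: "0 \<le> k" "k \<le> m" "0 \<le> l" "l \<le> n + 1" using k l i j by auto
    define S where "S = step x k + step x (k + 1)"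
    define M where "M = (midpt x k, midpt y l)"
    define M' where "M' = (midpt x (k + 1), midpt y l)"
    have MM: "M \<in> ?\<Omega>" "M' \<in> ?\<Omega>"
      using partition_in_interval(2)[OF x mn(1), of k] partition_in_interval(2)[OF x mn(1), of "k + 1"]
        partition_in_interval(2)[OF y mn(2), of l] kl unfolding M_def M'_def by auto
    have S1: "S \<le> 2 * h"
      using partition_step_bounds(2)[OF x mn(1) hx, of k] partition_step_bounds(2)[OF x mn(1) hx, of "k + 1"] kl
      unfolding S_def by auto
    have S2: "\<delta> \<le> S"
    proof (cases "k = 0")
      case True
      then show ?thesis using \<delta>(2)[of 1] partition_steps(2)[OF x] mn unfolding S_def by simp
    next
      case False
      then show ?thesis
        using \<delta>(2)[of k] partition_step_bounds(1)[OF x mn(1) hx, of "k + 1"] kl unfolding S_def by simp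
    qed
    have S: "0 < S" using S2 \<delta>(1) by linarith
    have dM: "midpt x (k + 1) - midpt x k = S / 2"
      unfolding midpt_def S_def step_def by (simp add: field_simps)
    have "dist M M' \<le> \<bar>midpt x k - midpt x (k + 1)\<bar>"
      using dist_pair_le[of "midpt x k" "midpt y l" "midpt x (k + 1)" "midpt y l"] by (simp add: M_def M'_def)
    also have "\<dots> = S / 2" using dM S by simp
    finally have dist: "dist M M' \<le> real 2 * (h / 2)" using S1 by simp
    have T: "\<bar>f M' - f M - fx M * (S / 2)\<bar> \<le> (S / 2) * (2 * \<omega>)"
      using first_order_remainder[OF conv f fx fy MM dist] S dM by (simp add: M_def M'_def)
    have "\<bar>\<mu> (k + 1) l - f M'\<bar> \<le> K * h * \<omega>" "\<bar>\<mu> k l - f M\<bar> \<le> K * h * \<omega>"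
      using \<mu>[of "k + 1" l] \<mu>[of k l] kl by (simp_all add: M_def M'_def)
    then have "\<bar>\<mu> (k + 1) l - \<mu> k l - fx M * (S / 2)\<bar> \<le> S * \<omega> + 2 * (K * h * \<omega>)"
      using T by (simp add: abs_le_iff) 
    then have "\<bar>\<mu> (k + 1) l - \<mu> k l - fx M * (S / 2)\<bar> / (S / 2) \<le> (S * \<omega> + 2 * (K * h * \<omega>)) / (S / 2)"
      using S by (intro divide_right_mono) auto
    also have "\<bar>\<mu> (k + 1) l - \<mu> k l - fx M * (S / 2)\<bar> / (S / 2)
        = \<bar>(\<mu> (k + 1) l - \<mu> k l - fx M * (S / 2)) / (S / 2)\<bar>"
      by (subst abs_divide, subst abs_of_pos[OF half_gt_zero[OF S]], rule refl)
    also have "(\<mu> (k + 1) l - \<mu> k l - fx M * (S / 2)) / (S / 2) = divided_slope x (\<lambda>i. \<mu> i l) k - fx M"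
      using S unfolding divided_slope_def dM by (simp add: field_simps)
    also have "(S * \<omega> + 2 * (K * h * \<omega>)) / (S / 2) = 2 * \<omega> + 4 * (K * h * \<omega>) / S"
      using S by (simp add: field_simps)
    also have "4 * (K * h * \<omega>) / S \<le> 4 * (K * h * \<omega>) / \<delta>"
    proof (rule divide_left_mono[OF S2])
      have "0 \<le> K * h * \<omega>" using \<mu>[of 0 0] mn by (smt (verit) abs_ge_zero)
      then show "0 \<le> 4 * (K * h * \<omega>)" by simp
      show "0 < S * \<delta>" using S \<delta>(1) by simp
    qed
    finally have 1: "\<bar>divided_slope x (\<lambda>i. \<mu> i l) k - fx M\<bar> \<le> 2 * \<omega> + 4 * (K * h * \<omega>) / \<delta>" by simp
    have "dist M z \<le> \<bar>midpt x k - X\<bar> + \<bar>midpt y l - Y\<bar>" unfolding M_def zXY by (rule dist_pair_le)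
    also have "\<dots> \<le> 3 / 2 * h + 3 / 2 * h"
      using midpt_near_cell[OF x mn(1) hx i, of k] midpt_near_cell[OF y mn(2) hy j, of l] k l by (intro add_mono) auto
    finally have dMz: "dist M z \<le> real 6 * (h / 2)" by simp
    have "\<bar>fx M - fx z\<bar> \<le> real 6 * \<omega>" by (rule modulus_chain[OF conv fx MM(1) z dMz])
    then show "\<bar>divided_slope x (\<lambda>i. \<mu> i l) k - fx z\<bar> \<le> (8 + 4 * K * (h / \<delta>)) * \<omega>"
      using 1 by (simp add: distrib_right)
  qed
qed

section \<open>Derivatives and moduli of \<open>C\<^sup>1\<close> functions on a rectangle\<close>

lemma partial_x_rectangle:
  fixes f :: "real \<times> real \<Rightarrow> real"
  assumes D: "(f has_derivative D) (at z within {a..b} \<times> {c..d})" and z: "z \<in> {a..b} \<times> {c..d}" and ab: "a < b"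
  shows "partial_x ({a..b} \<times> {c..d}) f z = D (1, 0)"
proof -
  have z': "fst z \<in> {a..b}" "snd z \<in> {c..d}" using z by (simp_all add: mem_Times_iff)
  have S: "{t. (t, snd z) \<in> {a..b} \<times> {c..d}} = {a..b}" using z' by auto
  have "((\<lambda>t. (t, snd z)) has_derivative (\<lambda>s. (s, 0))) (at (fst z) within {a..b})"
    by (auto intro!: derivative_eq_intros)
  moreover have "(f has_derivative D) (at (fst z, snd z) within (\<lambda>t. (t, snd z)) ` {a..b})"
    by (rule has_derivative_subset[of f D _ "{a..b} \<times> {c..d}"]) (use D z' in auto)
  ultimately have "((\<lambda>t. f (t, snd z)) has_derivative (\<lambda>s. D (s, 0))) (at (fst z) within {a..b})"
    by (rule has_derivative_in_compose)
  moreover have "(\<lambda>s. D (s, 0)) = (\<lambda>s. s *\<^sub>R D (1, 0))"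
  proof
    fix s
    show "D (s, 0) = s *\<^sub>R D (1, 0)"
      using linear_cmul[OF bounded_linear.linear[OF has_derivative_bounded_linear[OF D]], of s "(1, 0)"] by simp
  qed
  ultimately have "((\<lambda>t. f (t, snd z)) has_vector_derivative D (1, 0)) (at (fst z) within {a..b})"
    unfolding has_vector_derivative_def by (simp only:)
  then show ?thesis
    unfolding partial_x_def S using ab z'(1) by (intro vector_derivative_within_closed_interval) auto
qed

lemma partial_y_rectangle:
  fixes f :: "real \<times> real \<Rightarrow> real"
  assumes D: "(f has_derivative D) (at z within {a..b} \<times> {c..d})" and z: "z \<in> {a..b} \<times> {c..d}" and cd: "c < d"
  shows "partial_y ({a..b} \<times> {c..d}) f z = D (0, 1)"
proof -
  have z': "fst z \<in> {a..b}" "snd z \<in> {c..d}" using z by (simp_all add: mem_Times_iff)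
  have S: "{t. (fst z, t) \<in> {a..b} \<times> {c..d}} = {c..d}" using z' by auto
  have "((\<lambda>t. (fst z, t)) has_derivative (\<lambda>s. (0, s))) (at (snd z) within {c..d})"
    by (auto intro!: derivative_eq_intros)
  moreover have "(f has_derivative D) (at (fst z, snd z) within (\<lambda>t. (fst z, t)) ` {c..d})"
    by (rule has_derivative_subset[of f D _ "{a..b} \<times> {c..d}"]) (use D z' in auto)
  ultimately have "((\<lambda>t. f (fst z, t)) has_derivative (\<lambda>s. D (0, s))) (at (snd z) within {c..d})"
    by (rule has_derivative_in_compose)
  moreover have "(\<lambda>s. D (0, s)) = (\<lambda>s. s *\<^sub>R D (0, 1))"
  proof
    fix s
    show "D (0, s) = s *\<^sub>R D (0, 1)"
      using linear_cmul[OF bounded_linear.linear[OF has_derivative_bounded_linear[OF D]], of s "(0, 1)"] by simp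
  qed
  ultimately have "((\<lambda>t. f (fst z, t)) has_vector_derivative D (0, 1)) (at (snd z) within {c..d})"
    unfolding has_vector_derivative_def by (simp only:)
  then show ?thesis
    unfolding partial_y_def S using cd z'(2) by (intro vector_derivative_within_closed_interval) auto
qed

lemma C1_on_rectangle_partials:
  fixes f :: "real \<times> real \<Rightarrow> real"
  assumes f: "C1_on ({a..b} \<times> {c..d}) f" and ab: "a < b" and cd: "c < d"
  shows "\<And>z. z \<in> {a..b} \<times> {c..d} \<Longrightarrow> (f has_derivative
      (\<lambda>v. partial_x ({a..b} \<times> {c..d}) f z * fst v + partial_y ({a..b} \<times> {c..d}) f z * snd v))
      (at z within {a..b} \<times> {c..d})"
    and "continuous_on ({a..b} \<times> {c..d}) (partial_x ({a..b} \<times> {c..d}) f)"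
    and "continuous_on ({a..b} \<times> {c..d}) (partial_y ({a..b} \<times> {c..d}) f)"
proof -
  let ?\<Omega> = "{a..b} \<times> {c..d}"
  obtain f' :: "real \<times> real \<Rightarrow> (real \<times> real) \<Rightarrow>\<^sub>L real"
    where f': "\<And>z. z \<in> ?\<Omega> \<Longrightarrow> (f has_derivative blinfun_apply (f' z)) (at z within ?\<Omega>)"
      and cont: "continuous_on ?\<Omega> f'"
    using f unfolding C1_on_def by blast
  have px: "partial_x ?\<Omega> f z = blinfun_apply (f' z) (1, 0)" if z: "z \<in> ?\<Omega>" for z
    by (rule partial_x_rectangle[OF f'[OF z] z ab])
  have py: "partial_y ?\<Omega> f z = blinfun_apply (f' z) (0, 1)" if z: "z \<in> ?\<Omega>" for z
    by (rule partial_y_rectangle[OF f'[OF z] z cd])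
  show "(f has_derivative (\<lambda>v. partial_x ?\<Omega> f z * fst v + partial_y ?\<Omega> f z * snd v)) (at z within ?\<Omega>)"
    if z: "z \<in> ?\<Omega>" for z
  proof (rule has_derivative_eq_rhs[OF f'[OF z]], rule ext)
    fix v :: "real \<times> real"
    have "v = fst v *\<^sub>R (1, 0) + snd v *\<^sub>R (0, 1)" by (simp add: prod_eq_iff)
    then have "blinfun_apply (f' z) v = blinfun_apply (f' z) (fst v *\<^sub>R (1, 0) + snd v *\<^sub>R (0, 1))" by simp
    then show "blinfun_apply (f' z) v = partial_x ?\<Omega> f z * fst v + partial_y ?\<Omega> f z * snd v"
      by (simp only: blinfun.add_right blinfun.scaleR_right px[OF z] py[OF z] real_scaleR_def mult.commute)
  qed
  have "continuous_on ?\<Omega> (\<lambda>z. blinfun_apply (f' z) e)" for e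
    by (intro continuous_intros cont)
  then show "continuous_on ?\<Omega> (partial_x ?\<Omega> f)" "continuous_on ?\<Omega> (partial_y ?\<Omega> f)"
    by (auto intro!: continuous_on_eq[rotated, OF px[symmetric]] continuous_on_eq[rotated, OF py[symmetric]])
qed

lemma le_modulus:
  assumes "compact S" "continuous_on S g" "z \<in> S" "z' \<in> S" "dist z z' \<le> t"
  shows "\<bar>g z - g z'\<bar> \<le> modulus S g t"
proof -
  have "bounded (g ` S)" using assms(1,2) by (intro compact_imp_bounded compact_continuous_image)
  then obtain B where B: "\<And>p. p \<in> S \<Longrightarrow> \<bar>g p\<bar> \<le> B" unfolding bounded_iff by auto
  let ?P = "{(M, P). M \<in> S \<and> P \<in> S \<and> dist M P \<le> t}"
  have "bdd_above ((\<lambda>(M, P). \<bar>g M - g P\<bar>) ` ?P)"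
  proof (rule bdd_aboveI2)
    fix k assume "k \<in> ?P"
    then obtain M P where k: "k = (M, P)" "M \<in> S" "P \<in> S" by blast
    have "\<bar>g M - g P\<bar> \<le> B + B" using B[OF k(2)] B[OF k(3)] by linarith
    then show "(case k of (M, P) \<Rightarrow> \<bar>g M - g P\<bar>) \<le> B + B" by (simp add: k(1))
  qed
  then have "(case (z, z') of (M, P) \<Rightarrow> \<bar>g M - g P\<bar>) \<le> modulus S g t"
    unfolding modulus_def by (rule cSUP_upper[rotated]) (use assms in simp)
  then show ?thesis by simp
qed

lemma le_deriv_modulus_1:
  "modulus S (partial_x S f) t \<le> deriv_modulus S 1 f t" "modulus S (partial_y S f) t \<le> deriv_modulus S 1 f t"
proof -
  have idx: "{\<alpha> :: nat \<times> nat. fst \<alpha> + snd \<alpha> = 1} = {(1, 0), (0, 1)}" by auto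
  have "partial_deriv S (1, 0) f = partial_x S f" "partial_deriv S (0, 1) f = partial_y S f"
    by (simp_all add: partial_deriv_def)
  then show "modulus S (partial_x S f) t \<le> deriv_modulus S 1 f t" "modulus S (partial_y S f) t \<le> deriv_modulus S 1 f t"
    unfolding deriv_modulus_def idx by simp_all
qed

section \<open>The functionals are close to point evaluation\<close>

text \<open>
  The values prescribed at the two ends are those of the general formula with \<open>step x 0 = step x (m + 1) = 0\<close>.
\<close>

lemma sigma_eq:
  assumes x: "is_partition m a b x" and i: "1 \<le> i" "i \<le> m"
  shows "sigma m x i = step x i / (step x (i - 1) + step x i)"
    and "sigma' m x (i + 1) = step x i / (step x i + step x (i + 1))"
proof -
  note S = partition_steps[OF x]
  have p: "0 < step x i" using S(1) i by simp
  show "sigma m x i = step x i / (step x (i - 1) + step x i)"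
    using p i S(2) unfolding sigma_def by auto
  show "sigma' m x (i + 1) = step x i / (step x i + step x (i + 1))"
  proof (cases "i = m")
    case True
    then show ?thesis using p i S(3) unfolding sigma'_def by auto
  next
    case False
    then have "0 < step x (i + 1)" using S(1)[of "i + 1"] i by simp
    then show ?thesis using p i False unfolding sigma'_def sigma_def by (simp add: field_simps)
  qed
qed

text \<open>
  With \<open>s = \<sigma>(i)\<close> and \<open>t = \<sigma>'(i+1)\<close> the correction has the coefficients \<open>- r s\<close> and \<open>- r t\<close>, where \<open>r = s t / (s + t)\<close>.
  They annihilate linear functions, because \<open>s S1\<close> and \<open>t S2\<close> are both the length of the \<open>i\<close>-th interval, and the
  sum of their moduli is \<open>s t \<le> 1\<close>. Hence only the remainders count, at most once.
\<close>

lemma S2_correction: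
  assumes x: "is_partition m a b x" and B: "0 \<le> B"
    and rem: "\<And>k. k \<in> {i - 1, i + 1} \<Longrightarrow> 0 \<le> k \<Longrightarrow> k \<le> m + 1 \<Longrightarrow>
      \<bar>\<phi> k - \<phi> i - A * (midpt x k - midpt x i)\<bar> \<le> B"
  shows "\<bar>coeff_a m x i * (\<phi> (i - 1) - \<phi> i) + coeff_c m x i * (\<phi> (i + 1) - \<phi> i)\<bar> \<le> B"
proof (cases "1 \<le> i \<and> i \<le> m")
  case False
  then show ?thesis using B by (auto simp: coeff_a_def coeff_c_def)
next
  case True
  then have i: "1 \<le> i" "i \<le> m" by auto
  define s where "s = sigma m x i"
  define t where "t = sigma' m x (i + 1)"
  define S1 where "S1 = step x (i - 1) + step x i"
  define S2 where "S2 = step x i + step x (i + 1)"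
  have st: "0 < step x i" "0 \<le> step x (i - 1)" "0 \<le> step x (i + 1)"
  proof -
    note S = partition_steps[OF x]
    show "0 < step x i" using S(1) i by simp
    show "0 \<le> step x (i - 1)" using S(1)[of "i - 1"] S(2) i by (cases "i = 1") auto
    show "0 \<le> step x (i + 1)" using S(1)[of "i + 1"] S(3) i by (cases "i = m") auto
  qed
  have Spos: "0 < S1" "0 < S2" using st by (simp_all add: S1_def S2_def)
  have s: "s = step x i / S1" and t: "t = step x i / S2"
    unfolding s_def t_def S1_def S2_def using sigma_eq[OF x i] by simp_all
  have s01: "0 < s" "s \<le> 1" "0 < t" "t \<le> 1" "s * S1 = step x i" "t * S2 = step x i"
    using st Spos unfolding s t by (simp_all add: S1_def S2_def)
  define r where "r = s * t / (s + t)"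
  have r: "0 \<le> r" "r * (s + t) = s * t" using s01 by (simp_all add: r_def)
  have ac: "coeff_a m x i = - (r * s)" "coeff_c m x i = - (r * t)"
    using i unfolding coeff_a_def coeff_c_def s_def[symmetric] t_def[symmetric] r_def
    by (simp_all add: power2_eq_square mult_ac)
  have d: "midpt x (i - 1) - midpt x i = - S1 / 2" "midpt x (i + 1) - midpt x i = S2 / 2"
    unfolding midpt_def S1_def S2_def step_def by (simp_all add: field_simps)
  define R1 where "R1 = \<phi> (i - 1) - \<phi> i - A * (- S1 / 2)"
  define R2 where "R2 = \<phi> (i + 1) - \<phi> i - A * (S2 / 2)"
  have R: "\<bar>R1\<bar> \<le> B" "\<bar>R2\<bar> \<le> B"
    using rem[of "i - 1"] rem[of "i + 1"] i d by (simp_all add: R1_def R2_def)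
  have "coeff_a m x i * (\<phi> (i - 1) - \<phi> i) + coeff_c m x i * (\<phi> (i + 1) - \<phi> i)
    = - (r * s) * R1 + - (r * t) * R2 + r * A / 2 * (s * S1 - t * S2)"
    unfolding ac R1_def R2_def by (simp add: field_simps)
  also have "\<dots> = - (r * s) * R1 + - (r * t) * R2" using s01 by simp
  also have "\<bar>\<dots>\<bar> \<le> (r * s) * B + (r * t) * B"
    by (rule order_trans[OF abs_triangle_ineq])
      (use r s01 R in \<open>simp add: abs_mult add_mono mult_left_mono\<close>)
  also have "\<dots> = (s * t) * B" by (simp add: r(2)[symmetric] algebra_simps)
  also have "\<dots> \<le> 1 * B" using s01 B by (intro mult_right_mono mult_le_one) auto
  finally show ?thesis by simp
qed

text \<open>
  Each of the two directions contributes a correction of at most \<open>2 h \<omega>\<close>.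
\<close>

lemma mu_S2_near_value:
  fixes f :: "real \<times> real \<Rightarrow> real"
  assumes mn: "1 \<le> m" "1 \<le> n" and x: "is_partition m a b x" and y: "is_partition n c d y"
    and hx: "\<And>i. 1 \<le> i \<Longrightarrow> i \<le> m \<Longrightarrow> step x i \<le> h" and hy: "\<And>j. 1 \<le> j \<Longrightarrow> j \<le> n \<Longrightarrow> step y j \<le> h"
    and rem: "\<And>z z'. z \<in> {a..b} \<times> {c..d} \<Longrightarrow> z' \<in> {a..b} \<times> {c..d} \<Longrightarrow> dist z z' \<le> h \<Longrightarrow>
      \<bar>f z' - f z - fx z * (fst z' - fst z) - fy z * (snd z' - snd z)\<bar>
        \<le> (\<bar>fst z' - fst z\<bar> + \<bar>snd z' - snd z\<bar>) * (2 * \<omega>)"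
    and \<omega>: "0 \<le> \<omega>" and ij: "0 \<le> i" "i \<le> m + 1" "0 \<le> j" "j \<le> n + 1"
  shows "\<bar>mu_S2 m n x y f i j - f (midpt x i, midpt y j)\<bar> \<le> 4 * h * \<omega>"
proof -
  note inx = partition_in_interval(2)[OF x mn(1)] and iny = partition_in_interval(2)[OF y mn(2)]
  have h: "0 \<le> h" using partition_step_bounds[OF x mn(1) hx, of 0] mn by force
  have nb: "\<bar>midpt x k - midpt x i\<bar> \<le> h" if "is_partition m a b x" "1 \<le> m"
    "\<And>i. 1 \<le> i \<Longrightarrow> i \<le> m \<Longrightarrow> step x i \<le> h"
    "0 \<le> i" "i \<le> m + 1" "k \<in> {i - 1, i + 1}" "0 \<le> k" "k \<le> m + 1" for m a b x i k
  proof -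
    note st = partition_step_bounds[OF that(1,2,3)]
    have "k = i - 1 \<or> k = i + 1" using that by simp
    then show ?thesis
    proof
      assume k: "k = i - 1"
      have "midpt x i - midpt x k = step x k / 2 + step x i / 2"
        unfolding k midpt_def step_def by (simp add: field_simps)
      then show ?thesis using st[of i] st[of k] that by (simp add: abs_le_iff)
    next
      assume k: "k = i + 1"
      have "midpt x k - midpt x i = step x k / 2 + step x i / 2"
        unfolding k midpt_def step_def by (simp add: field_simps)
      then show ?thesis using st[of i] st[of k] that by (simp add: abs_le_iff)
    qed
  qed
  let ?M = "(midpt x i, midpt y j)"
  have M: "?M \<in> {a..b} \<times> {c..d}" using inx[of i] iny[of j] ij by simp
  have 1: "\<bar>coeff_a m x i * (f (midpt x (i - 1), midpt y j) - f ?M)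
      + coeff_c m x i * (f (midpt x (i + 1), midpt y j) - f ?M)\<bar> \<le> 2 * h * \<omega>"
  proof (rule S2_correction[OF x, where A = "fx ?M"])
    fix k assume k: "k \<in> {i - 1, i + 1}" "0 \<le> k" "k \<le> m + 1"
    have P: "(midpt x k, midpt y j) \<in> {a..b} \<times> {c..d}" using inx[of k] iny[of j] k ij by simp
    have d: "\<bar>midpt x k - midpt x i\<bar> \<le> h" by (rule nb[OF x mn(1) hx ij(1,2) k])
    have "dist ?M (midpt x k, midpt y j) \<le> h"
      using dist_pair_le[of "midpt x i" "midpt y j" "midpt x k" "midpt y j"] d by (simp add: abs_minus_commute)
    from rem[OF M P this]
    have "\<bar>f (midpt x k, midpt y j) - f ?M - fx ?M * (midpt x k - midpt x i)\<bar> \<le> \<bar>midpt x k - midpt x i\<bar> * (2 * \<omega>)"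
      by simp
    also have "\<dots> \<le> h * (2 * \<omega>)" using d \<omega> by (intro mult_right_mono) auto
    finally show "\<bar>f (midpt x k, midpt y j) - f ?M - fx ?M * (midpt x k - midpt x i)\<bar> \<le> 2 * h * \<omega>" by simp
  qed (use h \<omega> in simp)
  have 2: "\<bar>coeff_a n y j * (f (midpt x i, midpt y (j - 1)) - f ?M)
      + coeff_c n y j * (f (midpt x i, midpt y (j + 1)) - f ?M)\<bar> \<le> 2 * h * \<omega>"
  proof (rule S2_correction[OF y, where A = "fy ?M"])
    fix k assume k: "k \<in> {j - 1, j + 1}" "0 \<le> k" "k \<le> n + 1"
    have P: "(midpt x i, midpt y k) \<in> {a..b} \<times> {c..d}" using inx[of i] iny[of k] k ij by simp
    have d: "\<bar>midpt y k - midpt y j\<bar> \<le> h" by (rule nb[OF y mn(2) hy ij(3,4) k])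
    have "dist ?M (midpt x i, midpt y k) \<le> h"
      using dist_pair_le[of "midpt x i" "midpt y j" "midpt x i" "midpt y k"] d by (simp add: abs_minus_commute)
    from rem[OF M P this]
    have "\<bar>f (midpt x i, midpt y k) - f ?M - fy ?M * (midpt y k - midpt y j)\<bar> \<le> \<bar>midpt y k - midpt y j\<bar> * (2 * \<omega>)"
      by simp
    also have "\<dots> \<le> h * (2 * \<omega>)" using d \<omega> by (intro mult_right_mono) auto
    finally show "\<bar>f (midpt x i, midpt y k) - f ?M - fy ?M * (midpt y k - midpt y j)\<bar> \<le> 2 * h * \<omega>" by simp
  qed (use h \<omega> in simp)
  have "mu_S2 m n x y f i j - f ?M
    = (coeff_a m x i * (f (midpt x (i - 1), midpt y j) - f ?M)
      + coeff_c m x i * (f (midpt x (i + 1), midpt y j) - f ?M))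
    + (coeff_a n y j * (f (midpt x i, midpt y (j - 1)) - f ?M)
      + coeff_c n y j * (f (midpt x i, midpt y (j + 1)) - f ?M))"
    unfolding mu_S2_def coeff_b_def by (simp add: algebra_simps)
  then show ?thesis using 1 2 by linarith
qed

text \<open>
  The corners are symmetric about the centre, so the affine parts cancel in the mean over the four corners.
\<close>

lemma mu_W2_near_value:
  fixes f :: "real \<times> real \<Rightarrow> real"
  assumes mn: "1 \<le> m" "1 \<le> n" and x: "is_partition m a b x" and y: "is_partition n c d y"
    and hx: "\<And>i. 1 \<le> i \<Longrightarrow> i \<le> m \<Longrightarrow> step x i \<le> h" and hy: "\<And>j. 1 \<le> j \<Longrightarrow> j \<le> n \<Longrightarrow> step y j \<le> h"
    and rem: "\<And>z z'. z \<in> {a..b} \<times> {c..d} \<Longrightarrow> z' \<in> {a..b} \<times> {c..d} \<Longrightarrow> dist z z' \<le> h \<Longrightarrow>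
      \<bar>f z' - f z - fx z * (fst z' - fst z) - fy z * (snd z' - snd z)\<bar>
        \<le> (\<bar>fst z' - fst z\<bar> + \<bar>snd z' - snd z\<bar>) * (2 * \<omega>)"
    and \<omega>: "0 \<le> \<omega>" and ij: "0 \<le> i" "i \<le> m + 1" "0 \<le> j" "j \<le> n + 1"
  shows "\<bar>mu_W2 x y f i j - f (midpt x i, midpt y j)\<bar> \<le> 2 * h * \<omega>"
proof -
  let ?M = "(midpt x i, midpt y j)"
  define p where "p = step x i / 2"
  define q where "q = step y j / 2"
  have M: "?M \<in> {a..b} \<times> {c..d}"
    using partition_in_interval(2)[OF x mn(1), of i] partition_in_interval(2)[OF y mn(2), of j] ij by simp
  have pq: "0 \<le> p" "p \<le> h / 2" "0 \<le> q" "q \<le> h / 2"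
    using partition_step_bounds[OF x mn(1) hx ij(1,2)] partition_step_bounds[OF y mn(2) hy ij(3,4)]
    by (simp_all add: p_def q_def)
  have xs: "x (i - 1) - midpt x i = - p" "x i - midpt x i = p"
    and ys: "y (j - 1) - midpt y j = - q" "y j - midpt y j = q"
    unfolding p_def q_def midpt_def step_def by (simp_all add: field_simps)
  have corner: "\<bar>f (s, t) - f ?M - fx ?M * (s - midpt x i) - fy ?M * (t - midpt y j)\<bar> \<le> 2 * h * \<omega>"
    if s: "s \<in> {x (i - 1), x i}" and t: "t \<in> {y (j - 1), y j}" for s t
  proof -
    have "s \<in> {a..b}" "t \<in> {c..d}"
      using s t partition_in_interval(1)[OF x mn(1), of i] partition_in_interval(1)[OF x mn(1), of "i - 1"]
        partition_in_interval(1)[OF y mn(2), of j] partition_in_interval(1)[OF y mn(2), of "j - 1"] ij by auto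
    then have P: "(s, t) \<in> {a..b} \<times> {c..d}" by simp
    have d: "\<bar>s - midpt x i\<bar> \<le> h / 2" "\<bar>t - midpt y j\<bar> \<le> h / 2" using s t xs ys pq by auto
    have "dist ?M (s, t) \<le> h"
      using dist_pair_le[of "midpt x i" "midpt y j" s t] d by (simp add: abs_minus_commute)
    from rem[OF M P this]
    have "\<bar>f (s, t) - f ?M - fx ?M * (s - midpt x i) - fy ?M * (t - midpt y j)\<bar>
        \<le> (\<bar>s - midpt x i\<bar> + \<bar>t - midpt y j\<bar>) * (2 * \<omega>)" by simp
    also have "\<dots> \<le> h * (2 * \<omega>)" using d \<omega> by (intro mult_right_mono) auto
    finally show ?thesis by simp
  qed
  have c: "\<bar>f (x (i - 1), y (j - 1)) - f ?M + fx ?M * p + fy ?M * q\<bar> \<le> 2 * h * \<omega>"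
    "\<bar>f (x (i - 1), y j) - f ?M + fx ?M * p - fy ?M * q\<bar> \<le> 2 * h * \<omega>"
    "\<bar>f (x i, y (j - 1)) - f ?M - fx ?M * p + fy ?M * q\<bar> \<le> 2 * h * \<omega>"
    "\<bar>f (x i, y j) - f ?M - fx ?M * p - fy ?M * q\<bar> \<le> 2 * h * \<omega>"
    using corner[of "x (i - 1)" "y (j - 1)"] corner[of "x (i - 1)" "y j"]
      corner[of "x i" "y (j - 1)"] corner[of "x i" "y j"] by (simp_all add: xs ys)
  have avg: "\<bar>2 * M - (A + B + C + D) / 4 - M\<bar> \<le> E"
    if "\<bar>A - M + P + Q\<bar> \<le> E" "\<bar>B - M + P - Q\<bar> \<le> E" "\<bar>C - M - P + Q\<bar> \<le> E" "\<bar>D - M - P - Q\<bar> \<le> E"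
    for A B C D M P Q E :: real using that unfolding abs_le_iff by argo
  show ?thesis unfolding mu_W2_def by (rule avg[OF c])
qed

section \<open>The error bound\<close>

text \<open>
  The hypothesis on \<open>\<mu>\<close> is what distinguishes one quasi-interpolant from another: an estimate that only uses
  first-order remainders. Since \<open>h/\<delta> \<ge> 1\<close>, all but 1 of the constant 8 can be absorbed into the term with \<open>h/\<delta>\<close>.
\<close>

lemma quasi_interpolant_derivative_error:
  assumes mn: "1 \<le> m" "1 \<le> n" and x: "is_partition m a b x" and y: "is_partition n c d y"
    and u: "extended_knots m x u" and v: "extended_knots n y v"
    and h: "h = mesh_max m n x y" and \<delta>: "\<delta> = mesh_min m n x y"
    and \<alpha>: "fst \<alpha> + snd \<alpha> = 1"
    and Q: "\<And>f z. Q f z = (\<Sum>i\<in>{0..m + 1}. \<Sum>j\<in>{0..n + 1}. \<mu> f i j * bspline m n x y u v i j z)"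
    and \<mu>: "\<And>f fx fy \<omega> i j. \<lbrakk>\<And>z z'. z \<in> {a..b} \<times> {c..d} \<Longrightarrow> z' \<in> {a..b} \<times> {c..d} \<Longrightarrow> dist z z' \<le> h \<Longrightarrow>
        \<bar>f z' - f z - fx z * (fst z' - fst z) - fy z * (snd z' - snd z)\<bar>
          \<le> (\<bar>fst z' - fst z\<bar> + \<bar>snd z' - snd z\<bar>) * (2 * \<omega>);
        0 \<le> \<omega>; 0 \<le> i; i \<le> m + 1; 0 \<le> j; j \<le> n + 1\<rbrakk>
      \<Longrightarrow> \<bar>\<mu> f i j - f (midpt x i, midpt y j)\<bar> \<le> K * h * \<omega>"
    and f: "C1_on ({a..b} \<times> {c..d}) f"
  shows "sup_norm ({a..b} \<times> {c..d})
      (\<lambda>p. partial_deriv ({a..b} \<times> {c..d}) \<alpha> f p - partial_deriv ({a..b} \<times> {c..d}) \<alpha> (Q f) p)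
    \<le> (1 + (7 + 4 * K) * (h / \<delta>)) * deriv_modulus ({a..b} \<times> {c..d}) 1 f (h / 2)"
proof -
  let ?\<Omega> = "{a..b} \<times> {c..d}"
  let ?U = "extend_knots m u" and ?V = "extend_knots n v"
  let ?w = "lifted_net m n x y u v (\<mu> f)"
  define fx where "fx = partial_x ?\<Omega> f"
  define fy where "fy = partial_y ?\<Omega> f"
  define \<omega> where "\<omega> = deriv_modulus ?\<Omega> 1 f (h / 2)"
  note U = knot_line_extend_knots[OF mn(1) u] and V = knot_line_extend_knots[OF mn(2) v]
  have ab: "a < b" and cd: "c < d"
  proof -
    have "x 0 < x 1" "x 1 \<le> x m" "y 0 < y 1" "y 1 \<le> y n"
      using partition_steps(1)[OF x, of 1] partition_steps(1)[OF y, of 1] mn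
        partition_mono[OF x mn(1), of 1 m] partition_mono[OF y mn(2), of 1 n] by (simp_all add: step_def)
    then show "a < b" "c < d" using x y unfolding is_partition_def by auto
  qed
  have fin: "finite (steps m n x y)" by (simp add: steps_def)
  have mem: "1 \<le> i \<Longrightarrow> i \<le> m \<Longrightarrow> step x i \<in> steps m n x y" "1 \<le> j \<Longrightarrow> j \<le> n \<Longrightarrow> step y j \<in> steps m n x y" for i j
    by (auto simp: steps_def)
  have hx: "step x i \<le> h" "\<delta> \<le> step x i" if "1 \<le> i" "i \<le> m" for i
    unfolding h \<delta> mesh_max_def mesh_min_def using fin mem(1)[OF that] by simp_all
  have hy: "step y j \<le> h" "\<delta> \<le> step y j" if "1 \<le> j" "j \<le> n" for j
    unfolding h \<delta> mesh_max_def mesh_min_def using fin mem(2)[OF that] by simp_all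
  have "\<delta> \<in> steps m n x y"
    unfolding \<delta> mesh_min_def using fin mem(1)[of 1] mn by (intro Min_in) auto
  then have dpos: "0 < \<delta>" using partition_steps(1)[OF x] partition_steps(1)[OF y] by (auto simp: steps_def)
  have hd: "\<delta> \<le> h" using hx[of 1] mn by simp
  note part = C1_on_rectangle_partials[OF f ab cd, folded fx_def fy_def]
  have comp: "compact ?\<Omega>" by (intro compact_Times compact_Icc)
  have conv: "convex ?\<Omega>" by (intro convex_Times convex_closed_interval)
  have mx: "\<bar>fx z - fx z'\<bar> \<le> \<omega>" if "z \<in> ?\<Omega>" "z' \<in> ?\<Omega>" "dist z z' \<le> h / 2" for z z'
    using le_modulus[OF comp part(2) that] le_deriv_modulus_1(1)[of ?\<Omega> f "h / 2"] unfolding fx_def \<omega>_def by linarith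
  have my: "\<bar>fy z - fy z'\<bar> \<le> \<omega>" if "z \<in> ?\<Omega>" "z' \<in> ?\<Omega>" "dist z z' \<le> h / 2" for z z'
    using le_modulus[OF comp part(3) that] le_deriv_modulus_1(2)[of ?\<Omega> f "h / 2"] unfolding fy_def \<omega>_def by linarith
  have \<omega>: "0 \<le> \<omega>" using mx[of "(a, c)" "(a, c)"] ab cd hd dpos by simp
  have rem: "\<bar>f z' - f z - fx z * (fst z' - fst z) - fy z * (snd z' - snd z)\<bar>
      \<le> (\<bar>fst z' - fst z\<bar> + \<bar>snd z' - snd z\<bar>) * (2 * \<omega>)" if "z \<in> ?\<Omega>" "z' \<in> ?\<Omega>" "dist z z' \<le> h" for z z'
  proof -
    have "dist z z' \<le> real 2 * (h / 2)" using that(3) by simp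
    from first_order_remainder[OF conv part(1) mx my that(1,2) this] show ?thesis by simp
  qed
  have near: "\<bar>\<mu> f i j - f (midpt x i, midpt y j)\<bar> \<le> K * h * \<omega>"
    if "0 \<le> i" "i \<le> m + 1" "0 \<le> j" "j \<le> n + 1" for i j
    by (rule \<mu>[OF rem \<omega> that])
  have Qf: "Q f = spline ?U ?V ?w"
    by (rule ext) (rule trans[OF Q quasi_interpolant_eq_spline[OF mn u v]])
  have le: "(8 + 4 * K * (h / \<delta>)) * \<omega> \<le> (1 + (7 + 4 * K) * (h / \<delta>)) * \<omega>"
  proof (rule mult_right_mono[OF _ \<omega>])
    have "8 + 4 * K * r \<le> 1 + (7 + 4 * K) * r" if "1 \<le> r" for r using that by (simp add: distrib_right)
    moreover have "1 \<le> h / \<delta>" using hd dpos by simp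
    ultimately show "8 + 4 * K * (h / \<delta>) \<le> 1 + (7 + 4 * K) * (h / \<delta>)" by blast
  qed
  have dQ: "(Q f has_derivative (\<lambda>v. spline_dx ?U ?V ?w z * fst v
      + spline_dx ?V ?U (transpose_net ?w) (prod.swap z) * snd v)) (at z within ?\<Omega>)" for z
    unfolding Qf by (rule has_derivative_at_withinI[OF spline_has_derivative[OF U V]])
  have error_x: "\<bar>partial_x ?\<Omega> f z - partial_x ?\<Omega> (Q f) z\<bar> \<le> (8 + 4 * K * (h / \<delta>)) * \<omega>" if z: "z \<in> ?\<Omega>" for z
  proof -
    have "\<bar>spline_dx ?U ?V ?w z - fx z\<bar> \<le> (8 + 4 * K * (h / \<delta>)) * \<omega>"
      by (rule spline_dx_error[OF mn x y u v hx(1) hy(1) dpos hx(2) part(1) mx my near z])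
    then show ?thesis
      using partial_x_rectangle[OF dQ z ab] by (simp add: fx_def abs_minus_commute)
  qed
  have error_y: "\<bar>partial_y ?\<Omega> f z - partial_y ?\<Omega> (Q f) z\<bar> \<le> (8 + 4 * K * (h / \<delta>)) * \<omega>" if z: "z \<in> ?\<Omega>" for z
  proof -
    \<comment> \<open>Exchanging the coordinates turns the \<open>y\<close>-derivative into an \<open>x\<close>-derivative.\<close>
    let ?\<Omega>' = "{c..d} \<times> {a..b}"
    have sw: "prod.swap z \<in> ?\<Omega>" if "z \<in> ?\<Omega>'" for z using that by (simp add: mem_Times_iff)
    have ds: "dist (prod.swap z) (prod.swap z') = dist z z'" for z z' :: "real \<times> real"
      by (simp add: dist_prod_def add.commute)
    have "((\<lambda>z. f (prod.swap z)) has_derivative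
        (\<lambda>v. fy (prod.swap z) * fst v + fx (prod.swap z) * snd v)) (at z within ?\<Omega>')" if "z \<in> ?\<Omega>'" for z
    proof -
      have lin: "(prod.swap has_derivative prod.swap) (at z within ?\<Omega>')"
        unfolding prod.swap_def by (auto intro!: derivative_eq_intros)
      have im: "prod.swap ` ?\<Omega>' = ?\<Omega>" by (rule product_swap)
      have "(f has_derivative (\<lambda>v. fx (prod.swap z) * fst v + fy (prod.swap z) * snd v))
          (at (prod.swap z) within prod.swap ` ?\<Omega>')"
        unfolding im by (rule part(1)[OF sw[OF that]])
      from has_derivative_in_compose[OF lin this] show ?thesis by (simp add: add.commute)
    qed
    note f' = this
    have "\<bar>spline_dx ?V ?U (lifted_net n m y x v u (transpose_net (\<mu> f))) (prod.swap z) - fy (prod.swap (prod.swap z))\<bar>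
        \<le> (8 + 4 * K * (h / \<delta>)) * \<omega>"
    proof (rule spline_dx_error[OF mn(2,1) y x v u hy(1) hx(1) dpos hy(2) f'])
      show "\<bar>fy (prod.swap z) - fy (prod.swap z')\<bar> \<le> \<omega>" "\<bar>fx (prod.swap z) - fx (prod.swap z')\<bar> \<le> \<omega>"
        if "z \<in> ?\<Omega>'" "z' \<in> ?\<Omega>'" "dist z z' \<le> h / 2" for z z'
        using mx[OF sw sw, of z z'] my[OF sw sw, of z z'] that by (simp_all add: ds)
      show "\<bar>\<mu> f i j - f (prod.swap (midpt y j, midpt x i))\<bar> \<le> K * h * \<omega>"
        if "0 \<le> j" "j \<le> n + 1" "0 \<le> i" "i \<le> m + 1" for i j
        using near that by simp
      show "prod.swap z \<in> ?\<Omega>'" using z by (simp add: mem_Times_iff)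
    qed
    moreover have "lifted_net n m y x v u (transpose_net (\<mu> f)) = transpose_net ?w"
      by (intro ext lifted_net_transpose)
    ultimately show ?thesis
      using partial_y_rectangle[OF dQ z cd] by (simp add: fy_def abs_minus_commute)
  qed
  have \<alpha>': "\<alpha> = (1, 0) \<or> \<alpha> = (0, 1)" using \<alpha> by (cases \<alpha>) auto
  show ?thesis
    unfolding sup_norm_def \<omega>_def[symmetric]
  proof (rule cSUP_least)
    show "?\<Omega> \<noteq> {}" using ab cd by simp
    fix z assume z: "z \<in> ?\<Omega>"
    have "\<bar>partial_deriv ?\<Omega> \<alpha> f z - partial_deriv ?\<Omega> \<alpha> (Q f) z\<bar> \<le> (8 + 4 * K * (h / \<delta>)) * \<omega>"
      using \<alpha>'
    proof
      assume "\<alpha> = (1, 0)"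
      then show ?thesis using error_x[OF z] by (simp add: partial_deriv_def)
    next
      assume "\<alpha> = (0, 1)"
      then show ?thesis using error_y[OF z] by (simp add: partial_deriv_def)
    qed
    then show "\<bar>partial_deriv ?\<Omega> \<alpha> f z - partial_deriv ?\<Omega> \<alpha> (Q f) z\<bar>
      \<le> (1 + (7 + 4 * K) * (h / \<delta>)) * \<omega>" using le by (rule order_trans)
  qed
qed

theorem theorem4:
  fixes m n :: int
    and a b c d :: real
    and x y u v :: "int \<Rightarrow> real"
    and \<Omega> :: "(real \<times> real) set"
    and h \<delta> :: real
    and \<alpha> :: "nat \<times> nat"
  assumes "1 \<le> m" and "1 \<le> n"
    and "\<Omega> = {a..b} \<times> {c..d}"
    and "is_partition m a b x" and "is_partition n c d y"
    and "extended_knots m x u" and "extended_knots n y v"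
    and "h = mesh_max m n x y" and "\<delta> = mesh_min m n x y"
    and "fst \<alpha> + snd \<alpha> = 1"
  shows
    "(\<exists>C>0. C \<le> 120 \<and>
        (\<forall>f. C1_on \<Omega> f \<longrightarrow>
          sup_norm \<Omega> (\<lambda>p. partial_deriv \<Omega> \<alpha> f p - partial_deriv \<Omega> \<alpha> (S2 m n x y u v f) p)
            \<le> (1 + C * (h / \<delta>)) * deriv_modulus \<Omega> 1 f (h / 2))) \<and>
     (\<exists>C>0. C \<le> 70 \<and>
        (\<forall>f. C1_on \<Omega> f \<longrightarrow>
          sup_norm \<Omega> (\<lambda>p. partial_deriv \<Omega> \<alpha> f p - partial_deriv \<Omega> \<alpha> (W2 m n x y u v f) p)
            \<le> (1 + C * (h / \<delta>)) * deriv_modulus \<Omega> 1 f (h / 2)))"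
proof -
  note mn = assms(1,2) and \<Omega> = assms(3) and x = assms(4) and y = assms(5)
  note error = quasi_interpolant_derivative_error[OF mn x y assms(6-10)]
  have hx: "step x i \<le> h" if "1 \<le> i" "i \<le> m" for i
    unfolding assms(8) mesh_max_def using that by (intro Max_ge) (auto simp: steps_def)
  have hy: "step y j \<le> h" if "1 \<le> j" "j \<le> n" for j
    unfolding assms(8) mesh_max_def using that by (intro Max_ge) (auto simp: steps_def)
  have S2: "sup_norm \<Omega> (\<lambda>p. partial_deriv \<Omega> \<alpha> f p - partial_deriv \<Omega> \<alpha> (S2 m n x y u v f) p)
      \<le> (1 + 23 * (h / \<delta>)) * deriv_modulus \<Omega> 1 f (h / 2)" if f: "C1_on \<Omega> f" for f
  proof -
    have "sup_norm \<Omega> (\<lambda>p. partial_deriv \<Omega> \<alpha> f p - partial_deriv \<Omega> \<alpha> (S2 m n x y u v f) p)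
      \<le> (1 + (7 + 4 * 4) * (h / \<delta>)) * deriv_modulus \<Omega> 1 f (h / 2)"
      unfolding \<Omega>
    proof (rule error[where \<mu> = "mu_S2 m n x y"])
      show "S2 m n x y u v f z = (\<Sum>i\<in>{0..m + 1}. \<Sum>j\<in>{0..n + 1}. mu_S2 m n x y f i j * bspline m n x y u v i j z)" for f z
        by (rule S2_def)
    qed (rule mu_S2_near_value[OF mn x y hx hy], assumption+, rule f[unfolded \<Omega>])
    then show ?thesis by simp
  qed
  have W2: "sup_norm \<Omega> (\<lambda>p. partial_deriv \<Omega> \<alpha> f p - partial_deriv \<Omega> \<alpha> (W2 m n x y u v f) p)
      \<le> (1 + 15 * (h / \<delta>)) * deriv_modulus \<Omega> 1 f (h / 2)" if f: "C1_on \<Omega> f" for f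
  proof -
    have "sup_norm \<Omega> (\<lambda>p. partial_deriv \<Omega> \<alpha> f p - partial_deriv \<Omega> \<alpha> (W2 m n x y u v f) p)
      \<le> (1 + (7 + 4 * 2) * (h / \<delta>)) * deriv_modulus \<Omega> 1 f (h / 2)"
      unfolding \<Omega>
    proof (rule error[where \<mu> = "mu_W2 x y"])
      show "W2 m n x y u v f z = (\<Sum>i\<in>{0..m + 1}. \<Sum>j\<in>{0..n + 1}. mu_W2 x y f i j * bspline m n x y u v i j z)" for f z
        by (rule W2_def)
    qed (rule mu_W2_near_value[OF mn x y hx hy], assumption+, rule f[unfolded \<Omega>])
    then show ?thesis by simp
  qed
  show ?thesis
    using S2 W2 by (intro conjI exI[of _ "23 :: real"] exI[of _ "15 :: real"]) auto
qed

end
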